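(* In the covariate-adaptive randomization setting described in the context, suppose that as $n\to\infty$: (A1) (global balance) $n^{-1}\sum_{i=1}^n(2T_i-1)\overset{p}{\rightarrow}0$; (A2) (covariate balance) $n^{-1/2}\sum_{i=1}^n(2T_i-1)\bm{x}_i\overset{d}{\rightarrow}\bm{\xi}$, where $\bm{\xi}$ is a $(p+q)$-dimensional random vector with $\mathbb{E}[\bm{\xi}]=\bm{0}$. Let $\mathbf{C}$ be a fixed $m\times(p+2)$ matrix of rank $m$ ($m\le p$) whose first two columns are zero, and let $S^*$ be the test statistic in the context for $H_0:\mathbf{C}\bm{\theta}=\bm{c}_0$ versus $H_1:\mathbf{C}\bm{\theta}=\bm{c}_1$. 1. If $\mathbf{C}\bm{\theta}=\bm{c}_0$, then $S^*\overset{d}{\rightarrow}\chi^2_m/m$. 2. If $\mathbf{C}\bm{\theta}=\bm{c}_1$, under a sequence of local alternatives with $\bm{c}_1-\bm{c}_0=\bm{\Delta}/\sqrt{n}$ for a fixed $\bm{\Delta}\neq\bm{0}$, then $S^*\overset{d}{\rightarrow}\chi^2_m(\phi)/m$, where $\phi=\bm{\Delta}^t[\mathbf{C}\mathbf{V}^{-1}\mathbf{C}^t]^{-1}\bm{\Delta}/\sigma_w^2$ is the non-centrality parameter and $\mathbf{V}=\mathrm{diag}(1/2,1/2,\mathrm{Var}(X_1),\dots,\mathrm{Var}(X_p))$.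
   Context: Setting. Fix integers $p,q\ge 0$. For each $n$ there are $n$ units; $T_i\in\{0,1\}$ is the treatment assignment of unit $i$ ($T_i=1$ for treatment 1, $T_i=0$ for treatment 2), possibly depending on $n$, and $\bm{x}_i=(x_{i,1},\dots,x_{i,p+q})^t$ is its covariate vector. The vectors $\bm{x}_i$ are i.i.d. over $i$; $x_{i,j}$ is distributed as $X_j$, the covariates $X_1,\dots,X_{p+q}$ are independent of each other, with $\mathbb{E}X_j=0$ and $0<\mathrm{Var}(X_j)<\infty$. The outcomes follow the true linear model $$Y_i=\mu_1T_i+\mu_2(1-T_i)+\sum_{j=1}^{p+q}\beta_jx_{i,j}+\epsilon_i,$$ where $\epsilon_1,\dots,\epsilon_n$ are i.i.d. with mean $0$ and variance $\sigma_\epsilon^2\in(0,\infty)$, independent of the covariates. The randomization uses only covariate information (and possibly extra external randomness), not the responses: $(T_1,\dots,T_n)$ and all covariates are jointly independent of $(\epsilon_1,\dots,\epsilon_n)$. Working model. Only the first $p$ covariates are included: $\mathbb{E}[Y_i]=\mu_1T_i+\mu_2(1-T_i)+\sum_{j=1}^p\beta_jx_{i,j}$. Write $\bm{Y}=(Y_1,\dots,Y_n)^t$, $\bm{T}=(T_1,\dots,T_n)^t$, $\mathbf{X}_{\mathrm{in}}=(x_{i,j})_{1\le i\le n,1\le j\le p}$, $\bm{\beta}_{\mathrm{in}}=(\beta_1,\dots,\beta_p)^t$, $\bm{1}_n$ the vector of $n$ ones, $\mathbf{G}=[\bm{T};\bm{1}_n-\bm{T};\mathbf{X}_{\mathrm{in}}]$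 (an $n\times(p+2)$ matrix, columns juxtaposed), and $\bm{\theta}=(\mu_1,\mu_2,\bm{\beta}_{\mathrm{in}}^t)^t$. The OLS estimator is $\hat{\bm{\theta}}=(\mathbf{G}^t\mathbf{G})^{-1}\mathbf{G}^t\bm{Y}$ (defined arbitrarily when $\mathbf{G}^t\mathbf{G}$ is singular), and $\hat\sigma_w^2=\Vert\bm{Y}-\mathbf{G}\hat{\bm{\theta}}\Vert^2/(n-p-2)$, $\sigma_w^2=\sigma_\epsilon^2+\sum_{j=1}^q\beta_{p+j}^2\mathrm{Var}(X_{p+j})$. Test statistic for covariate effects: $$S^*=\frac{(\mathbf{C}\hat{\bm{\theta}}-\bm{c}_0)^t[\mathbf{C}(\mathbf{G}^t\mathbf{G})^{-1}\mathbf{C}^t]^{-1}(\mathbf{C}\hat{\bm{\theta}}-\bm{c}_0)}{m\hat\sigma_w^2}.$$ $\chi^2_m$ denotes the chi-squared distribution with $m$ degrees of freedom and $\chi^2_m(\phi)$ the non-central chi-squared distribution with $m$ degrees of freedom and non-centrality parameter $\phi$ (the law of $\Vert N(\bm{v},\mathbf{I}_m)\Vert^2$ with $\Vert\bm{v}\Vert^2=\phi$). *)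

theory Defs
  imports "HOL-Probability.Probability"
begin

section \<open>Modes of convergence\<close>

definition tendsto_in_prob :: "'a measure \<Rightarrow> (nat \<Rightarrow> 'a \<Rightarrow> real) \<Rightarrow> real \<Rightarrow> bool" where
  "tendsto_in_prob M Z c \<longleftrightarrow>
     (\<forall>e>0. (\<lambda>n. measure M {\<omega> \<in> space M. \<bar>Z n \<omega> - c\<bar> > e}) \<longlonglongrightarrow> 0)"

text \<open>Convergence in distribution of random vectors; the limit may live on another probability
  space. For real random variables the library notion \<open>weak_conv_m\<close> is used instead.\<close>

definition tendsto_in_distr ::
    "'a measure \<Rightarrow> (nat \<Rightarrow> 'a \<Rightarrow> real^'k::finite) \<Rightarrow> 'b measure \<Rightarrow> ('b \<Rightarrow> real^'k) \<Rightarrow> bool" where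
  "tendsto_in_distr M Z N \<xi> \<longleftrightarrow>
     (\<forall>f :: real^'k \<Rightarrow> real. continuous_on UNIV f \<and> bounded (range f) \<longrightarrow>
        (\<lambda>n. \<integral>\<omega>. f (Z n \<omega>) \<partial>M) \<longlonglongrightarrow> (\<integral>\<omega>. f (\<xi> \<omega>) \<partial>N))"


section \<open>Chi-squared laws\<close>

text \<open>The normal law \<open>N(v, I\<^sub>m)\<close>, with independent coordinates.\<close>

definition normal_vec :: "real^'m::finite \<Rightarrow> (real^'m) measure" where
  "normal_vec v = density lborel (\<lambda>z. ennreal (\<Prod>i\<in>UNIV. normal_density (v $ i) 1 (z $ i)))"

definition chi_squared :: "'m::finite itself \<Rightarrow> real measure" where
  "chi_squared _ = distr (normal_vec (0 :: real^'m)) borel (\<lambda>z. (norm z)\<^sup>2)"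

text \<open>The choice of the mean vector is immaterial, see \<open>noncentral_chi_squared_eq\<close> below.\<close>

definition noncentral_chi_squared :: "'m::finite itself \<Rightarrow> real \<Rightarrow> real measure" where
  "noncentral_chi_squared _ \<phi> =
     distr (normal_vec (SOME v :: real^'m. (norm v)\<^sup>2 = \<phi>)) borel (\<lambda>z. (norm z)\<^sup>2)"

lemma normal_vec_density:
  fixes v z :: "real^'m::finite"
  shows "(\<Prod>i\<in>UNIV. normal_density (v $ i) 1 (z $ i)) =
    (1 / sqrt (2 * pi)) ^ CARD('m) * exp (- (norm (z - v))\<^sup>2 / 2)"
proof -
  have "(norm (z - v))\<^sup>2 = (\<Sum>i\<in>UNIV. (z $ i - v $ i)\<^sup>2)"
    by (simp add: norm_vec_def L2_set_def sum_nonneg)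
  then have "exp (- (norm (z - v))\<^sup>2 / 2) = (\<Prod>i\<in>UNIV. exp (- (z $ i - v $ i)\<^sup>2 / 2))"
    by (simp add: exp_sum [symmetric] sum_negf sum_divide_distrib)
  then show ?thesis
    by (simp add: normal_density_def prod_dividef power_divide)
qed

lemma distr_lborel_orthogonal:
  fixes f :: "'v::euclidean_space \<Rightarrow> 'v"
  assumes f: "orthogonal_transformation f"
  shows "distr lborel borel f = lborel"
proof (rule measure_eqI)
  fix A assume "A \<in> sets (distr lborel borel f)"
  then have A [measurable]: "A \<in> sets borel" by simp
  have lin: "linear f" using f by (rule orthogonal_transformation_linear)
  have meas [measurable]: "f \<in> borel_measurable borel"
    using lin by (intro borel_measurable_continuous_onI linear_continuous_on)
      (simp add: linear_conv_bounded_linear)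
  define g where "g = inv f"
  have fg: "f (g y) = y" for y
    unfolding g_def using orthogonal_transformation_surj[OF f] by (rule surj_f_inv_f)
  define K where "K = ball (0::'v) 1"
  have K [measurable]: "K \<in> sets borel" by (simp add: K_def)
  define b where "b = emeasure lborel K"
  have ball: "emeasure lborel (ball (c::'v) 1) = b" for c
    by (simp add: b_def K_def emeasure_ball)
  have b: "b \<noteq> 0" "b \<noteq> top"
    using unit_ball_vol_pos[of "real DIM('v)"] by (auto simp: b_def K_def emeasure_ball simp del: unit_ball_vol_pos)
  have shift: "(\<integral>\<^sup>+x. h x \<partial>lborel) = (\<integral>\<^sup>+x. h (c + x) \<partial>lborel)"
    if [measurable]: "h \<in> borel_measurable borel" for h :: "'v \<Rightarrow> ennreal" and c
  proof -
    have "(\<integral>\<^sup>+x. h x \<partial>lborel) = (\<integral>\<^sup>+x. h x \<partial>distr lborel borel ((+) c))"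
      by (simp add: lborel_distr_plus)
    also have "\<dots> = (\<integral>\<^sup>+x. h (c + x) \<partial>lborel)"
      by (subst nn_integral_distr) simp_all
    finally show ?thesis .
  qed
  let ?A = "indicator A :: 'v \<Rightarrow> ennreal" and ?K = "indicator K :: 'v \<Rightarrow> ennreal"
  have "emeasure lborel (f -` A) = (\<integral>\<^sup>+x. ?A (f x) \<partial>lborel)"
  proof -
    have "?A (f x) = indicator (f -` A) x" for x by (simp add: indicator_def)
    then show ?thesis using measurable_sets[OF meas A] by simp
  qed
  then have "emeasure lborel (f -` A) * b = (\<integral>\<^sup>+y. (\<integral>\<^sup>+x. ?A (f x) * ?K y \<partial>lborel) \<partial>lborel)"
    by (simp add: nn_integral_multc nn_integral_cmult_indicator b_def)
  also have "\<dots> = (\<integral>\<^sup>+y. (\<integral>\<^sup>+x. ?A (f x + y) * ?K y \<partial>lborel) \<partial>lborel)"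
  proof (rule nn_integral_cong)
    fix y
    show "(\<integral>\<^sup>+x. ?A (f x) * ?K y \<partial>lborel) = (\<integral>\<^sup>+x. ?A (f x + y) * ?K y \<partial>lborel)"
      by (subst shift[of _ "g y"]) (simp_all add: linear_add[OF lin] fg add.commute)
  qed
  also have "\<dots> = (\<integral>\<^sup>+x. (\<integral>\<^sup>+y. ?A (f x + y) * ?K y \<partial>lborel) \<partial>lborel)"
    by (rule lborel_pair.Fubini') measurable
  also have "\<dots> = (\<integral>\<^sup>+x. (\<integral>\<^sup>+y. ?A y * ?K (y - f x) \<partial>lborel) \<partial>lborel)"
  proof (rule nn_integral_cong)
    fix x
    show "(\<integral>\<^sup>+y. ?A (f x + y) * ?K y \<partial>lborel) = (\<integral>\<^sup>+y. ?A y * ?K (y - f x) \<partial>lborel)"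
      by (subst (2) shift[of _ "f x"]) simp_all
  qed
  also have "\<dots> = (\<integral>\<^sup>+y. (\<integral>\<^sup>+x. ?A y * ?K (y - f x) \<partial>lborel) \<partial>lborel)"
    by (rule lborel_pair.Fubini' [symmetric]) measurable
  also have "\<dots> = (\<integral>\<^sup>+y. ?A y * b \<partial>lborel)"
  proof (rule nn_integral_cong)
    fix y
    have "?K (y - f x) = indicator (ball (g y) 1) x" for x
    proof -
      have "norm (y - f x) = norm (f (g y - x))" by (simp add: linear_diff[OF lin] fg)
      also have "\<dots> = dist (g y) x" by (simp add: orthogonal_transformation_norm[OF f] dist_norm)
      finally show ?thesis by (simp add: indicator_def K_def)
    qed
    then show "(\<integral>\<^sup>+x. ?A y * ?K (y - f x) \<partial>lborel) = ?A y * b"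
      by (simp add: nn_integral_cmult_indicator ball)
  qed
  also have "\<dots> = emeasure lborel A * b"
    by (simp add: nn_integral_multc)
  finally have "emeasure lborel (f -` A) = emeasure lborel A"
    using b by (simp add: mult.commute[of _ b] ennreal_mult_cancel_left)
  then show "emeasure (distr lborel borel f) A = emeasure lborel A"
    by (simp add: emeasure_distr)
qed simp

lemma noncentral_chi_squared_eq:
  fixes v :: "real^'m::finite"
  assumes "(norm v)\<^sup>2 = \<phi>"
  shows "noncentral_chi_squared TYPE('m) \<phi> = distr (normal_vec v) borel (\<lambda>z. (norm z)\<^sup>2)"
proof -
  define w where "w = (SOME v :: real^'m. (norm v)\<^sup>2 = \<phi>)"
  have "(norm w)\<^sup>2 = \<phi>" unfolding w_def by (rule someI) (rule assms)
  with assms have "norm v = norm w" by (metis norm_ge_zero power2_eq_iff_nonneg)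
  then obtain f where f: "orthogonal_transformation f" and fv: "f v = w"
    using orthogonal_transformation_exists by blast
  have lin: "linear f" using f by (rule orthogonal_transformation_linear)
  have meas [measurable]: "f \<in> borel_measurable borel"
    using lin by (intro borel_measurable_continuous_onI linear_continuous_on) (simp add: linear_conv_bounded_linear)
  have dens: "(\<Prod>i\<in>UNIV. normal_density (w $ i) 1 (f z $ i)) =
      (\<Prod>i\<in>UNIV. normal_density (v $ i) 1 (z $ i))" for z
  proof -
    have "norm (f z - w) = norm (z - v)"
      using orthogonal_transformation_norm [OF f, of "z - v"] by (simp add: linear_diff [OF lin] fv)
    then show ?thesis by (simp only: normal_vec_density)
  qed
  have "normal_vec w = density (distr lborel borel f)
      (\<lambda>z. ennreal (\<Prod>i\<in>UNIV. normal_density (w $ i) 1 (z $ i)))"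
    by (simp add: normal_vec_def distr_lborel_orthogonal [OF f])
  also have "\<dots> = distr (normal_vec v) borel f"
    unfolding normal_vec_def by (subst density_distr) (simp_all add: dens)
  finally have "normal_vec w = distr (normal_vec v) borel f" .
  moreover have "sets (normal_vec v) = sets borel" by (simp add: normal_vec_def)
  then have "f \<in> normal_vec v \<rightarrow>\<^sub>M borel" using meas by (simp cong: measurable_cong_sets)
  ultimately show ?thesis
    unfolding noncentral_chi_squared_def w_def [symmetric]
    by (simp add: distr_distr comp_def orthogonal_transformation_norm [OF f])
qed


section \<open>Least squares\<close>

text \<open>
  The type \<open>'k\<close> indexes all \<open>p + q\<close> covariates and \<open>'p\<close> the \<open>p\<close> covariates of the working model,
  which are placed among all covariates by the injection \<open>inc\<close>; since \<open>inc\<close> may be surjective,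
  the case \<open>q = 0\<close> is included. Coefficient vectors \<open>\<theta>\<close> and columns of \<open>G\<close> are indexed by
  \<open>bool + 'p\<close>: \<open>Inl True\<close> is treatment 1, \<open>Inl False\<close> is treatment 2, and \<open>Inr j\<close> is covariate \<open>j\<close>.
  As the number \<open>n\<close> of rows varies, the matrix \<open>G\<close> and the vector \<open>Y\<close> are sequences of rows and of
  entries, of which the first \<open>n\<close> are used.
\<close>

definition theta :: "('p::finite \<Rightarrow> 'k::finite) \<Rightarrow> real \<Rightarrow> real \<Rightarrow> real^'k \<Rightarrow> real^(bool + 'p)" where
  "theta inc \<mu>\<^sub>1 \<mu>\<^sub>2 \<beta> =
     (\<chi> a. case a of Inl b \<Rightarrow> (if b then \<mu>\<^sub>1 else \<mu>\<^sub>2) | Inr j \<Rightarrow> \<beta> $ inc j)"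

definition design_row :: "('p::finite \<Rightarrow> 'k::finite) \<Rightarrow> real \<Rightarrow> real^'k \<Rightarrow> real^(bool + 'p)" where
  "design_row inc t x =
     (\<chi> a. case a of Inl b \<Rightarrow> (if b then t else 1 - t) | Inr j \<Rightarrow> x $ inc j)"

text \<open>\<open>G\<^sup>t G\<close> and \<open>G\<^sup>t Y\<close>\<close>

definition gram :: "nat \<Rightarrow> (nat \<Rightarrow> real^'c::finite) \<Rightarrow> real^'c^'c" where
  "gram n G = (\<chi> a b. \<Sum>i<n. G i $ a * G i $ b)"

definition cross_moment :: "nat \<Rightarrow> (nat \<Rightarrow> real^'c::finite) \<Rightarrow> (nat \<Rightarrow> real) \<Rightarrow> real^'c" where
  "cross_moment n G Y = (\<chi> a. \<Sum>i<n. G i $ a * Y i)"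

text \<open>On singular matrices \<open>matrix_inv\<close> is an unspecified constant.\<close>

definition ols :: "nat \<Rightarrow> (nat \<Rightarrow> real^'c::finite) \<Rightarrow> (nat \<Rightarrow> real) \<Rightarrow> real^'c" where
  "ols n G Y = matrix_inv (gram n G) *v cross_moment n G Y"

definition sigma_hat2 :: "nat \<Rightarrow> (nat \<Rightarrow> real^(bool + 'p::finite)) \<Rightarrow> (nat \<Rightarrow> real) \<Rightarrow> real" where
  "sigma_hat2 n G Y =
     (\<Sum>i<n. (Y i - G i \<bullet> ols n G Y)\<^sup>2) / (real n - real CARD('p) - 2)"

definition S_star ::
    "real^(bool + 'p::finite)^'m::finite \<Rightarrow> real^'m \<Rightarrow> nat \<Rightarrow> (nat \<Rightarrow> real^(bool + 'p))
      \<Rightarrow> (nat \<Rightarrow> real) \<Rightarrow> real" where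
  "S_star C c\<^sub>0 n G Y =
     (let d = C *v ols n G Y - c\<^sub>0 in
       (d \<bullet> (matrix_inv (C ** matrix_inv (gram n G) ** transpose C) *v d))
         / (real CARD('m) * sigma_hat2 n G Y))"


section \<open>Covariate-adaptive design and outcome model\<close>

text \<open>Units are numbered from \<open>0\<close>; \<open>T n i\<close> is the assignment of unit \<open>i < n\<close> in the experiment with
  \<open>n\<close> units. The last assumption says that the random elements \<open>(T n i, x i)\<^sub>i\<^sub><\<^sub>n\<close> and \<open>(\<epsilon> i)\<^sub>i\<^sub><\<^sub>n\<close>
  are independent; \<open>indep_var\<close> does not apply as their values have different types.\<close>

locale covariate_adaptive_design = prob_space M
  for M :: "'a measure" +
  fixes inc :: "'p::finite \<Rightarrow> 'k::finite"
    and T :: "nat \<Rightarrow> nat \<Rightarrow> 'a \<Rightarrow> real"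
    and x :: "nat \<Rightarrow> 'a \<Rightarrow> real^'k"
    and X :: "'k \<Rightarrow> 'a \<Rightarrow> real"
    and \<epsilon> :: "nat \<Rightarrow> 'a \<Rightarrow> real"
    and \<sigma>\<^sub>\<epsilon>2 :: real
  assumes inj_inc: "inj inc"
    and T_measurable: "\<And>n i. i < n \<Longrightarrow> random_variable borel (T n i)"
    and T_values: "\<And>n i \<omega>. i < n \<Longrightarrow> \<omega> \<in> space M \<Longrightarrow> T n i \<omega> \<in> {0, 1}"
    and X_indep: "indep_vars (\<lambda>_. borel) X UNIV"
    and X_integrable: "\<And>j. integrable M (X j)"
    and X_mean: "\<And>j. expectation (X j) = 0"
    and X_square_integrable: "\<And>j. integrable M (\<lambda>\<omega>. (X j \<omega>)\<^sup>2)"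
    and X_variance: "\<And>j. variance (X j) > 0"
    and x_indep: "indep_vars (\<lambda>_. borel) x UNIV"
    and x_distr: "\<And>i. distr M borel (x i) = distr M borel (\<lambda>\<omega>. \<chi> j. X j \<omega>)"
    and eps_indep: "indep_vars (\<lambda>_. borel) \<epsilon> UNIV"
    and eps_distr: "\<And>i. distr M borel (\<epsilon> i) = distr M borel (\<epsilon> 0)"
    and eps_integrable: "\<And>i. integrable M (\<epsilon> i)"
    and eps_mean: "\<And>i. expectation (\<epsilon> i) = 0"
    and eps_square_integrable: "\<And>i. integrable M (\<lambda>\<omega>. (\<epsilon> i \<omega>)\<^sup>2)"
    and eps_variance: "\<And>i. variance (\<epsilon> i) = \<sigma>\<^sub>\<epsilon>2"
    and eps_variance_pos: "\<sigma>\<^sub>\<epsilon>2 > 0"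
    and design_indep_eps: "\<And>n. indep_set
          (sets (vimage_algebra (space M) (\<lambda>\<omega>. \<lambda>i\<in>{..<n}. (T n i \<omega>, x i \<omega>))
             (Pi\<^sub>M {..<n} (\<lambda>_. borel \<Otimes>\<^sub>M borel))))
          (sets (vimage_algebra (space M) (\<lambda>\<omega>. \<lambda>i\<in>{..<n}. \<epsilon> i \<omega>)
             (Pi\<^sub>M {..<n} (\<lambda>_. borel))))"

text \<open>The true model involves all covariates, not only those in the range of \<open>inc\<close>.\<close>

definition outcome :: "real \<Rightarrow> real \<Rightarrow> real^'k::finite \<Rightarrow> real \<Rightarrow> real^'k \<Rightarrow> real \<Rightarrow> real" where
  "outcome \<mu>\<^sub>1 \<mu>\<^sub>2 \<beta> t x e = \<mu>\<^sub>1 * t + \<mu>\<^sub>2 * (1 - t) + (\<Sum>j\<in>UNIV. \<beta> $ j * x $ j) + e"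

definition S_star_n ::
    "('p::finite \<Rightarrow> 'k::finite) \<Rightarrow> (nat \<Rightarrow> nat \<Rightarrow> 'a \<Rightarrow> real) \<Rightarrow> (nat \<Rightarrow> 'a \<Rightarrow> real^'k)
      \<Rightarrow> (nat \<Rightarrow> 'a \<Rightarrow> real) \<Rightarrow> real^(bool + 'p)^'m::finite \<Rightarrow> real^'m
      \<Rightarrow> real \<Rightarrow> real \<Rightarrow> real^'k \<Rightarrow> nat \<Rightarrow> 'a \<Rightarrow> real" where
  "S_star_n inc T x \<epsilon> C c\<^sub>0 \<mu>\<^sub>1 \<mu>\<^sub>2 \<beta> n \<omega> =
     S_star C c\<^sub>0 n (\<lambda>i. design_row inc (T n i \<omega>) (x i \<omega>))
       (\<lambda>i. outcome \<mu>\<^sub>1 \<mu>\<^sub>2 \<beta> (T n i \<omega>) (x i \<omega>) (\<epsilon> i \<omega>))"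

definition V_matrix ::
    "'a measure \<Rightarrow> ('p::finite \<Rightarrow> 'k::finite) \<Rightarrow> ('k \<Rightarrow> 'a \<Rightarrow> real) \<Rightarrow> real^(bool + 'p)^(bool + 'p)" where
  "V_matrix M inc X = (\<chi> a b. if a = b
     then (case a of Inl _ \<Rightarrow> 1 / 2 | Inr j \<Rightarrow> prob_space.variance M (X (inc j))) else 0)"

definition sigma_w2 ::
    "'a measure \<Rightarrow> ('p::finite \<Rightarrow> 'k::finite) \<Rightarrow> ('k \<Rightarrow> 'a \<Rightarrow> real) \<Rightarrow> real^'k \<Rightarrow> real \<Rightarrow> real" where
  "sigma_w2 M inc X \<beta> \<sigma>\<^sub>\<epsilon>2 =
     \<sigma>\<^sub>\<epsilon>2 + (\<Sum>j\<in>- range inc. (\<beta> $ j)\<^sup>2 * prob_space.variance M (X j))"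

end

theory Submission
  imports Defs
begin

text \<open>
  Put \<open>u\<^sub>i = \<epsilon>\<^sub>i + \<Sum>\<^sub>j\<^sub>>\<^sub>p \<beta>\<^sub>j x\<^sub>i\<^sub>j\<close>, so that \<open>Y = G \<theta> + u\<close>. Up to a set of vanishing probability \<open>S\<^sup>*\<close> is a
  fixed function of \<open>G\<^sup>t G / n\<close>, of the mean of the \<open>u\<^sub>i\<^sup>2\<close>, and of the score
  \<open>z\<^sub>n = n\<^sup>-\<^sup>1\<^sup>/\<^sup>2 G\<^sup>t u\<close>. The balance conditions and the law of large numbers make the first two
  converge to \<open>V\<close> and \<open>\<sigma>\<^sub>w\<^sup>2\<close>, and \<open>z\<^sub>n\<close> is bounded in probability. As \<open>C\<close> ignores the treatment
  columns and \<open>V\<close> is diagonal, the limit only involves the covariate entries of \<open>z\<^sub>n\<close>, which are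
  normalised sums of i.i.d. terms whatever the randomisation is.

  Only the squared norm of an asymptotically Gaussian vector is needed, so that a multivariate
  Levy continuity theorem can be avoided: \<open>exp (- s \<bar>w\<bar>\<^sup>2)\<close> is a Gaussian average of the characters
  \<open>exp (i t \<bullet> w)\<close>. The one-dimensional central limit theorem therefore gives convergence of the Laplace
  transforms of \<open>\<bar>W\<^sub>n\<bar>\<^sup>2\<close>, and by the Weierstrass theorem these determine convergence in law.
\<close>

section \<open>Weak convergence from Laplace transforms\<close>

text \<open>The assignments may depend on all covariates in an arbitrary way, so no limit law is
  available for the treatment entries of the score: their omitted-covariate part is not independent
  of the design. Balance of all covariates, included and omitted, supplies tightness there, which is
  enough for coordinates that carry no weight in the limiting form. The covariates have only second
  moments, while the variance of a covariate entry of the score involves products of two squared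
  covariates. Independence of the included and the omitted covariates makes these products
  integrable and yields the factor \<open>sigma_w2\<close>. Limits are substituted into a function
  that need not be continuous at singular matrices, so continuity is used only over the limit point,
  uniformly for scores in a bounded set. Along local alternatives the parameters move with
  \<open>n\<close>, but the omitted coefficients do not. The score depends on the coefficients only
  through these, so both claims come from one limit theorem with a shift
  \<open>\<Delta>\<close>.\<close>

text \<open>Substituting \<open>y = exp (- x)\<close>, the hypothesis is convergence of moments on \<open>[0, 1]\<close>, and a continuous
  step function of \<open>x\<close> extends continuously to \<open>y = 0\<close>.\<close>

lemma laplace_conv_imp_weak_conv:
  fixes \<mu> :: "nat \<Rightarrow> real measure"
  assumes \<mu>: "\<And>n. real_distribution (\<mu> n)" and \<nu>: "real_distribution \<nu>"
    and nn: "\<And>n. AE x in \<mu> n. 0 \<le> x" "AE x in \<nu>. 0 \<le> x"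
    and lim: "\<And>k::nat. (\<lambda>n. \<integral>x. exp (- (real k * x)) \<partial>\<mu> n) \<longlonglongrightarrow> (\<integral>x. exp (- (real k * x)) \<partial>\<nu>)"
  shows "weak_conv_m \<mu> \<nu>"
proof (rule integral_cts_step_conv_imp_weak_conv[OF \<mu> \<nu>])
  fix a b :: real assume ab: "a < b"
  \<comment> \<open>The step function vanishes to the right of \<open>b\<close>, so raising
    \<open>y\<close> to at least \<open>exp (- b)\<close> before taking the logarithm does not
    change the value at \<open>y = exp (- x)\<close> and makes \<open>g\<close> continuous at
    \<open>y = 0\<close>.\<close>
  define g where "g y = cts_step a b (- ln (max y (exp (- b))))" for y
  have cont: "continuous_on UNIV (cts_step a b)"
    by (rule uniformly_continuous_imp_continuous[OF cts_step_uniformly_continuous[OF ab]])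
  have pos: "0 < max y (exp (- b))" for y by (simp add: less_max_iff_disj)
  have "continuous_on {0..1} (\<lambda>y. - ln (max y (exp (- b))))"
    by (intro continuous_intros) (use pos in \<open>metis less_irrefl\<close>)
  then have g_cont: "continuous_on {0..1} g"
    unfolding g_def by (rule continuous_on_compose2[OF cont]) auto
  have g_exp: "g (exp (- x)) = cts_step a b x" for x
    using ab by (cases "x \<le> b") (simp_all add: g_def cts_step_def max_def)
  have meas [measurable]: "cts_step a b \<in> borel_measurable borel"
    by (rule borel_measurable_continuous_onI[OF cont])
  show "(\<lambda>n. integral\<^sup>L (\<mu> n) (cts_step a b)) \<longlonglongrightarrow> integral\<^sup>L \<nu> (cts_step a b)"
  proof (rule LIMSEQ_I)
    fix e :: real assume "0 < e"
    then have e: "0 < e / 3" by simp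
    obtain h where h: "real_polynomial_function h" and he: "\<And>y. y \<in> {0..1} \<Longrightarrow> \<bar>g y - h y\<bar> < e / 3"
      using Stone_Weierstrass_real_polynomial_function[OF _ g_cont e] by auto
    obtain c d where hc: "h = (\<lambda>y. \<Sum>i\<le>d. c i * y ^ i)"
      using h by (auto simp: real_polynomial_function_iff_sum)
    define H where "H x = (\<Sum>i\<le>d. c i * exp (- (real i * x)))" for x
    have hH: "h (exp (- x)) = H x" for x
      by (simp add: hc H_def exp_of_nat_mult[symmetric])
    \<comment> \<open>A polynomial in \<open>exp (- x)\<close> integrates to a combination of
      Laplace transforms at integers, and the nonnegative support keeps \<open>exp (- x)\<close> in
      the interval of uniform approximation. The bound serves every \<open>\<mu> n\<close> and
      \<open>\<nu>\<close>, hence the thirds of \<open>e\<close>.\<close>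
    have close: "\<bar>integral\<^sup>L m (cts_step a b) - (\<Sum>i\<le>d. c i * (\<integral>x. exp (- (real i * x)) \<partial>m))\<bar> \<le> e / 3"
      if m: "real_distribution m" "AE x in m. 0 \<le> x" for m
    proof -
      interpret real_distribution m by (rule m)
      have int: "integrable m (\<lambda>x. exp (- (real i * x)))" for i
        by (rule integrable_const_bound[of _ 1]) (use m(2) in auto)
      have intH: "integrable m H" unfolding H_def using int by (intro Bochner_Integration.integrable_sum integrable_mult_right)
      have intS: "integrable m (cts_step a b)"
        by (rule integrable_cts_step[OF ab])
      have "(\<Sum>i\<le>d. c i * (\<integral>x. exp (- (real i * x)) \<partial>m)) = integral\<^sup>L m H"
        unfolding H_def using int by simp
      moreover have "\<bar>integral\<^sup>L m (\<lambda>x. cts_step a b x - H x)\<bar> \<le> integral\<^sup>L m (\<lambda>x. e / 3)"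
      proof (rule order_trans[OF integral_abs_bound integral_mono_AE])
        show "AE x in m. \<bar>cts_step a b x - H x\<bar> \<le> e / 3"
          using m(2)
        proof eventually_elim
          case (elim x)
          show ?case using he[of "exp (- x)"] elim by (simp add: g_exp hH)
        qed
      qed (use intH intS in auto)
      ultimately show ?thesis using intH intS prob_space by simp
    qed
    have "(\<lambda>n. \<Sum>i\<le>d. c i * (\<integral>x. exp (- (real i * x)) \<partial>\<mu> n)) \<longlonglongrightarrow>
        (\<Sum>i\<le>d. c i * (\<integral>x. exp (- (real i * x)) \<partial>\<nu>))"
      by (intro tendsto_intros lim)
    from LIMSEQ_D[OF this e] obtain n0 where n0:
      "\<And>n. n \<ge> n0 \<Longrightarrow> \<bar>(\<Sum>i\<le>d. c i * (\<integral>x. exp (- (real i * x)) \<partial>\<mu> n)) -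
        (\<Sum>i\<le>d. c i * (\<integral>x. exp (- (real i * x)) \<partial>\<nu>))\<bar> < e / 3"
      by auto
    show "\<exists>no. \<forall>n\<ge>no. norm (integral\<^sup>L (\<mu> n) (cts_step a b) - integral\<^sup>L \<nu> (cts_step a b)) < e"
    proof (intro exI allI impI)
      fix n assume "n0 \<le> n"
      from n0[OF this] close[OF \<mu> nn(1), of n] close[OF \<nu> nn(2)]
      show "norm (integral\<^sup>L (\<mu> n) (cts_step a b) - integral\<^sup>L \<nu> (cts_step a b)) < e"
        unfolding real_norm_def by linarith
    qed
  qed
qed

text \<open>Continuous step functions determine weak convergence and are uniformly continuous with
  values in [0, 1]. Where \<open>S n\<close> and \<open>Q n\<close> are close the integrands differ
  little; elsewhere they differ by at most 1, on an event of vanishing probability.\<close>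

lemma (in prob_space) weak_conv_slutsky:
  fixes Q S :: "nat \<Rightarrow> 'a \<Rightarrow> real"
  assumes Q [measurable]: "\<And>n. random_variable borel (Q n)"
    and S [measurable]: "\<And>n. random_variable borel (S n)"
    and \<nu>: "real_distribution \<nu>" and conv: "weak_conv_m (\<lambda>n. distr M borel (Q n)) \<nu>"
    and diff: "tendsto_in_prob M (\<lambda>n \<omega>. S n \<omega> - Q n \<omega>) 0"
  shows "weak_conv_m (\<lambda>n. distr M borel (S n)) \<nu>"
proof (rule integral_cts_step_conv_imp_weak_conv[OF _ \<nu>])
  show "real_distribution (distr M borel (S n))" for n
    by (rule real_distribution_distr) simp
  have rQ: "real_distribution (distr M borel (Q n))" for n
    by (rule real_distribution_distr) simp
  fix a b :: real assume ab: "a < b"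
  note ucont = cts_step_uniformly_continuous[OF ab]
  have cont: "continuous_on UNIV (cts_step a b)"
    by (rule uniformly_continuous_imp_continuous[OF ucont])
  have meas [measurable]: "cts_step a b \<in> borel_measurable borel"
    by (rule borel_measurable_continuous_onI[OF cont])
  have bdd: "\<bar>cts_step a b x\<bar> \<le> 1" "0 \<le> cts_step a b x" "cts_step a b x \<le> 1" for x
    using ab by (auto simp: cts_step_def field_simps)
  have lim: "(\<lambda>n. \<integral>\<omega>. cts_step a b (Q n \<omega>) \<partial>M) \<longlonglongrightarrow> integral\<^sup>L \<nu> (cts_step a b)"
    using weak_conv_imp_integral_bdd_continuous_conv[OF rQ \<nu> conv, of "cts_step a b" 1] cont bdd
    by (simp add: integral_distr continuous_on_eq_continuous_at)
  have int: "integrable M (\<lambda>\<omega>. cts_step a b (f \<omega>))" if [measurable]: "random_variable borel f" for f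
    by (rule integrable_const_bound[of _ 1]) (use bdd in auto)
  have "(\<lambda>n. (\<integral>\<omega>. cts_step a b (S n \<omega>) \<partial>M) - (\<integral>\<omega>. cts_step a b (Q n \<omega>) \<partial>M)) \<longlonglongrightarrow> 0"
  proof (rule LIMSEQ_I)
    fix e :: real assume e: "0 < e"
    from uniformly_continuous_onE[OF ucont, of "e / 2"] e obtain d where d: "0 < d"
      and dd: "\<And>x y. \<bar>y - x\<bar> < d \<Longrightarrow> \<bar>cts_step a b y - cts_step a b x\<bar> < e / 2"
      by (auto simp: dist_real_def)
    \<comment> \<open>Half of \<open>d\<close> is taken because outside \<open>A n\<close> the
      difference is only known to be at most the threshold, while uniform continuity asks for less
      than \<open>d\<close>.\<close>
    define A where "A n = {\<omega> \<in> space M. \<bar>S n \<omega> - Q n \<omega> - 0\<bar> > d / 2}" for n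
    have A [measurable]: "A n \<in> events" for n unfolding A_def by measurable
    have "(\<lambda>n. prob (A n)) \<longlonglongrightarrow> 0"
      using diff half_gt_zero[OF d] unfolding tendsto_in_prob_def A_def by blast
    from LIMSEQ_D[OF this, of "e / 2"] e obtain n0 where n0: "\<And>n. n \<ge> n0 \<Longrightarrow> prob (A n) < e / 2"
      by auto
    show "\<exists>no. \<forall>n\<ge>no. norm ((\<integral>\<omega>. cts_step a b (S n \<omega>) \<partial>M) - (\<integral>\<omega>. cts_step a b (Q n \<omega>) \<partial>M) - 0) < e"
    proof (intro exI allI impI)
      fix n assume n: "n0 \<le> n"
      have "\<bar>\<integral>\<omega>. cts_step a b (S n \<omega>) - cts_step a b (Q n \<omega>) \<partial>M\<bar> \<le> (\<integral>\<omega>. e / 2 + indicator (A n) \<omega> \<partial>M)"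
      proof (rule order_trans[OF integral_abs_bound integral_mono])
        show "integrable M (\<lambda>\<omega>. e / 2 + indicat_real (A n) \<omega>)"
          by (intro Bochner_Integration.integrable_add integrable_real_indicator)
            (auto simp: emeasure_eq_measure)
        fix \<omega> assume "\<omega> \<in> space M"
        then show "\<bar>cts_step a b (S n \<omega>) - cts_step a b (Q n \<omega>)\<bar> \<le> e / 2 + indicat_real (A n) \<omega>"
          using dd[of "S n \<omega>" "Q n \<omega>"] bdd(2,3)[of "S n \<omega>"] bdd(2,3)[of "Q n \<omega>"] d e
          by (auto simp: indicator_def A_def not_less simp del: cts_step_def)
      qed (use int in auto)
      also have "\<dots> = e / 2 + prob (A n)"
        by (subst Bochner_Integration.integral_add) (auto simp: prob_space emeasure_eq_measure)
      also have "\<dots> < e" using n0[OF n] by simp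
      finally show "norm ((\<integral>\<omega>. cts_step a b (S n \<omega>) \<partial>M) - (\<integral>\<omega>. cts_step a b (Q n \<omega>) \<partial>M) - 0) < e"
        by (simp add: int)
    qed
  qed
  from tendsto_add[OF this lim] show "(\<lambda>n. integral\<^sup>L (distr M borel (S n)) (cts_step a b)) \<longlonglongrightarrow> integral\<^sup>L \<nu> (cts_step a b)"
    by (simp add: integral_distr)
qed

section \<open>Gaussian vectors and the norm of an asymptotically Gaussian vector\<close>

text \<open>Lebesgue measure on \<open>real^'m\<close> is the image of a product over basis vectors,
  and \<open>idx\<close> recovers the coordinate from a basis vector; Fubini for product functions
  then applies. Values may be real or complex, which covers both the total mass and the
  characteristic function of \<open>normal_vec\<close>.\<close>

lemma
  fixes g :: "'m::finite \<Rightarrow> real \<Rightarrow> 'b::{real_normed_field,banach,second_countable_topology}"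
  assumes g: "\<And>i. integrable lborel (g i)"
  shows integrable_prod_vec: "integrable (lborel :: (real^'m) measure) (\<lambda>z. \<Prod>i\<in>UNIV. g i (z $ i))"
    and integral_prod_vec:
      "(\<integral>z. (\<Prod>i\<in>UNIV. g i (z $ i)) \<partial>(lborel :: (real^'m) measure)) = (\<Prod>i\<in>UNIV. integral\<^sup>L lborel (g i))"
proof -
  interpret product_sigma_finite "\<lambda>_::real^'m. lborel :: real measure" ..
  let ?P = "\<Pi>\<^sub>M b\<in>(Basis :: (real^'m) set). (lborel :: real measure)"
  define S where "S f = (\<Sum>b\<in>Basis. f b *\<^sub>R b)" for f :: "real^'m \<Rightarrow> real"
  define idx where "idx b = (SOME i. b = axis i (1::real))" for b :: "real^'m"
  have idx: "idx (axis i 1) = i" for i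
    unfolding idx_def by (rule some_equality) (auto simp: axis_eq_axis)
  have Basis: "(Basis :: (real^'m) set) = (\<lambda>i. axis i 1) ` UNIV"
    by (auto simp: Basis_vec_def)
  have inj: "inj (\<lambda>i::'m. axis i (1::real))" by (auto simp: inj_on_def axis_eq_axis)
  have S: "S f $ i = f (axis i 1)" for f i
  proof -
    have "S f $ i = S f \<bullet> axis i 1" by (simp add: inner_axis)
    also have "\<dots> = f (axis i 1)"
      unfolding S_def by (rule inner_sum_left_Basis) (auto simp: Basis)
    finally show ?thesis .
  qed
  have S_meas [measurable]: "S \<in> ?P \<rightarrow>\<^sub>M borel" unfolding S_def by measurable
  have eq: "(\<Prod>i\<in>UNIV. g i (S f $ i)) = (\<Prod>b\<in>Basis. g (idx b) (f b))" for f
    unfolding Basis by (subst prod.reindex[OF inj]) (simp add: S idx)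
  have [measurable]: "g i \<in> borel_measurable borel" for i
    using borel_measurable_integrable[OF g[of i]] by simp
  have meas: "(\<lambda>z::real^'m. \<Prod>i\<in>UNIV. g i (z $ i)) \<in> borel_measurable borel"
    by measurable
  have lb: "(lborel :: (real^'m) measure) = distr ?P borel S"
    unfolding S_def by (rule lborel_eq)
  have "integrable ?P (\<lambda>f. \<Prod>b\<in>Basis. g (idx b) (f b))"
    by (rule product_integrable_prod) (auto simp: g)
  then show "integrable (lborel :: (real^'m) measure) (\<lambda>z. \<Prod>i\<in>UNIV. g i (z $ i))"
    unfolding lb by (subst integrable_distr_eq[OF S_meas meas]) (simp add: eq)
  have "(\<integral>z. (\<Prod>i\<in>UNIV. g i (z $ i)) \<partial>(lborel :: (real^'m) measure)) =
      (\<integral>f. (\<Prod>b\<in>Basis. g (idx b) (f b)) \<partial>?P)"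
    unfolding lb by (subst integral_distr[OF S_meas meas]) (simp add: eq)
  also have "\<dots> = (\<Prod>b\<in>Basis. integral\<^sup>L lborel (g (idx b)))"
    by (rule product_integral_prod) (auto simp: g)
  also have "\<dots> = (\<Prod>i\<in>UNIV. integral\<^sup>L lborel (g i))"
    unfolding Basis by (subst prod.reindex[OF inj]) (simp add: idx)
  finally show "(\<integral>z. (\<Prod>i\<in>UNIV. g i (z $ i)) \<partial>(lborel :: (real^'m) measure)) =
    (\<Prod>i\<in>UNIV. integral\<^sup>L lborel (g i))" .
qed

lemma space_normal_vec [simp]: "space (normal_vec v) = UNIV"
  and sets_normal_vec [simp, measurable_cong]: "sets (normal_vec v) = sets borel"
  by (simp_all add: normal_vec_def)

lemma normal_vec_density_measurable [measurable]:
  "(\<lambda>z::real^'m::finite. \<Prod>i\<in>UNIV. normal_density (v $ i) 1 (z $ i)) \<in> borel_measurable borel"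
  by measurable

lemma prob_space_normal_vec: "prob_space (normal_vec (v :: real^'m::finite))"
proof
  let ?d = "\<lambda>z::real^'m. \<Prod>i\<in>UNIV. normal_density (v $ i) 1 (z $ i)"
  have "integrable lborel ?d" "(\<integral>z. ?d z \<partial>lborel) = 1"
    using integrable_prod_vec[of "\<lambda>i. normal_density (v $ i) 1"]
      integral_prod_vec[of "\<lambda>i. normal_density (v $ i) 1"]
    by (simp_all add: integrable_normal_density integral_normal_density)
  then have "(\<integral>\<^sup>+z. ennreal (?d z) \<partial>lborel) = 1"
    by (subst nn_integral_eq_integral) (simp_all add: prod_nonneg)
  then show "emeasure (normal_vec v) (space (normal_vec v)) = 1"
    by (simp add: normal_vec_def emeasure_density)
qed

text \<open>Translation by \<open>\<mu>\<close> reduces to the standard normal law and brings out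
  the phase \<open>iexp (t * \<mu>)\<close>.\<close>

lemma integral_normal_density_iexp:
  "(\<integral>x. normal_density \<mu> 1 x *\<^sub>R iexp (t * x) \<partial>lborel) = iexp (t * \<mu>) * exp (- t\<^sup>2 / 2)"
proof -
  have "(\<integral>x. normal_density \<mu> 1 x *\<^sub>R iexp (t * x) \<partial>lborel) =
      (\<integral>x. iexp (t * \<mu>) * (std_normal_density x *\<^sub>R iexp (t * x)) \<partial>lborel)"
    by (subst lborel_integral_real_affine[where c=1 and t=\<mu>])
      (simp_all add: normal_density_def algebra_simps exp_add scaleR_conv_of_real)
  also have "\<dots> = iexp (t * \<mu>) * char std_normal_distribution t"
    by (subst integral_mult_right_zero) (simp add: char_def integral_density)
  finally show ?thesis by (simp add: char_std_normal_distribution)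
qed

lemma integrable_normal_density_iexp:
  "integrable lborel (\<lambda>x. normal_density \<mu> 1 x *\<^sub>R iexp (t * x))"
  by (rule Bochner_Integration.integrable_bound[OF integrable_normal_density[of 1 \<mu>]]) auto

lemma normal_vec_char:
  fixes v t :: "real^'m::finite"
  shows "(\<integral>z. iexp (t \<bullet> z) \<partial>normal_vec v) = iexp (t \<bullet> v) * exp (- (norm t)\<^sup>2 / 2)"
proof -
  let ?g = "\<lambda>i x. normal_density (v $ i) 1 x *\<^sub>R iexp (t $ i * x)"
  have "(\<integral>z. iexp (t \<bullet> z) \<partial>normal_vec v) =
      (\<integral>z. (\<Prod>i\<in>UNIV. normal_density (v $ i) 1 (z $ i)) *\<^sub>R iexp (t \<bullet> z) \<partial>lborel)"
    unfolding normal_vec_def by (subst integral_density) (simp_all add: prod_nonneg)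
  also have "\<dots> = (\<integral>z. (\<Prod>i\<in>UNIV. ?g i (z $ i)) \<partial>lborel)"
    by (simp add: inner_vec_def scaleR_conv_of_real prod.distrib sum_distrib_left exp_sum)
  also have "\<dots> = (\<Prod>i\<in>UNIV. iexp (t $ i * v $ i) * exp (- (t $ i)\<^sup>2 / 2))"
    by (subst integral_prod_vec) (simp_all only: integrable_normal_density_iexp integral_normal_density_iexp)
  also have "\<dots> = iexp (t \<bullet> v) * exp (- (\<Sum>i\<in>UNIV. (t $ i)\<^sup>2) / 2)"
    by (simp add: prod.distrib inner_vec_def exp_sum sum_distrib_left sum_negf[symmetric] sum_divide_distrib of_real_prod[symmetric] del: of_real_prod)
  also have "(\<Sum>i\<in>UNIV. (t $ i)\<^sup>2) = (norm t)\<^sup>2"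
    by (simp add: norm_vec_def L2_set_def sum_nonneg)
  finally show ?thesis .
qed

text \<open>The characteristic function of the standard Gaussian at \<open>(2 s)\<^sup>1\<^sup>/\<^sup>2 W\<close>, averaged over \<open>W\<close>.\<close>

lemma (in prob_space) laplace_norm_eq:
  fixes W :: "'a \<Rightarrow> real^'m::finite"
  assumes W [measurable]: "random_variable borel W" and s: "0 \<le> s"
  shows "complex_of_real (\<integral>\<omega>. exp (- (s * (norm (W \<omega>))\<^sup>2)) \<partial>M) =
    (\<integral>t. (\<integral>\<omega>. iexp (sqrt (2 * s) *\<^sub>R t \<bullet> W \<omega>) \<partial>M) \<partial>normal_vec 0)"
proof -
  interpret G: prob_space "normal_vec (0 :: real^'m)" by (rule prob_space_normal_vec)
  interpret P: pair_prob_space M "normal_vec (0 :: real^'m)" ..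
  have "complex_of_real (\<integral>\<omega>. exp (- (s * (norm (W \<omega>))\<^sup>2)) \<partial>M) =
      (\<integral>\<omega>. complex_of_real (exp (- (s * (norm (W \<omega>))\<^sup>2))) \<partial>M)" by simp
  also have "\<dots> = (\<integral>\<omega>. (\<integral>t. iexp (sqrt (2 * s) *\<^sub>R t \<bullet> W \<omega>) \<partial>normal_vec 0) \<partial>M)"
  proof (intro Bochner_Integration.integral_cong refl)
    fix \<omega>
    show "complex_of_real (exp (- (s * (norm (W \<omega>))\<^sup>2))) =
        (\<integral>t. iexp (sqrt (2 * s) *\<^sub>R t \<bullet> W \<omega>) \<partial>normal_vec 0)"
      using normal_vec_char[where t="sqrt (2 * s) *\<^sub>R W \<omega>" and v=0] s
      by (simp add: inner_commute power_mult_distrib)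
  qed
  also have "\<dots> = (\<integral>t. (\<integral>\<omega>. iexp (sqrt (2 * s) *\<^sub>R t \<bullet> W \<omega>) \<partial>M) \<partial>normal_vec 0)"
    by (rule P.Fubini_integral[symmetric], rule P.integrable_const_bound[of _ 1])
      (auto simp: split_beta')
  finally show ?thesis .
qed

text \<open>Characters have modulus 1, so dominated convergence carries the pointwise limits of the
  characteristic functions through the Gaussian average of \<open>laplace_norm_eq\<close>, applied
  with \<open>s\<close> a natural number.\<close>

lemma (in prob_space) char_conv_imp_norm_weak_conv:
  fixes W :: "nat \<Rightarrow> 'a \<Rightarrow> real^'m::finite" and \<nu> :: "(real^'m) measure"
  assumes W [measurable]: "\<And>n. random_variable borel (W n)"
    and \<nu>: "prob_space \<nu>" and sets [measurable_cong]: "sets \<nu> = sets borel"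
    and lim: "\<And>t. (\<lambda>n. \<integral>\<omega>. iexp (t \<bullet> W n \<omega>) \<partial>M) \<longlonglongrightarrow> (\<integral>z. iexp (t \<bullet> z) \<partial>\<nu>)"
  shows "weak_conv_m (\<lambda>n. distr M borel (\<lambda>\<omega>. (norm (W n \<omega>))\<^sup>2)) (distr \<nu> borel (\<lambda>z. (norm z)\<^sup>2))"
proof (rule laplace_conv_imp_weak_conv)
  interpret N: prob_space \<nu> by (rule \<nu>)
  interpret G: prob_space "normal_vec (0 :: real^'m)" by (rule prob_space_normal_vec)
  show "real_distribution (distr M borel (\<lambda>\<omega>. (norm (W n \<omega>))\<^sup>2))" for n
    by (rule real_distribution_distr) simp
  show "real_distribution (distr \<nu> borel (\<lambda>z. (norm z)\<^sup>2))"
    by (rule N.real_distribution_distr) simp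
  show "AE x in distr M borel (\<lambda>\<omega>. (norm (W n \<omega>))\<^sup>2). 0 \<le> x" for n
    by (subst AE_distr_iff) auto
  show "AE x in distr \<nu> borel (\<lambda>z. (norm z)\<^sup>2). 0 \<le> x"
    by (subst AE_distr_iff) auto
  fix k :: nat
  have "(\<lambda>n. \<integral>t. (\<integral>\<omega>. iexp (sqrt (2 * real k) *\<^sub>R t \<bullet> W n \<omega>) \<partial>M) \<partial>normal_vec (0 :: real^'m)) \<longlonglongrightarrow>
      (\<integral>t. (\<integral>z. iexp (sqrt (2 * real k) *\<^sub>R t \<bullet> z) \<partial>\<nu>) \<partial>normal_vec (0 :: real^'m))"
  proof (rule integral_dominated_convergence[where w="\<lambda>_. 1"])
    show "AE t in normal_vec (0 :: real^'m). norm (\<integral>\<omega>. iexp (sqrt (2 * real k) *\<^sub>R t \<bullet> W n \<omega>) \<partial>M) \<le> 1" for n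
    proof (intro AE_I2)
      fix t :: "real^'m"
      have "norm (\<integral>\<omega>. iexp (sqrt (2 * real k) *\<^sub>R t \<bullet> W n \<omega>) \<partial>M) \<le>
          (\<integral>\<omega>. norm (iexp (sqrt (2 * real k) *\<^sub>R t \<bullet> W n \<omega>)) \<partial>M)"
        by (rule integral_norm_bound)
      then show "norm (\<integral>\<omega>. iexp (sqrt (2 * real k) *\<^sub>R t \<bullet> W n \<omega>) \<partial>M) \<le> 1"
        by (simp add: prob_space)
    qed
    show "AE t in normal_vec (0 :: real^'m). (\<lambda>n. \<integral>\<omega>. iexp (sqrt (2 * real k) *\<^sub>R t \<bullet> W n \<omega>) \<partial>M)
        \<longlonglongrightarrow> (\<integral>z. iexp (sqrt (2 * real k) *\<^sub>R t \<bullet> z) \<partial>\<nu>)"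
      by (intro AE_I2 lim)
  qed auto
  then have "(\<lambda>n. complex_of_real (\<integral>\<omega>. exp (- (real k * (norm (W n \<omega>))\<^sup>2)) \<partial>M)) \<longlonglongrightarrow>
      complex_of_real (\<integral>z. exp (- (real k * (norm z)\<^sup>2)) \<partial>\<nu>)"
    using N.laplace_norm_eq[of "\<lambda>z. z" "real k"] by (simp add: laplace_norm_eq)
  then show "(\<lambda>n. \<integral>x. exp (- (real k * x)) \<partial>distr M borel (\<lambda>\<omega>. (norm (W n \<omega>))\<^sup>2)) \<longlonglongrightarrow>
      (\<integral>x. exp (- (real k * x)) \<partial>distr \<nu> borel (\<lambda>z. (norm z)\<^sup>2))"
    unfolding tendsto_of_real_iff by (simp add: integral_distr)
qed

section \<open>Boundedness and convergence in probability\<close>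

text \<open>Tightness, required only for large \<open>n\<close>: in this form it follows directly
  from convergence in distribution. The norm lets one notion serve scalars and vectors.\<close>

definition bounded_in_prob :: "'a measure \<Rightarrow> (nat \<Rightarrow> 'a \<Rightarrow> 'b::real_normed_vector) \<Rightarrow> bool" where
  "bounded_in_prob M Z \<longleftrightarrow>
     (\<forall>e>0. \<exists>K. \<forall>\<^sub>F n in sequentially. measure M {\<omega> \<in> space M. norm (Z n \<omega>) > K} < e)"

context prob_space
begin

text \<open>The comparison is asked only for \<open>n > 0\<close> because averages over
  \<open>n\<close> units are 0 at \<open>n = 0\<close> by the convention for division. Measurability
  concerns the dominating sequence, whose deviation event is the larger set.\<close>

lemma tendsto_in_prob_mono:
  fixes X Y :: "nat \<Rightarrow> 'a \<Rightarrow> real"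
  assumes Y [measurable]: "\<And>n. random_variable borel (Y n)"
    and le: "\<And>n \<omega>. n > 0 \<Longrightarrow> \<omega> \<in> space M \<Longrightarrow> \<bar>X n \<omega> - c\<bar> \<le> \<bar>Y n \<omega> - d\<bar>"
    and lim: "tendsto_in_prob M Y d"
  shows "tendsto_in_prob M X c"
  unfolding tendsto_in_prob_def
proof (intro allI impI)
  fix e :: real assume "0 < e"
  then have "(\<lambda>n. prob {\<omega> \<in> space M. \<bar>Y n \<omega> - d\<bar> > e}) \<longlonglongrightarrow> 0"
    using lim by (simp add: tendsto_in_prob_def)
  moreover have "\<forall>\<^sub>F n in sequentially. norm (prob {\<omega> \<in> space M. \<bar>X n \<omega> - c\<bar> > e})
      \<le> prob {\<omega> \<in> space M. \<bar>Y n \<omega> - d\<bar> > e}"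
    using eventually_gt_at_top[of 0]
  proof eventually_elim
    case (elim n)
    have "prob {\<omega> \<in> space M. \<bar>X n \<omega> - c\<bar> > e} \<le> prob {\<omega> \<in> space M. \<bar>Y n \<omega> - d\<bar> > e}"
      by (rule finite_measure_mono) (use le[OF elim] in \<open>auto intro: less_le_trans\<close>)
    then show ?case by simp
  qed
  ultimately show "(\<lambda>n. prob {\<omega> \<in> space M. \<bar>X n \<omega> - c\<bar> > e}) \<longlonglongrightarrow> 0"
    by (rule Lim_null_comparison[rotated])
qed

lemma tendsto_in_prob_add:
  fixes X Y :: "nat \<Rightarrow> 'a \<Rightarrow> real"
  assumes X [measurable]: "\<And>n. random_variable borel (X n)"
    and Y [measurable]: "\<And>n. random_variable borel (Y n)"
    and lim: "tendsto_in_prob M X c" "tendsto_in_prob M Y d"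
  shows "tendsto_in_prob M (\<lambda>n \<omega>. X n \<omega> + Y n \<omega>) (c + d)"
  unfolding tendsto_in_prob_def
proof (intro allI impI)
  fix e :: real assume "0 < e"
  then have e: "0 < e / 2" by simp
  let ?A = "\<lambda>n. {\<omega> \<in> space M. \<bar>X n \<omega> - c\<bar> > e / 2}" and ?B = "\<lambda>n. {\<omega> \<in> space M. \<bar>Y n \<omega> - d\<bar> > e / 2}"
  have "(\<lambda>n. prob (?A n) + prob (?B n)) \<longlonglongrightarrow> 0 + 0"
    using lim e unfolding tendsto_in_prob_def by (intro tendsto_add) blast+
  then have "(\<lambda>n. prob (?A n) + prob (?B n)) \<longlonglongrightarrow> 0" by simp
  moreover have "\<forall>\<^sub>F n in sequentially. norm (prob {\<omega> \<in> space M. \<bar>X n \<omega> + Y n \<omega> - (c + d)\<bar> > e})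
      \<le> prob (?A n) + prob (?B n)"
  proof (rule always_eventually, rule allI)
    fix n
    have "e / 2 < \<bar>X n \<omega> - c\<bar> \<or> e / 2 < \<bar>Y n \<omega> - d\<bar>" if "e < \<bar>X n \<omega> + Y n \<omega> - (c + d)\<bar>" for \<omega>
      using that by arith
    then have "prob {\<omega> \<in> space M. \<bar>X n \<omega> + Y n \<omega> - (c + d)\<bar> > e} \<le> prob (?A n \<union> ?B n)"
      by (intro finite_measure_mono) auto
    also have "\<dots> \<le> prob (?A n) + prob (?B n)"
      by (rule measure_Un_le) measurable
    finally show "norm (prob {\<omega> \<in> space M. \<bar>X n \<omega> + Y n \<omega> - (c + d)\<bar> > e}) \<le> prob (?A n) + prob (?B n)"
      by simp
  qed
  ultimately show "(\<lambda>n. prob {\<omega> \<in> space M. \<bar>X n \<omega> + Y n \<omega> - (c + d)\<bar> > e}) \<longlonglongrightarrow> 0"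
    by (rule Lim_null_comparison[rotated])
qed

lemma tendsto_in_prob_const: "a \<longlonglongrightarrow> c \<Longrightarrow> tendsto_in_prob M (\<lambda>n \<omega>. a n) c"
  unfolding tendsto_in_prob_def
proof (intro allI impI)
  fix e :: real assume "a \<longlonglongrightarrow> c" "0 < e"
  then have "\<forall>\<^sub>F n in sequentially. \<bar>a n - c\<bar> < e"
    using tendstoD[of a c sequentially e] by (simp add: dist_real_def)
  then have "\<forall>\<^sub>F n in sequentially. prob {\<omega> \<in> space M. \<bar>a n - c\<bar> > e} = 0"
    by eventually_elim simp
  then show "(\<lambda>n. prob {\<omega> \<in> space M. \<bar>a n - c\<bar> > e}) \<longlonglongrightarrow> 0"
    by (rule tendsto_eventually)
qed

lemma tendsto_in_prob_cmult:
  fixes X :: "nat \<Rightarrow> 'a \<Rightarrow> real"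
  assumes lim: "tendsto_in_prob M X c"
  shows "tendsto_in_prob M (\<lambda>n \<omega>. a * X n \<omega>) (a * c)"
proof (cases "a = 0")
  case True
  then show ?thesis using tendsto_in_prob_const[of "\<lambda>_. 0" 0] by simp
next
  case False
  have "{\<omega> \<in> space M. \<bar>a * X n \<omega> - a * c\<bar> > e} = {\<omega> \<in> space M. \<bar>X n \<omega> - c\<bar> > e / \<bar>a\<bar>}" for n e
    using False by (simp add: right_diff_distrib[symmetric] abs_mult pos_divide_less_eq mult.commute)
  then show ?thesis using lim False by (simp add: tendsto_in_prob_def)
qed

lemma tendsto_in_prob_sum:
  fixes X :: "'i \<Rightarrow> nat \<Rightarrow> 'a \<Rightarrow> real"
  assumes "finite I" "\<And>i n. i \<in> I \<Longrightarrow> random_variable borel (X i n)"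
    and "\<And>i. i \<in> I \<Longrightarrow> tendsto_in_prob M (X i) (c i)"
  shows "tendsto_in_prob M (\<lambda>n \<omega>. \<Sum>i\<in>I. X i n \<omega>) (\<Sum>i\<in>I. c i)"
  using assms
proof (induction I rule: finite_induct)
  case (insert i I)
  then show ?case by (simp add: tendsto_in_prob_add)
qed (simp add: tendsto_in_prob_const)

text \<open>The coordinates may be vectors themselves, so two applications treat a matrix entry by
  entry. Working with norms asks for measurability of real functions only.\<close>

lemma tendsto_in_prob_norm_vec:
  fixes A :: "nat \<Rightarrow> 'a \<Rightarrow> 'b::real_normed_vector^'n::finite"
  assumes "\<And>i n. random_variable borel (\<lambda>\<omega>. norm (A n \<omega> $ i - c $ i))"
    and "\<And>i. tendsto_in_prob M (\<lambda>n \<omega>. norm (A n \<omega> $ i - c $ i)) 0"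
  shows "tendsto_in_prob M (\<lambda>n \<omega>. norm (A n \<omega> - c)) 0"
proof (rule tendsto_in_prob_mono)
  show "tendsto_in_prob M (\<lambda>n \<omega>. \<Sum>i\<in>UNIV. norm (A n \<omega> $ i - c $ i)) 0"
    using tendsto_in_prob_sum[of UNIV "\<lambda>i n \<omega>. norm (A n \<omega> $ i - c $ i)" "\<lambda>_. 0"] assms by simp
  fix n \<omega>
  have "norm (A n \<omega> - c) \<le> (\<Sum>i\<in>UNIV. norm ((A n \<omega> - c) $ i))"
    by (simp add: norm_vec_def L2_set_le_sum)
  then show "\<bar>norm (A n \<omega> - c) - 0\<bar> \<le> \<bar>(\<Sum>i\<in>UNIV. norm (A n \<omega> $ i - c $ i)) - 0\<bar>"
    by (simp add: sum_nonneg)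
qed (use assms in simp)

text \<open>Serves to assemble the arguments of \<open>wald_form\<close>, a nested tuple of a matrix
  and three reals, into one element of a normed space.\<close>

lemma tendsto_in_prob_norm_Pair:
  fixes A :: "nat \<Rightarrow> 'a \<Rightarrow> 'b::real_normed_vector" and B :: "nat \<Rightarrow> 'a \<Rightarrow> 'c::real_normed_vector"
  assumes [measurable]: "\<And>n. random_variable borel (\<lambda>\<omega>. norm (A n \<omega> - c))"
      "\<And>n. random_variable borel (\<lambda>\<omega>. norm (B n \<omega> - d))"
    and "tendsto_in_prob M (\<lambda>n \<omega>. norm (A n \<omega> - c)) 0" "tendsto_in_prob M (\<lambda>n \<omega>. norm (B n \<omega> - d)) 0"
  shows "tendsto_in_prob M (\<lambda>n \<omega>. norm ((A n \<omega>, B n \<omega>) - (c, d))) 0"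
proof (rule tendsto_in_prob_mono)
  show "tendsto_in_prob M (\<lambda>n \<omega>. norm (A n \<omega> - c) + norm (B n \<omega> - d)) 0"
    using tendsto_in_prob_add[OF assms] by simp
  show "\<bar>norm ((A n \<omega>, B n \<omega>) - (c, d)) - 0\<bar> \<le> \<bar>norm (A n \<omega> - c) + norm (B n \<omega> - d) - 0\<bar>" for n \<omega>
    using norm_Pair_le[of "A n \<omega> - c" "B n \<omega> - d"] by simp
qed simp

lemma tendsto_in_prob_norm_real:
  "tendsto_in_prob M (\<lambda>n \<omega>. norm (A n \<omega> - c :: real)) 0 \<longleftrightarrow> tendsto_in_prob M A c"
  by (simp add: tendsto_in_prob_def)

lemma bounded_in_prob_mono:
  fixes X :: "nat \<Rightarrow> 'a \<Rightarrow> 'b::real_normed_vector" and Y :: "nat \<Rightarrow> 'a \<Rightarrow> 'c::real_normed_vector"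
  assumes Y [measurable]: "\<And>n. random_variable borel (\<lambda>\<omega>. norm (Y n \<omega>))"
    and le: "\<And>n \<omega>. \<omega> \<in> space M \<Longrightarrow> norm (X n \<omega>) \<le> norm (Y n \<omega>)"
    and "bounded_in_prob M Y"
  shows "bounded_in_prob M X"
  unfolding bounded_in_prob_def
proof (intro allI impI)
  fix e :: real assume "0 < e"
  then obtain K where K: "\<forall>\<^sub>F n in sequentially. prob {\<omega> \<in> space M. norm (Y n \<omega>) > K} < e"
    using assms(3) by (auto simp: bounded_in_prob_def)
  have "prob {\<omega> \<in> space M. norm (X n \<omega>) > K} \<le> prob {\<omega> \<in> space M. norm (Y n \<omega>) > K}" for n
    by (rule finite_measure_mono) (use le in \<open>auto intro: less_le_trans\<close>)
  then show "\<exists>K. \<forall>\<^sub>F n in sequentially. prob {\<omega> \<in> space M. norm (X n \<omega>) > K} < e"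
    using K by (intro exI[of _ K]) (auto elim!: eventually_mono intro: le_less_trans)
qed

lemma bounded_in_prob_add:
  fixes X Y :: "nat \<Rightarrow> 'a \<Rightarrow> real"
  assumes X [measurable]: "\<And>n. random_variable borel (X n)"
    and Y [measurable]: "\<And>n. random_variable borel (Y n)"
    and "bounded_in_prob M X" "bounded_in_prob M Y"
  shows "bounded_in_prob M (\<lambda>n \<omega>. X n \<omega> + Y n \<omega>)"
  unfolding bounded_in_prob_def
proof (intro allI impI)
  fix e :: real assume "0 < e"
  then have e: "0 < e / 2" by simp
  obtain K where K: "\<forall>\<^sub>F n in sequentially. prob {\<omega> \<in> space M. norm (X n \<omega>) > K} < e / 2"
    using assms(3) e unfolding bounded_in_prob_def by blast
  obtain L where L: "\<forall>\<^sub>F n in sequentially. prob {\<omega> \<in> space M. norm (Y n \<omega>) > L} < e / 2"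
    using assms(4) e unfolding bounded_in_prob_def by blast
  show "\<exists>K. \<forall>\<^sub>F n in sequentially. prob {\<omega> \<in> space M. norm (X n \<omega> + Y n \<omega>) > K} < e"
  proof (intro exI[of _ "K + L"], use K L in eventually_elim)
    case (elim n)
    let ?A = "{\<omega> \<in> space M. norm (X n \<omega>) > K}" and ?B = "{\<omega> \<in> space M. norm (Y n \<omega>) > L}"
    have "prob {\<omega> \<in> space M. norm (X n \<omega> + Y n \<omega>) > K + L} \<le> prob (?A \<union> ?B)"
      by (intro finite_measure_mono) auto
    also have "\<dots> \<le> prob ?A + prob ?B"
      by (rule measure_Un_le) measurable
    finally show ?case using elim by simp
  qed
qed

lemma bounded_in_prob_zero: "bounded_in_prob M (\<lambda>n \<omega>. 0 :: 'b::real_normed_vector)"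
  unfolding bounded_in_prob_def by (intro allI impI exI[of _ 0]) simp

lemma bounded_in_prob_sum:
  fixes X :: "'i \<Rightarrow> nat \<Rightarrow> 'a \<Rightarrow> real"
  assumes "finite I" "\<And>i n. i \<in> I \<Longrightarrow> random_variable borel (X i n)"
    and "\<And>i. i \<in> I \<Longrightarrow> bounded_in_prob M (X i)"
  shows "bounded_in_prob M (\<lambda>n \<omega>. \<Sum>i\<in>I. X i n \<omega>)"
  using assms
proof (induction I rule: finite_induct)
  case (insert i I)
  then show ?case by (simp add: bounded_in_prob_add)
qed (simp add: bounded_in_prob_zero)

lemma bounded_in_prob_norm:
  "bounded_in_prob M (\<lambda>n \<omega>. norm (X n \<omega>)) \<longleftrightarrow> bounded_in_prob M X"
  by (simp add: bounded_in_prob_def)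

lemma bounded_in_prob_cmult:
  fixes X :: "nat \<Rightarrow> 'a \<Rightarrow> real"
  assumes [measurable]: "\<And>n. random_variable borel (X n)" and X: "bounded_in_prob M X"
  shows "bounded_in_prob M (\<lambda>n \<omega>. a * X n \<omega>)"
  unfolding bounded_in_prob_def
proof (intro allI impI)
  fix e :: real assume "0 < e"
  then obtain K where K: "\<forall>\<^sub>F n in sequentially. prob {\<omega> \<in> space M. norm (X n \<omega>) > K} < e"
    using X by (auto simp: bounded_in_prob_def)
  have "prob {\<omega> \<in> space M. norm (a * X n \<omega>) > \<bar>a\<bar> * K} \<le> prob {\<omega> \<in> space M. norm (X n \<omega>) > K}" for n
    by (rule finite_measure_mono) (auto simp: abs_mult mult_less_cancel_left)
  then show "\<exists>K. \<forall>\<^sub>F n in sequentially. prob {\<omega> \<in> space M. norm (a * X n \<omega>) > K} < e"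
    using K by (intro exI[of _ "\<bar>a\<bar> * K"]) (auto elim!: eventually_mono intro: le_less_trans)
qed

lemma bounded_in_prob_vec:
  fixes X :: "nat \<Rightarrow> 'a \<Rightarrow> real^'n::finite"
  assumes [measurable]: "\<And>i n. random_variable borel (\<lambda>\<omega>. X n \<omega> $ i)"
    and "\<And>i. bounded_in_prob M (\<lambda>n \<omega>. X n \<omega> $ i)"
  shows "bounded_in_prob M X"
proof (rule bounded_in_prob_mono)
  show "bounded_in_prob M (\<lambda>n \<omega>. \<Sum>i\<in>UNIV. norm (X n \<omega> $ i))"
    by (rule bounded_in_prob_sum) (simp_all only: bounded_in_prob_norm assms, auto)
  show "norm (X n \<omega>) \<le> norm (\<Sum>i\<in>UNIV. norm (X n \<omega> $ i))" for n \<omega>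
    by (simp add: norm_vec_def L2_set_le_sum sum_nonneg)
qed measurable

lemma bounded_in_prob_second_moment:
  fixes Z :: "nat \<Rightarrow> 'a \<Rightarrow> real"
  assumes [measurable]: "\<And>n. random_variable borel (Z n)"
    and int: "\<And>n. integrable M (\<lambda>\<omega>. (Z n \<omega>)\<^sup>2)"
    and B: "\<And>n. expectation (\<lambda>\<omega>. (Z n \<omega>)\<^sup>2) \<le> B"
  shows "bounded_in_prob M Z"
  unfolding bounded_in_prob_def
proof (intro allI impI)
  fix e :: real assume e: "0 < e"
  have B0: "0 \<le> B" using B[of 0] by (meson Bochner_Integration.integral_nonneg order_trans zero_le_power2)
  \<comment> \<open>Chebyshev's bound becomes \<open>B / K\<^sup>2 = e * B / (B + 1)\<close>; the
    summand 1 makes it strictly smaller than \<open>e\<close> and keeps \<open>K\<close> positive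
    when \<open>B = 0\<close>.\<close>
  define K where "K = sqrt ((B + 1) / e)"
  have K2: "K\<^sup>2 = (B + 1) / e" using B0 e by (simp add: K_def)
  have K0: "0 < K" using B0 e by (simp add: K_def)
  have "prob {\<omega> \<in> space M. norm (Z n \<omega>) > K} < e" for n
  proof -
    have "prob {\<omega> \<in> space M. norm (Z n \<omega>) > K} \<le> prob {\<omega> \<in> space M. (Z n \<omega>)\<^sup>2 \<ge> K\<^sup>2}"
      using K0 by (intro finite_measure_mono) (auto simp: abs_le_square_iff[symmetric])
    also have "\<dots> \<le> expectation (\<lambda>\<omega>. (Z n \<omega>)\<^sup>2) / K\<^sup>2"
      using K0 by (intro integral_Markov_inequality_measure[OF int, where A="space M"]) auto
    also have "\<dots> \<le> B / K\<^sup>2" using B[of n] by (intro divide_right_mono) auto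
    also have "\<dots> < e" using e B0 by (simp add: K2 field_simps)
    finally show ?thesis .
  qed
  then show "\<exists>K. \<forall>\<^sub>F n in sequentially. prob {\<omega> \<in> space M. norm (Z n \<omega>) > K} < e"
    by (intro exI[of _ K] always_eventually allI)
qed

text \<open>With \<open>a n = 1 / sqrt (real n)\<close> this turns tightness of a normalised sum
  into a law of large numbers.\<close>

lemma bounded_in_prob_vanish:
  fixes Z :: "nat \<Rightarrow> 'a \<Rightarrow> real"
  assumes [measurable]: "\<And>n. random_variable borel (Z n)"
    and Z: "bounded_in_prob M Z" and a: "a \<longlonglongrightarrow> 0"
  shows "tendsto_in_prob M (\<lambda>n \<omega>. a n * Z n \<omega>) 0"
  unfolding tendsto_in_prob_def
proof (intro allI impI LIMSEQ_I)
  fix e r :: real assume e: "0 < e" and r: "0 < r"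
  obtain K where K: "\<forall>\<^sub>F n in sequentially. prob {\<omega> \<in> space M. norm (Z n \<omega>) > K} < r"
    using Z r by (auto simp: bounded_in_prob_def)
  have "(\<lambda>n. \<bar>a n\<bar> * K) \<longlonglongrightarrow> 0" using a by (intro tendsto_mult_left_zero tendsto_rabs_zero)
  then have "\<forall>\<^sub>F n in sequentially. \<bar>a n\<bar> * K < e" using e by (rule order_tendstoD(2))
  with K have "\<forall>\<^sub>F n in sequentially. norm (prob {\<omega> \<in> space M. \<bar>a n * Z n \<omega> - 0\<bar> > e} - 0) < r"
  proof eventually_elim
    case (elim n)
    have "\<bar>Z n \<omega>\<bar> > K" if "e < \<bar>a n * Z n \<omega>\<bar>" for \<omega>
    proof (rule ccontr)
      assume "\<not> K < \<bar>Z n \<omega>\<bar>"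
      then have "\<bar>a n * Z n \<omega>\<bar> \<le> \<bar>a n\<bar> * K" by (simp add: abs_mult mult_left_mono)
      with elim that show False by simp
    qed
    then have "prob {\<omega> \<in> space M. \<bar>a n * Z n \<omega> - 0\<bar> > e} \<le> prob {\<omega> \<in> space M. norm (Z n \<omega>) > K}"
      by (intro finite_measure_mono) auto
    with elim show ?case by simp
  qed
  then show "\<exists>no. \<forall>n\<ge>no. norm (prob {\<omega> \<in> space M. \<bar>a n * Z n \<omega> - 0\<bar> > e} - 0) < r"
    by (simp add: eventually_sequentially)
qed

text \<open>A continuous ramp rising from norm \<open>K\<close> to norm \<open>K + 1\<close> lies
  between the indicators of the two exterior regions. Its integral under \<open>\<xi>\<close> is
  small for large \<open>K\<close>, and convergence for this single test function bounds the tails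
  of \<open>Z n\<close> for all large \<open>n\<close>.\<close>

lemma tendsto_in_distr_bounded_in_prob:
  fixes Z :: "nat \<Rightarrow> 'a \<Rightarrow> real^'k::finite" and \<xi> :: "'b \<Rightarrow> real^'k"
  assumes [measurable]: "\<And>n. random_variable borel (Z n)"
    and N: "prob_space N" and \<xi> [measurable]: "\<xi> \<in> borel_measurable N"
    and lim: "tendsto_in_distr M Z N \<xi>"
  shows "bounded_in_prob M Z"
  unfolding bounded_in_prob_def
proof (intro allI impI)
  interpret N: prob_space N by (rule N)
  fix e :: real assume e: "0 < e"
  define f where "f K z = max 0 (min 1 (norm z - K))" for K and z :: "real^'k"
  have f01: "0 \<le> f K z" "f K z \<le> 1" for K z by (auto simp: f_def)
  have f_cont: "continuous_on UNIV (f K)" for K unfolding f_def by (intro continuous_intros)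
  have [measurable]: "f K \<in> borel_measurable borel" for K by (rule borel_measurable_continuous_onI[OF f_cont])
  have "(\<lambda>k. \<integral>\<omega>. f (real k) (\<xi> \<omega>) \<partial>N) \<longlonglongrightarrow> (\<integral>\<omega>. 0 \<partial>N)"
  proof (rule integral_dominated_convergence[where w="\<lambda>_. 1"])
    show "AE \<omega> in N. (\<lambda>k. f (real k) (\<xi> \<omega>)) \<longlonglongrightarrow> 0"
    proof (intro AE_I2 tendsto_eventually)
      fix \<omega>
      show "\<forall>\<^sub>F k in sequentially. f (real k) (\<xi> \<omega>) = 0"
        using eventually_ge_at_top[of "nat \<lceil>norm (\<xi> \<omega>)\<rceil>"]
        by eventually_elim (simp add: f_def nat_le_iff ceiling_le_iff)
    qed
  qed (auto simp: f01)
  then have "\<forall>\<^sub>F k in sequentially. (\<integral>\<omega>. f (real k) (\<xi> \<omega>) \<partial>N) < e"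
    using e by (auto dest: order_tendstoD(2))
  then obtain k where k: "(\<integral>\<omega>. f (real k) (\<xi> \<omega>) \<partial>N) < e"
    by (auto simp: eventually_sequentially)
  have "(\<lambda>n. \<integral>\<omega>. f (real k) (Z n \<omega>) \<partial>M) \<longlonglongrightarrow> (\<integral>\<omega>. f (real k) (\<xi> \<omega>) \<partial>N)"
  proof -
    have "bounded (range (f (real k)))" using f01 by (intro boundedI[of _ 1]) auto
    then show ?thesis using lim f_cont[of "real k"] unfolding tendsto_in_distr_def by blast
  qed
  then have "\<forall>\<^sub>F n in sequentially. (\<integral>\<omega>. f (real k) (Z n \<omega>) \<partial>M) < e"
    using k by (rule order_tendstoD(2))
  then have "\<forall>\<^sub>F n in sequentially. prob {\<omega> \<in> space M. norm (Z n \<omega>) > real k + 1} < e"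
  proof eventually_elim
    case (elim n)
    have "prob {\<omega> \<in> space M. norm (Z n \<omega>) > real k + 1} =
        (\<integral>\<omega>. indicator {\<omega> \<in> space M. norm (Z n \<omega>) > real k + 1} \<omega> \<partial>M)"
      by simp
    also have "\<dots> \<le> (\<integral>\<omega>. f (real k) (Z n \<omega>) \<partial>M)"
    proof (rule integral_mono)
      show "integrable M (\<lambda>\<omega>. f (real k) (Z n \<omega>))"
        by (rule integrable_const_bound[of _ 1]) (auto simp: f01)
      show "integrable M (indicat_real {\<omega> \<in> space M. norm (Z n \<omega>) > real k + 1})"
        by (intro integrable_real_indicator) (auto simp: emeasure_eq_measure)
    qed (auto simp: indicator_def f_def)
    finally show ?case using elim by simp
  qed
  then show "\<exists>K. \<forall>\<^sub>F n in sequentially. prob {\<omega> \<in> space M. norm (Z n \<omega>) > K} < e" by blast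
qed

end

section \<open>Substitution of limits in probability into a continuous function\<close>

text \<open>A sequence of counterexamples would have bounded \<open>z k\<close>, hence a subsequence
  with a limit \<open>l\<close>, along which \<open>F a z\<close> and \<open>F c z\<close> both tend
  to \<open>F c l\<close>. Continuity is asked only over the one point \<open>c\<close>, since
  matrix inversion need not be continuous at singular matrices.\<close>

lemma isCont_uniform_on_bounded:
  fixes F :: "'b::real_normed_vector \<Rightarrow> 'c::euclidean_space \<Rightarrow> real"
  assumes cont: "\<And>z. isCont (\<lambda>(a, z). F a z) (c, z)" and e: "0 < e"
  obtains d where "0 < d" "\<And>a z. norm (a - c) < d \<Longrightarrow> norm z \<le> K \<Longrightarrow> \<bar>F a z - F c z\<bar> < e"
proof -
  have "\<exists>d>0. \<forall>a z. norm (a - c) < d \<longrightarrow> norm z \<le> K \<longrightarrow> \<bar>F a z - F c z\<bar> < e"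
  proof (rule ccontr)
    assume *: "\<not> ?thesis"
    have "\<exists>a z. norm (a - c) < inverse (real (Suc k)) \<and> norm z \<le> K \<and> \<not> \<bar>F a z - F c z\<bar> < e" for k
    proof -
      have "0 < inverse (real (Suc k))" by simp
      then show ?thesis using * by blast
    qed
    then obtain a z where a: "\<And>k. norm (a k - c) < inverse (real (Suc k))"
      and z: "\<And>k. norm (z k) \<le> K" and bad: "\<And>k. \<not> \<bar>F (a k) (z k) - F c (z k)\<bar> < e"
      by metis
    have "seq_compact (cball (0::'c) K)" by (simp add: compact_imp_seq_compact)
    then obtain l r where r: "strict_mono r" and l: "(z \<circ> r) \<longlonglongrightarrow> l"
      unfolding seq_compact_def using z by (metis mem_cball_0)
    have "(\<lambda>k. norm (a k - c)) \<longlonglongrightarrow> 0"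
      by (rule tendsto_sandwich[OF _ always_eventually tendsto_const LIMSEQ_inverse_real_of_nat])
        (use a in \<open>auto intro: less_imp_le simp del: of_nat_Suc\<close>)
    then have "a \<longlonglongrightarrow> c" by (simp add: LIM_zero_iff tendsto_norm_zero_iff)
    then have ar: "(a \<circ> r) \<longlonglongrightarrow> c" using r by (rule LIMSEQ_subseq_LIMSEQ)
    have "(\<lambda>k. F (a (r k)) (z (r k))) \<longlonglongrightarrow> F c l"
      using isCont_tendsto_compose[OF cont[of l] tendsto_Pair[OF ar l]] by simp
    moreover have "(\<lambda>k. F c (z (r k))) \<longlonglongrightarrow> F c l"
      using isCont_tendsto_compose[OF cont[of l] tendsto_Pair[OF tendsto_const l]] by simp
    ultimately have "(\<lambda>k. F (a (r k)) (z (r k)) - F c (z (r k))) \<longlonglongrightarrow> F c l - F c l"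
      by (rule tendsto_diff)
    then have "\<forall>\<^sub>F k in sequentially. \<bar>F (a (r k)) (z (r k)) - F c (z (r k))\<bar> < e"
      using e by (auto dest!: tendstoD simp: dist_real_def)
    then show False using bad by (auto simp: eventually_sequentially)
  qed
  then show ?thesis using that by blast
qed

text \<open>Replaces the averages by their limits but keeps the random \<open>Z n\<close>, which is
  only tight. The identity for \<open>S n\<close> is asked only within distance \<open>r\<close> of
  \<open>c\<close>: in the application the relevant matrices are invertible there, and leaving this
  ball has vanishing probability.\<close>

lemma (in prob_space) slutsky_substitute:
  fixes A :: "nat \<Rightarrow> 'a \<Rightarrow> 'b::real_normed_vector" and Z :: "nat \<Rightarrow> 'a \<Rightarrow> 'c::euclidean_space"
    and F :: "'b \<Rightarrow> 'c \<Rightarrow> real"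
  assumes A [measurable]: "\<And>n. random_variable borel (\<lambda>\<omega>. norm (A n \<omega> - c))"
    and Z [measurable]: "\<And>n. random_variable borel (\<lambda>\<omega>. norm (Z n \<omega>))"
    and cont: "\<And>z. isCont (\<lambda>(a, z). F a z) (c, z)"
    and r: "0 < r"
    and S: "\<And>n \<omega>. n > 0 \<Longrightarrow> \<omega> \<in> space M \<Longrightarrow> norm (A n \<omega> - c) < r \<Longrightarrow> S n \<omega> = F (A n \<omega>) (Z n \<omega>)"
    and Alim: "tendsto_in_prob M (\<lambda>n \<omega>. norm (A n \<omega> - c)) 0" and Zb: "bounded_in_prob M Z"
  shows "tendsto_in_prob M (\<lambda>n \<omega>. S n \<omega> - F c (Z n \<omega>)) 0"
  unfolding tendsto_in_prob_def
proof (intro allI impI LIMSEQ_I)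
  fix e s :: real assume e: "0 < e" and s: "0 < s"
  then have s2: "0 < s / 2" by simp
  obtain K where K: "\<forall>\<^sub>F n in sequentially. prob {\<omega> \<in> space M. norm (Z n \<omega>) > K} < s / 2"
    using Zb s2 unfolding bounded_in_prob_def by blast
  obtain d where d: "0 < d" "\<And>a z. norm (a - c) < d \<Longrightarrow> norm z \<le> K \<Longrightarrow> \<bar>F a z - F c z\<bar> < e"
    using isCont_uniform_on_bounded[OF cont e, of K] by blast
  \<comment> \<open>Strictly below both radii, since the complement of the deviation event only
    gives distance at most \<open>d'\<close>.\<close>
  define d' where "d' = min r d / 2"
  have d': "0 < d'" "d' < r" "d' < d" using r d by (auto simp: d'_def)
  have "(\<lambda>n. prob {\<omega> \<in> space M. \<bar>norm (A n \<omega> - c) - 0\<bar> > d'}) \<longlonglongrightarrow> 0"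
    using Alim d'(1) unfolding tendsto_in_prob_def by blast
  then have "\<forall>\<^sub>F n in sequentially. prob {\<omega> \<in> space M. \<bar>norm (A n \<omega> - c) - 0\<bar> > d'} < s / 2"
    using s2 by (rule order_tendstoD(2))
  with K eventually_gt_at_top[of 0]
  have "\<forall>\<^sub>F n in sequentially. norm (prob {\<omega> \<in> space M. \<bar>S n \<omega> - F c (Z n \<omega>) - 0\<bar> > e} - 0) < s"
  proof eventually_elim
    case (elim n)
    let ?A = "{\<omega> \<in> space M. norm (Z n \<omega>) > K}" and ?B = "{\<omega> \<in> space M. \<bar>norm (A n \<omega> - c) - 0\<bar> > d'}"
    have "{\<omega> \<in> space M. \<bar>S n \<omega> - F c (Z n \<omega>) - 0\<bar> > e} \<subseteq> ?A \<union> ?B"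
    proof (rule subsetI, rule ccontr)
      fix \<omega> assume a: "\<omega> \<in> {\<omega> \<in> space M. \<bar>S n \<omega> - F c (Z n \<omega>) - 0\<bar> > e}" and "\<omega> \<notin> ?A \<union> ?B"
      then have "norm (Z n \<omega>) \<le> K" "norm (A n \<omega> - c) \<le> d'" by auto
      then show False using a d' d(2)[of "A n \<omega>" "Z n \<omega>"] S[of n \<omega>] elim(2) by auto
    qed
    then have "prob {\<omega> \<in> space M. \<bar>S n \<omega> - F c (Z n \<omega>) - 0\<bar> > e} \<le> prob (?A \<union> ?B)"
      by (rule finite_measure_mono) measurable
    also have "\<dots> \<le> prob ?A + prob ?B"
      by (rule measure_Un_le) measurable
    finally show ?case using elim by simp
  qed
  then show "\<exists>no. \<forall>n\<ge>no. norm (prob {\<omega> \<in> space M. \<bar>S n \<omega> - F c (Z n \<omega>) - 0\<bar> > e} - 0) < s"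
    by (simp add: eventually_sequentially)
qed

section \<open>Weak law of large numbers\<close>

lemma distr_eq_integral_cong:
  fixes g :: "'b \<Rightarrow> 'c::{banach,second_countable_topology}"
  assumes [measurable]: "X \<in> M \<rightarrow>\<^sub>M N" "Y \<in> L \<rightarrow>\<^sub>M N" "g \<in> borel_measurable N"
    and eq: "distr M N X = distr L N Y"
  shows "(\<integral>\<omega>. g (X \<omega>) \<partial>M) = (\<integral>\<omega>. g (Y \<omega>) \<partial>L)"
    and "integrable M (\<lambda>\<omega>. g (X \<omega>)) \<longleftrightarrow> integrable L (\<lambda>\<omega>. g (Y \<omega>))"
  using integral_distr[of X M N g] integral_distr[of Y L N g]
    integrable_distr_eq[of X M N g] integrable_distr_eq[of Y L N g] by (simp_all add: eq)

lemma sqrt_n_vanish: "(\<lambda>n. 1 / sqrt (real n)) \<longlonglongrightarrow> 0"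
  by (intro tendsto_divide_0[OF tendsto_const] filterlim_at_top_imp_at_infinity
      filterlim_compose[OF sqrt_at_top filterlim_real_sequentially])

context prob_space
begin

text \<open>Orthogonality is asked in place of independence because the terms
  \<open>T n i * \<epsilon> i\<close> are uncorrelated while the assignments may depend on one
  another.\<close>

lemma
  fixes Y :: "'i \<Rightarrow> 'a \<Rightarrow> real"
  assumes fin: "finite I"
    and int: "\<And>i j. i \<in> I \<Longrightarrow> j \<in> I \<Longrightarrow> integrable M (\<lambda>\<omega>. Y i \<omega> * Y j \<omega>)"
    and orth: "\<And>i j. i \<in> I \<Longrightarrow> j \<in> I \<Longrightarrow> i \<noteq> j \<Longrightarrow> expectation (\<lambda>\<omega>. Y i \<omega> * Y j \<omega>) = 0"
  shows integrable_sum_power2: "integrable M (\<lambda>\<omega>. (\<Sum>i\<in>I. Y i \<omega>)\<^sup>2)"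
    and expectation_sum_power2:
      "expectation (\<lambda>\<omega>. (\<Sum>i\<in>I. Y i \<omega>)\<^sup>2) = (\<Sum>i\<in>I. expectation (\<lambda>\<omega>. (Y i \<omega>)\<^sup>2))"
proof -
  have eq: "(\<Sum>i\<in>I. Y i \<omega>)\<^sup>2 = (\<Sum>i\<in>I. \<Sum>j\<in>I. Y i \<omega> * Y j \<omega>)" for \<omega>
    by (simp add: power2_eq_square sum_product)
  show "integrable M (\<lambda>\<omega>. (\<Sum>i\<in>I. Y i \<omega>)\<^sup>2)"
    unfolding eq by (intro Bochner_Integration.integrable_sum int)
  have "expectation (\<lambda>\<omega>. (\<Sum>i\<in>I. Y i \<omega>)\<^sup>2) = (\<Sum>i\<in>I. \<Sum>j\<in>I. expectation (\<lambda>\<omega>. Y i \<omega> * Y j \<omega>))"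
    unfolding eq using int by (simp add: integral_sum)
  also have "\<dots> = (\<Sum>i\<in>I. \<Sum>j\<in>I. if j = i then expectation (\<lambda>\<omega>. (Y i \<omega>)\<^sup>2) else 0)"
    by (intro sum.cong refl) (auto simp: power2_eq_square orth)
  also have "\<dots> = (\<Sum>i\<in>I. expectation (\<lambda>\<omega>. (Y i \<omega>)\<^sup>2))"
    using fin by simp
  finally show "expectation (\<lambda>\<omega>. (\<Sum>i\<in>I. Y i \<omega>)\<^sup>2) = (\<Sum>i\<in>I. expectation (\<lambda>\<omega>. (Y i \<omega>)\<^sup>2))" .
qed

lemma
  fixes X :: "'i \<Rightarrow> 'a \<Rightarrow> real"
  assumes indep: "indep_vars (\<lambda>_. borel) X I" and ij: "i \<in> I" "j \<in> I" "i \<noteq> j"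
    and int: "integrable M (X i)" "integrable M (X j)"
  shows indep_vars_integrable_mult: "integrable M (\<lambda>\<omega>. X i \<omega> * X j \<omega>)"
    and indep_vars_expectation_mult:
      "expectation (\<lambda>\<omega>. X i \<omega> * X j \<omega>) = expectation (X i) * expectation (X j)"
proof -
  have *: "indep_vars (\<lambda>_. borel) X {i, j}"
    by (rule indep_vars_subset[OF indep]) (use ij in auto)
  show "integrable M (\<lambda>\<omega>. X i \<omega> * X j \<omega>)"
    using indep_vars_integrable[OF _ *] int ij by auto
  show "expectation (\<lambda>\<omega>. X i \<omega> * X j \<omega>) = expectation (X i) * expectation (X j)"
    using indep_vars_lebesgue_integral[OF _ *] int ij by auto
qed

text \<open>The second moment of the normalised sum is the average of the single second moments, so
  Chebyshev's bound is uniform in \<open>n\<close>.\<close>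

lemma normalized_sum_bounded_in_prob:
  fixes X :: "nat \<Rightarrow> 'a \<Rightarrow> real"
  assumes indep: "indep_vars (\<lambda>_. borel) X UNIV"
    and sq: "\<And>i. integrable M (\<lambda>\<omega>. (X i \<omega>)\<^sup>2)"
    and mean: "\<And>i. expectation (X i) = 0"
    and B: "\<And>i. expectation (\<lambda>\<omega>. (X i \<omega>)\<^sup>2) \<le> B"
  shows "bounded_in_prob M (\<lambda>n \<omega>. (1 / sqrt (real n)) * (\<Sum>i<n. X i \<omega>))"
proof (rule bounded_in_prob_second_moment)
  have meas [measurable]: "random_variable borel (X i)" for i
    using indep by (simp add: indep_vars_def)
  have int: "integrable M (X i)" for i
    by (rule square_integrable_imp_integrable[OF meas sq])
  have intp: "integrable M (\<lambda>\<omega>. X i \<omega> * X j \<omega>)" for i j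
    using indep_vars_integrable_mult[OF indep _ _ _ int int, of i j] sq[of i]
    by (cases "i = j") (auto simp: power2_eq_square)
  have orth: "i \<noteq> j \<Longrightarrow> expectation (\<lambda>\<omega>. X i \<omega> * X j \<omega>) = 0" for i j
    using indep_vars_expectation_mult[OF indep _ _ _ int int, of i j] by (simp add: mean)
  fix n
  show "random_variable borel (\<lambda>\<omega>. (1 / sqrt (real n)) * (\<Sum>i<n. X i \<omega>))" by measurable
  show "integrable M (\<lambda>\<omega>. ((1 / sqrt (real n)) * (\<Sum>i<n. X i \<omega>))\<^sup>2)"
    unfolding power_mult_distrib by (intro integrable_mult_right integrable_sum_power2 intp orth) auto
  \<comment> \<open>Covers \<open>n = 0\<close>, where the average is 0 by the convention for
    division.\<close>
  have B0: "0 \<le> B" using B[of 0] by (meson Bochner_Integration.integral_nonneg order_trans zero_le_power2)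
  have "expectation (\<lambda>\<omega>. ((1 / sqrt (real n)) * (\<Sum>i<n. X i \<omega>))\<^sup>2) =
      (1 / sqrt (real n))\<^sup>2 * expectation (\<lambda>\<omega>. (\<Sum>i<n. X i \<omega>)\<^sup>2)"
    unfolding power_mult_distrib by (rule integral_mult_right_zero)
  also have "\<dots> = (1 / real n) * (\<Sum>i<n. expectation (\<lambda>\<omega>. (X i \<omega>)\<^sup>2))"
    by (subst expectation_sum_power2) (auto simp: intp orth power_divide)
  also have "\<dots> \<le> (1 / real n) * (\<Sum>i<n. B)"
    by (intro mult_left_mono sum_mono B) auto
  also have "\<dots> \<le> B" using B0 by simp
  finally show "expectation (\<lambda>\<omega>. ((1 / sqrt (real n)) * (\<Sum>i<n. X i \<omega>))\<^sup>2) \<le> B" .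
qed

text \<open>Only a first moment is available, so the variables are truncated before Chebyshev's
  inequality is applied.\<close>

theorem weak_law_of_large_numbers:
  fixes X :: "nat \<Rightarrow> 'a \<Rightarrow> real"
  assumes indep: "indep_vars (\<lambda>_. borel) X UNIV"
    and distr: "\<And>i. distr M borel (X i) = distr M borel (X 0)"
    and int0: "integrable M (X 0)"
  shows "tendsto_in_prob M (\<lambda>n \<omega>. (\<Sum>i<n. X i \<omega>) / real n) (expectation (X 0))"
  unfolding tendsto_in_prob_def
proof (intro allI impI LIMSEQ_I)
  fix e s :: real assume e: "0 < e" and s: "0 < s"
  have meas [measurable]: "random_variable borel (X i)" for i
    using indep by (simp add: indep_vars_def)
  note same = distr_eq_integral_cong[OF meas meas _ distr]
  have int: "integrable M (X i)" for i
    using same(2)[of "\<lambda>x. x"] int0 by simp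
  define t where "t k x = (if \<bar>x\<bar> \<le> real k then x else 0)" for k and x :: real
  have [measurable]: "t k \<in> borel_measurable borel" for k unfolding t_def by measurable
  have "(\<lambda>k. expectation (\<lambda>\<omega>. \<bar>X 0 \<omega> - t k (X 0 \<omega>)\<bar>)) \<longlonglongrightarrow> expectation (\<lambda>\<omega>. 0)"
  proof (rule integral_dominated_convergence[where w="\<lambda>\<omega>. \<bar>X 0 \<omega>\<bar>"])
    show "AE \<omega> in M. (\<lambda>k. \<bar>X 0 \<omega> - t k (X 0 \<omega>)\<bar>) \<longlonglongrightarrow> 0"
    proof (intro AE_I2 tendsto_eventually)
      fix \<omega>
      show "\<forall>\<^sub>F k in sequentially. \<bar>X 0 \<omega> - t k (X 0 \<omega>)\<bar> = 0"
        using eventually_ge_at_top[of "nat \<lceil>\<bar>X 0 \<omega>\<bar>\<rceil>"]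
        by eventually_elim (simp add: t_def nat_le_iff ceiling_le_iff)
    qed
    show "AE \<omega> in M. norm \<bar>X 0 \<omega> - t k (X 0 \<omega>)\<bar> \<le> \<bar>X 0 \<omega>\<bar>" for k
      by (auto simp: t_def)
  qed (use int0 in auto)
  then have "\<forall>\<^sub>F k in sequentially. expectation (\<lambda>\<omega>. \<bar>X 0 \<omega> - t k (X 0 \<omega>)\<bar>) < e * s / 8"
    using e s by (intro order_tendstoD(2)[of _ 0]) auto
  \<comment> \<open>The discarded tail enters twice, through its average and through its mean, so
    its expected deviation is at most \<open>e * s / 4\<close>; Markov's inequality at level
    \<open>e / 2\<close> turns this into \<open>s / 2\<close>.\<close>
  then obtain k where k: "expectation (\<lambda>\<omega>. \<bar>X 0 \<omega> - t k (X 0 \<omega>)\<bar>) < e * s / 8"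
    by (auto simp: eventually_sequentially)
  define m where "m = expectation (\<lambda>\<omega>. t k (X 0 \<omega>))"
  define Y where "Y i \<omega> = t k (X i \<omega>) - m" for i \<omega>
  define R where "R i \<omega> = X i \<omega> - t k (X i \<omega>)" for i \<omega>
  have [measurable]: "random_variable borel (Y i)" "random_variable borel (R i)" for i
    unfolding Y_def R_def by measurable
  have tb: "\<bar>t k x\<bar> \<le> real k" for x by (simp add: t_def)
  have int_t: "integrable M (\<lambda>\<omega>. t k (X i \<omega>))" for i
    by (rule integrable_const_bound[of _ "real k"]) (auto simp: tb)
  have m_i: "expectation (\<lambda>\<omega>. t k (X i \<omega>)) = m" for i
    unfolding m_def by (rule same(1)) simp
  have m_le: "\<bar>m\<bar> \<le> real k"
  proof -
    have "\<bar>m\<bar> \<le> expectation (\<lambda>\<omega>. \<bar>t k (X 0 \<omega>)\<bar>)" unfolding m_def by (rule integral_abs_bound)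
    also have "\<dots> \<le> expectation (\<lambda>\<omega>. real k)"
      by (rule integral_mono) (use int_t tb in auto)
    finally show ?thesis by (simp add: prob_space)
  qed
  have Yb: "\<bar>Y i \<omega>\<bar> \<le> 2 * real k" for i \<omega>
    using tb[of "X i \<omega>"] m_le by (simp add: Y_def)
  have Y2: "(Y i \<omega>)\<^sup>2 \<le> (2 * real k)\<^sup>2" for i \<omega>
    using Yb[of i \<omega>] by (subst abs_le_square_iff[symmetric]) simp
  have intY2: "integrable M (\<lambda>\<omega>. (Y i \<omega>)\<^sup>2)" for i
    by (rule integrable_const_bound[of _ "(2 * real k)\<^sup>2"]) (use Y2 in auto)
  have "bounded_in_prob M (\<lambda>n \<omega>. (1 / sqrt (real n)) * (\<Sum>i<n. Y i \<omega>))"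
  proof (rule normalized_sum_bounded_in_prob)
    show "indep_vars (\<lambda>_. borel) Y UNIV"
      unfolding Y_def by (rule indep_vars_compose2[OF indep]) measurable
    show "expectation (Y i) = 0" for i
      unfolding Y_def using int_t m_i by (simp add: prob_space)
    have "expectation (\<lambda>\<omega>. (Y i \<omega>)\<^sup>2) \<le> expectation (\<lambda>\<omega>. (2 * real k)\<^sup>2)" for i
      by (rule integral_mono) (use intY2 Y2 in auto)
    then show "expectation (\<lambda>\<omega>. (Y i \<omega>)\<^sup>2) \<le> (2 * real k)\<^sup>2" for i
      by (simp add: prob_space)
  qed (rule intY2)
  \<comment> \<open>One factor \<open>1 / sqrt (real n)\<close> makes the sum of the truncated terms
    tight; the second one makes it vanish.\<close>
  then have "tendsto_in_prob M (\<lambda>n \<omega>. (1 / sqrt (real n)) * ((1 / sqrt (real n)) * (\<Sum>i<n. Y i \<omega>))) 0"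
    by (intro bounded_in_prob_vanish sqrt_n_vanish) auto
  then have "tendsto_in_prob M (\<lambda>n \<omega>. (\<Sum>i<n. Y i \<omega>) / real n) 0" by simp
  then have "(\<lambda>n. prob {\<omega> \<in> space M. \<bar>(\<Sum>i<n. Y i \<omega>) / real n - 0\<bar> > e / 2}) \<longlonglongrightarrow> 0"
    using half_gt_zero[OF e] unfolding tendsto_in_prob_def by blast
  then have "\<forall>\<^sub>F n in sequentially. prob {\<omega> \<in> space M. \<bar>(\<Sum>i<n. Y i \<omega>) / real n - 0\<bar> > e / 2} < s / 2"
    using half_gt_zero[OF s] by (rule order_tendstoD(2))
  with eventually_gt_at_top[of 0]
  have "\<forall>\<^sub>F n in sequentially. norm (prob {\<omega> \<in> space M. \<bar>(\<Sum>i<n. X i \<omega>) / real n - expectation (X 0)\<bar> > e} - 0) < s"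
  proof eventually_elim
    case (elim n)
    define r where "r = expectation (R 0)"
    define Q where "Q \<omega> = (\<Sum>i<n. R i \<omega>) / real n - r" for \<omega>
    have intR: "integrable M (R i)" for i unfolding R_def using int int_t by simp
    have absR: "expectation (\<lambda>\<omega>. \<bar>R i \<omega>\<bar>) < e * s / 8" for i
      using k same(1)[of "\<lambda>x. \<bar>x - t k x\<bar>" i] by (simp add: R_def)
    have rb: "\<bar>r\<bar> < e * s / 8"
      unfolding r_def using integral_abs_bound[of M "R 0"] absR[of 0] by linarith
    have [measurable]: "random_variable borel Q" unfolding Q_def by measurable
    have intQ: "integrable M Q" unfolding Q_def using intR by simp
    have "expectation (\<lambda>\<omega>. \<bar>Q \<omega>\<bar>) \<le> expectation (\<lambda>\<omega>. (\<Sum>i<n. \<bar>R i \<omega>\<bar>) / real n + \<bar>r\<bar>)"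
    proof (rule integral_mono)
      fix \<omega>
      have "\<bar>Q \<omega>\<bar> \<le> \<bar>(\<Sum>i<n. R i \<omega>)\<bar> / real n + \<bar>r\<bar>"
        unfolding Q_def using abs_triangle_ineq4[of "(\<Sum>i<n. R i \<omega>) / real n" r] by simp
      also have "\<dots> \<le> (\<Sum>i<n. \<bar>R i \<omega>\<bar>) / real n + \<bar>r\<bar>"
        by (intro add_right_mono divide_right_mono sum_abs) simp
      finally show "\<bar>Q \<omega>\<bar> \<le> (\<Sum>i<n. \<bar>R i \<omega>\<bar>) / real n + \<bar>r\<bar>" .
    qed (use intQ intR in auto)
    also have "\<dots> = (\<Sum>i<n. expectation (\<lambda>\<omega>. \<bar>R i \<omega>\<bar>)) / real n + \<bar>r\<bar>"
      using intR by (simp add: prob_space)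
    also have "\<dots> \<le> (\<Sum>i<n. e * s / 8) / real n + e * s / 8"
      using rb absR by (intro add_mono divide_right_mono sum_mono) (auto intro: less_imp_le)
    also have "\<dots> = e * s / 4" using elim(1) by simp
    finally have EQ: "expectation (\<lambda>\<omega>. \<bar>Q \<omega>\<bar>) \<le> e * s / 4" .
    let ?A = "{\<omega> \<in> space M. \<bar>(\<Sum>i<n. Y i \<omega>) / real n - 0\<bar> > e / 2}" and ?B = "{\<omega> \<in> space M. \<bar>Q \<omega>\<bar> \<ge> e / 2}"
    have "prob ?B \<le> expectation (\<lambda>\<omega>. \<bar>Q \<omega>\<bar>) / (e / 2)"
      by (rule integral_Markov_inequality_measure[where A="space M"]) (use intQ e in auto)
    also have "\<dots> \<le> (e * s / 4) / (e / 2)" using EQ e by (intro divide_right_mono) auto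
    also have "\<dots> = s / 2" using e by simp
    finally have PB: "prob ?B \<le> s / 2" .
    have mu: "expectation (X 0) = m + r"
      unfolding r_def R_def m_def using int int_t by simp
    have split: "(\<Sum>i<n. X i \<omega>) / real n - expectation (X 0) = (\<Sum>i<n. Y i \<omega>) / real n + Q \<omega>" for \<omega>
    proof -
      have "(\<Sum>i<n. X i \<omega>) = (\<Sum>i<n. Y i \<omega> + R i \<omega> + m)"
        by (simp add: Y_def R_def)
      also have "\<dots> = (\<Sum>i<n. Y i \<omega>) + (\<Sum>i<n. R i \<omega>) + real n * m"
        by (simp add: sum.distrib)
      finally show ?thesis using elim(1) by (simp add: Q_def mu add_divide_distrib)
    qed
    have "e / 2 < \<bar>a - 0\<bar> \<or> e / 2 \<le> \<bar>b\<bar>" if "e < \<bar>a + b\<bar>" for a b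
      using that by arith
    then have "prob {\<omega> \<in> space M. \<bar>(\<Sum>i<n. X i \<omega>) / real n - expectation (X 0)\<bar> > e} \<le> prob (?A \<union> ?B)"
      unfolding split by (intro finite_measure_mono) (blast, measurable)
    also have "\<dots> \<le> prob ?A + prob ?B"
      by (rule measure_Un_le) measurable
    finally show ?case using elim PB by simp
  qed
  then show "\<exists>no. \<forall>n\<ge>no. norm (prob {\<omega> \<in> space M. \<bar>(\<Sum>i<n. X i \<omega>) / real n - expectation (X 0)\<bar> > e} - 0) < s"
    by (simp add: eventually_sequentially)
qed

end

section \<open>Matrix inverses and whitening\<close>

lemma matrix_inv_invertible:
  fixes A :: "real^'n^'n"
  assumes "invertible A"
  shows "matrix_inv A ** A = mat 1" "A ** matrix_inv A = mat 1"
  using someI_ex[OF assms[unfolded invertible_def]] unfolding matrix_inv_def by auto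

lemma matrix_inv_unique:
  fixes A B :: "real^'n^'n"
  assumes "A ** B = mat 1"
  shows "matrix_inv A = B"
proof -
  have BA: "B ** A = mat 1" using assms by (simp add: matrix_left_right_inverse)
  then have "invertible A" using assms by (auto simp: invertible_def)
  from matrix_inv_invertible(2)[OF this] have "B ** (A ** matrix_inv A) = B" by simp
  then show ?thesis by (simp add: matrix_mul_assoc BA)
qed

lemma matrix_mult_scaleR:
  fixes A :: "real^'n^'m" and B :: "real^'p^'n"
  shows "(c *\<^sub>R A) ** B = c *\<^sub>R (A ** B)" "A ** (c *\<^sub>R B) = c *\<^sub>R (A ** B)"
  by (simp_all add: matrix_matrix_mult_def vec_eq_iff sum_distrib_left mult_ac)

lemma matrix_vector_mult_scaleR:
  fixes A :: "real^'n^'m"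
  shows "(c *\<^sub>R A) *v x = c *\<^sub>R (A *v x)" "A *v (c *\<^sub>R x) = c *\<^sub>R (A *v x)"
  by (simp_all add: matrix_vector_mult_def vec_eq_iff sum_distrib_left mult_ac)

lemma matrix_inv_scaleR:
  fixes A :: "real^'n^'n"
  assumes "invertible A" "c \<noteq> 0"
  shows "matrix_inv (c *\<^sub>R A) = (1 / c) *\<^sub>R matrix_inv A"
  by (rule matrix_inv_unique) (use assms in \<open>simp add: matrix_mult_scaleR matrix_inv_invertible\<close>)

text \<open>Cramer's rule for the equation \<open>A *v y = axis j 1\<close>, whose solution is
  column \<open>j\<close> of the inverse. The entries become quotients of polynomials in the entries
  of \<open>A\<close>.\<close>

lemma matrix_inv_entry:
  fixes A :: "real^'n^'n"
  assumes "det A \<noteq> 0"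
  shows "matrix_inv A $ i $ j = det (\<chi> r s. if s = i then axis j 1 $ r else A $ r $ s) / det A"
proof -
  have "A *v (matrix_inv A *v axis j 1) = axis j 1"
    using assms by (simp add: matrix_vector_mul_assoc matrix_inv_invertible invertible_det_nz)
  then have "matrix_inv A *v axis j 1 = (\<chi> k. det (\<chi> r s. if s = k then axis j 1 $ r else A $ r $ s) / det A)"
    using cramer[OF assms] by blast
  then show ?thesis by (simp add: matrix_vector_mult_basis column_def vec_eq_iff)
qed

lemma tendsto_det:
  fixes f :: "'a \<Rightarrow> real^'n^'n"
  assumes "(f \<longlongrightarrow> A) F"
  shows "((\<lambda>x. det (f x)) \<longlongrightarrow> det A) F"
  unfolding det_def by (intro tendsto_intros assms)

text \<open>The determinant is eventually nonzero along the filter, so the inverse eventually agrees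
  with the quotients of \<open>matrix_inv_entry\<close>, and these converge.\<close>

lemma tendsto_matrix_inv:
  fixes f :: "'a \<Rightarrow> real^'n^'n"
  assumes f: "(f \<longlongrightarrow> A) F" and A: "det A \<noteq> 0"
  shows "((\<lambda>x. matrix_inv (f x)) \<longlongrightarrow> matrix_inv A) F"
proof -
  let ?c = "\<lambda>A i j. det (\<chi> r s. if s = i then axis j 1 $ r else A $ r $ s) / det A :: real"
  have "((\<lambda>x. if s = i then axis j 1 $ r else f x $ r $ s) \<longlongrightarrow> (if s = i then axis j 1 $ r else A $ r $ s)) F"
    for i j r s by (cases "s = i") (auto intro!: tendsto_intros f)
  then have "((\<lambda>x. \<chi> i j. ?c (f x) i j) \<longlongrightarrow> (\<chi> i j. ?c A i j)) F"
    by (intro tendsto_vec_lambda tendsto_divide tendsto_det f A)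
  moreover have "(\<chi> i j. ?c A i j) = matrix_inv A"
    using A by (simp add: vec_eq_iff matrix_inv_entry)
  moreover have "\<forall>\<^sub>F x in F. (\<chi> i j. ?c (f x) i j) = matrix_inv (f x)"
    using tendsto_imp_eventually_ne[OF tendsto_det[OF f] A]
    by eventually_elim (simp add: vec_eq_iff matrix_inv_entry)
  ultimately show ?thesis using tendsto_cong by force
qed

lemma tendsto_matrix_mult:
  fixes f :: "'a \<Rightarrow> real^'n^'m" and g :: "'a \<Rightarrow> real^'p^'n"
  assumes "(f \<longlongrightarrow> A) F" "(g \<longlongrightarrow> B) F"
  shows "((\<lambda>x. f x ** g x) \<longlongrightarrow> A ** B) F"
  unfolding matrix_matrix_mult_def by (intro tendsto_intros assms)

lemma tendsto_matrix_vector_mult: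
  fixes f :: "'a \<Rightarrow> real^'n^'m" and g :: "'a \<Rightarrow> real^'n"
  assumes "(f \<longlongrightarrow> A) F" "(g \<longlongrightarrow> x) F"
  shows "((\<lambda>x. f x *v g x) \<longlongrightarrow> A *v x) F"
  unfolding matrix_vector_mult_def by (intro tendsto_intros assms)

section \<open>Borel measurability of vectors, matrices and inverses\<close>

lemma borel_measurable_vec_iff:
  fixes f :: "'a \<Rightarrow> 'b::euclidean_space^'n"
  shows "f \<in> borel_measurable M \<longleftrightarrow> (\<forall>i. (\<lambda>x. f x $ i) \<in> borel_measurable M)"
proof
  show "f \<in> borel_measurable M \<Longrightarrow> \<forall>i. (\<lambda>x. f x $ i) \<in> borel_measurable M"
    by (auto intro!: borel_measurable_continuous_on[of "\<lambda>z. z $ _"] continuous_intros)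
  assume *: "\<forall>i. (\<lambda>x. f x $ i) \<in> borel_measurable M"
  show "f \<in> borel_measurable M"
    unfolding borel_measurable_euclidean_space[of f]
    using * by (auto simp: Basis_vec_def inner_axis intro!: borel_measurable_inner)
qed

lemma borel_measurable_vec_lambda [measurable (raw)]:
  fixes f :: "'a \<Rightarrow> 'n::finite \<Rightarrow> 'b::euclidean_space"
  assumes "\<And>i. (\<lambda>x. f x i) \<in> borel_measurable M"
  shows "(\<lambda>x. \<chi> i. f x i) \<in> borel_measurable M"
  using assms by (simp add: borel_measurable_vec_iff)

lemma borel_measurable_vec_nth [measurable (raw)]:
  fixes f :: "'a \<Rightarrow> 'b::euclidean_space^'n"
  shows "f \<in> borel_measurable M \<Longrightarrow> (\<lambda>x. f x $ i) \<in> borel_measurable M"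
  by (simp add: borel_measurable_vec_iff)

lemma borel_measurable_matrix_mult [measurable (raw)]:
  fixes f :: "'a \<Rightarrow> real^'n^'m" and g :: "'a \<Rightarrow> real^'p^'n"
  assumes [measurable]: "f \<in> borel_measurable M" "g \<in> borel_measurable M"
  shows "(\<lambda>x. f x ** g x) \<in> borel_measurable M"
  unfolding matrix_matrix_mult_def by measurable

lemma borel_measurable_matrix_vector_mult [measurable (raw)]:
  fixes f :: "'a \<Rightarrow> real^'n^'m" and g :: "'a \<Rightarrow> real^'n"
  assumes [measurable]: "f \<in> borel_measurable M" "g \<in> borel_measurable M"
  shows "(\<lambda>x. f x *v g x) \<in> borel_measurable M"
  unfolding matrix_vector_mult_def by measurable

text \<open>Both inverses are choices from the same empty set of candidates, hence the same
  unspecified matrix.\<close>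

lemma matrix_inv_singular:
  fixes A B :: "real^'n^'n"
  assumes "det A = 0" "det B = 0"
  shows "matrix_inv A = matrix_inv B"
proof -
  have "(\<lambda>A'. A ** A' = mat 1 \<and> A' ** A = mat 1) = (\<lambda>A'. B ** A' = mat 1 \<and> A' ** B = mat 1)"
    using assms invertible_det_nz[of A] invertible_det_nz[of B] by (auto simp: invertible_def fun_eq_iff)
  then show ?thesis unfolding matrix_inv_def by simp
qed

text \<open>Inversion is continuous on the open set of invertible matrices and constant on its
  complement, where the matrix \<open>0\<close> serves as representative.\<close>

lemma borel_measurable_matrix_inv [measurable]:
  "(matrix_inv :: real^'n^'n \<Rightarrow> real^'n^'n) \<in> borel_measurable borel"
proof -
  let ?U = "{A :: real^'n^'n. det A \<noteq> 0}"
  have det_cont: "continuous_on UNIV (det :: real^'n^'n \<Rightarrow> real)"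
    unfolding continuous_on_def by (auto intro!: tendsto_det)
  have "open ?U"
    by (rule open_Collect_neq[OF det_cont continuous_on_const])
  moreover have "continuous_on ?U (matrix_inv :: real^'n^'n \<Rightarrow> real^'n^'n)"
    unfolding continuous_on_def by (auto intro!: tendsto_matrix_inv)
  ultimately have "(\<lambda>A. if A \<in> ?U then matrix_inv A else matrix_inv (0 :: real^'n^'n)) \<in> borel_measurable borel"
    by (intro borel_measurable_continuous_on_if) auto
  moreover have "(\<lambda>A. if A \<in> ?U then matrix_inv A else matrix_inv (0 :: real^'n^'n)) = matrix_inv"
  proof
    have "det (0 :: real^'n^'n) = 0" using det_0 by (simp add: mat_def zero_vec_def)
    then show "(if A \<in> ?U then matrix_inv A else matrix_inv 0) = matrix_inv A" for A :: "real^'n^'n"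
      using matrix_inv_singular[of A 0] by simp
  qed
  ultimately show ?thesis by simp
qed

section \<open>Diagonal matrices and whitening\<close>

definition diag_mat :: "('c::finite \<Rightarrow> real) \<Rightarrow> real^'c^'c" where
  "diag_mat d = (\<chi> a b. if a = b then d a else 0)"

lemma diag_mat_vector: "diag_mat d *v x = (\<chi> a. d a * x $ a)"
proof -
  have "(\<Sum>j\<in>UNIV. (if i = j then d i else 0) * x $ j) = d i * x $ i" for i
    by (subst sum.remove[of _ i]) auto
  then show ?thesis by (simp add: diag_mat_def matrix_vector_mult_def)
qed

lemma matrix_inv_diag_mat:
  assumes "\<And>a. d a \<noteq> 0"
  shows "matrix_inv (diag_mat d) = diag_mat (\<lambda>a. 1 / d a)"
  by (rule matrix_inv_unique)
    (simp add: matrix_eq matrix_vector_mul_assoc[symmetric] diag_mat_vector assms)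

lemma det_diag_mat: "(\<And>a. d a \<noteq> 0) \<Longrightarrow> det (diag_mat d) \<noteq> 0"
  by (simp add: diag_mat_def det_diagonal)

text \<open>Gram--Schmidt on the rows of \<open>C D\<^sup>1\<^sup>/\<^sup>2\<close> plays the part of the inverse square root of \<open>C D C\<^sup>t\<close>.\<close>

lemma whitening_exists:
  fixes C :: "real^'c^'m"
  assumes rank: "rank C = CARD('m)" and d: "\<And>a. 0 < d a"
  obtains P :: "real^'m^'m" where "P ** (C ** diag_mat d ** transpose C) ** transpose P = mat 1"
proof -
  \<comment> \<open>Since \<open>d\<close> is positive,
    \<open>C ** diag_mat d ** transpose C\<close> is the Gram matrix of the rows of
    \<open>E\<close>, so it suffices to make these rows orthonormal by a linear change
    \<open>P\<close>.\<close>
  define E where "E = C ** diag_mat (\<lambda>a. sqrt (d a))"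
  have "diag_mat (\<lambda>a. sqrt (d a)) ** transpose (diag_mat (\<lambda>a. sqrt (d a))) = diag_mat d"
  proof -
    have "transpose (diag_mat (\<lambda>a. sqrt (d a))) = diag_mat (\<lambda>a. sqrt (d a))"
      by (auto simp: diag_mat_def transpose_def vec_eq_iff)
    then show ?thesis
      using d by (simp add: matrix_eq matrix_vector_mul_assoc[symmetric] diag_mat_vector vec_eq_iff less_imp_le
          mult.assoc[symmetric])
  qed
  then have EE: "E ** transpose E = C ** diag_mat d ** transpose C"
    by (simp add: E_def matrix_transpose_mul matrix_mul_assoc)
      (simp add: matrix_mul_assoc[symmetric])
  have "surj ((*v) C)" using rank full_rank_surjective by blast
  have "\<exists>x. E *v x = y" for y
  proof -
    obtain x where x: "C *v x = y" using \<open>surj ((*v) C)\<close> by (metis surj_def)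
    have "diag_mat (\<lambda>a. sqrt (d a)) *v (\<chi> a. x $ a / sqrt (d a)) = x"
      using d by (simp add: diag_mat_vector vec_eq_iff less_imp_neq[symmetric])
    then have "E *v (\<chi> a. x $ a / sqrt (d a)) = y"
      by (simp add: E_def matrix_vector_mul_assoc[symmetric] x)
    then show ?thesis by blast
  qed
  then have "surj ((*v) E)" by (metis surj_def)
  then have "rank E = CARD('m)" using full_rank_surjective by blast
  then have dim: "dim (span (rows E)) = CARD('m)" by (simp add: row_rank_def)
  \<comment> \<open>Scaling by the positive square roots preserves the rank, so this orthonormal
    basis of the row space of \<open>E\<close> has as many elements as the type \<open>'m\<close>
    and can be indexed by it.\<close>
  obtain B where B: "B \<subseteq> span (rows E)" "pairwise orthogonal B" "\<And>x. x \<in> B \<Longrightarrow> norm x = 1"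
      "independent B" "card B = dim (span (rows E))"
    using orthonormal_basis_subspace[OF subspace_span, of "rows E"] by metis
  have "finite B" using B(4) by (rule independent_imp_finite)
  then obtain b where b: "bij_betw b (UNIV :: 'm set) B"
    using finite_same_card_bij[of "UNIV :: 'm set" B] B(5) dim by auto
  \<comment> \<open>Each basis vector is a combination of the rows of \<open>E\<close>; the
    coefficient vectors become the rows of \<open>P\<close>.\<close>
  have "\<exists>y. b i = transpose E *v y" for i
  proof -
    have "b i \<in> span (columns (transpose E))"
      using b B(1) by (auto simp: bij_betw_def)
    also have "\<dots> \<subseteq> range ((*v) (transpose E))"
      unfolding columns_image_basis by (subst linear_span_image) (auto simp: matrix_vector_mul_linear)
    finally show ?thesis by auto
  qed
  then obtain y where y: "\<And>i. b i = transpose E *v y i" by metis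
  define P where "P = (\<chi> i. y i)"
  have PE: "(P ** E) $ i = b i" for i
    unfolding y by (simp add: P_def matrix_matrix_mult_def matrix_vector_mult_def transpose_def vec_eq_iff mult.commute)
  have "(P ** E) ** transpose (P ** E) = mat 1"
  proof -
    have "((P ** E) ** transpose (P ** E)) $ i $ j = b i \<bullet> b j" for i j
      by (simp add: PE[symmetric] matrix_matrix_mult_def transpose_def inner_vec_def)
    moreover have "b i \<bullet> b j = (if i = j then 1 else 0)" for i j
    proof (cases "i = j")
      case True
      have "b j \<in> B" using b by (auto simp: bij_betw_def)
      then show ?thesis using B(3)[of "b j"] True by (simp add: norm_eq_1)
    next
      case False
      then have "b i \<noteq> b j" "b i \<in> B" "b j \<in> B" using b by (auto simp: bij_betw_def inj_on_def)
      then show ?thesis using B(2) False by (auto simp: pairwise_def orthogonal_def)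
    qed
    ultimately show ?thesis by (simp add: vec_eq_iff mat_def)
  qed
  then have "P ** (E ** transpose E) ** transpose P = mat 1"
    by (simp add: matrix_transpose_mul matrix_mul_assoc)
  then show ?thesis using that unfolding EE by blast
qed

text \<open>One-sided inverses of square matrices are two-sided, so the factor \<open>P\<close> may
  be moved from the left end of the product to the right end.\<close>

lemma whitening_inverse:
  fixes A P :: "real^'m^'m"
  assumes "P ** A ** transpose P = mat 1"
  shows "matrix_inv A = transpose P ** P" and "invertible A"
proof -
  have "P ** (A ** transpose P) = mat 1" using assms by (simp add: matrix_mul_assoc)
  then have "A ** transpose P ** P = mat 1" by (rule matrix_left_right_inverse1)
  then have *: "A ** (transpose P ** P) = mat 1" by (simp add: matrix_mul_assoc)
  then show "matrix_inv A = transpose P ** P" by (rule matrix_inv_unique)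
  show "invertible A" using * matrix_left_right_inverse1[OF *] by (auto simp: invertible_def)
qed

text \<open>Turns the quadratic form of the test statistic into a squared norm, whose limit law is
  accessible through characteristic functions.\<close>

lemma whitening_quadratic_form:
  fixes A P :: "real^'m^'m"
  assumes "P ** A ** transpose P = mat 1"
  shows "w \<bullet> (matrix_inv A *v w) = (norm (P *v w))\<^sup>2"
proof -
  have "w \<bullet> (matrix_inv A *v w) = w \<bullet> (transpose P *v (P *v w))"
    by (simp add: whitening_inverse(1)[OF assms] matrix_vector_mul_assoc)
  also have "\<dots> = (P *v w) \<bullet> (P *v w)"
    by (simp add: dot_lmul_matrix[symmetric] vector_transpose_matrix inner_commute)
  finally show ?thesis by (simp add: power2_norm_eq_inner)
qed

section \<open>The test statistic as a function of averages\<close>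

text \<open>The arguments \<open>H\<close>, \<open>s\<close>, \<open>k\<close>, \<open>r\<close>, \<open>z\<close> stand for \<open>G\<^sup>t G / n\<close>, the mean of \<open>u\<^sub>i\<^sup>2\<close>, \<open>1 / n\<close>, \<open>n / (n - p - 2)\<close>
  and \<open>n\<^sup>-\<^sup>1\<^sup>/\<^sup>2 G\<^sup>t u\<close>.\<close>

definition wald_form ::
    "real^(bool + 'p::finite)^'m::finite \<Rightarrow> real^'m \<Rightarrow> (real^(bool + 'p)^(bool + 'p)) \<times> real \<times> real \<times> real
      \<Rightarrow> real^(bool + 'p) \<Rightarrow> real" where
  "wald_form C \<Delta> = (\<lambda>(H, s, k, r) z.
     (let w = C *v (matrix_inv H *v z) + \<Delta> in
       (w \<bullet> (matrix_inv (C ** matrix_inv H ** transpose C) *v w))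
         / (real CARD('m) * ((s - k * (z \<bullet> (matrix_inv H *v z))) * r))))"

lemma cross_moment_add:
  "cross_moment n G (\<lambda>i. f i + g i) = cross_moment n G f + cross_moment n G g"
  by (simp add: cross_moment_def vec_eq_iff distrib_left sum.distrib)

lemma cross_moment_linear: "cross_moment n G (\<lambda>i. G i \<bullet> \<theta>) = gram n G *v \<theta>"
  by (simp add: cross_moment_def gram_def matrix_vector_mult_def inner_vec_def vec_eq_iff
      sum_distrib_left sum_distrib_right mult.assoc sum.swap[of _ UNIV])

lemma cross_moment_inner: "cross_moment n G f \<bullet> y = (\<Sum>i<n. f i * (G i \<bullet> y))"
  by (simp add: cross_moment_def inner_vec_def sum_distrib_left sum_distrib_right
      sum.swap[of _ UNIV] mult_ac)

text \<open>With \<open>gram n G = real n *\<^sub>R H\<close> and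
  \<open>cross_moment n G u = sqrt (real n) *\<^sub>R z\<close> the estimation error is
  \<open>matrix_inv H *v z\<close> divided by \<open>sqrt (real n)\<close>. The powers of
  \<open>n\<close> cancel in the quadratic form, and the parameters survive only through
  \<open>\<Delta>\<close>.\<close>

lemma S_star_eq_wald_form:
  fixes C :: "real^(bool + 'p::finite)^'m::finite"
  assumes n: "0 < n" and Y: "\<And>i. i < n \<Longrightarrow> Y i = G i \<bullet> \<theta> + u i"
    and \<Delta>: "C *v \<theta> - c\<^sub>0 = (1 / sqrt (real n)) *\<^sub>R \<Delta>"
    and H_def: "H = (1 / real n) *\<^sub>R gram n G" and z_def: "z = (1 / sqrt (real n)) *\<^sub>R cross_moment n G u"
    and H: "det H \<noteq> 0" and M: "det (C ** matrix_inv H ** transpose C) \<noteq> 0"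
  shows "S_star C c\<^sub>0 n G Y = wald_form C \<Delta>
    (H, (\<Sum>i<n. (u i)\<^sup>2) / real n, 1 / real n, real n / (real n - real CARD('p) - 2)) z"
proof -
  let ?s = "sqrt (real n)"
  have s: "?s > 0" "?s * ?s = real n" using n by auto
  have sn: "?s / real n = 1 / ?s" using s by (simp add: real_div_sqrt field_simps)
  have inv: "invertible H" "invertible (C ** matrix_inv H ** transpose C)"
    using H M by (simp_all add: invertible_det_nz)
  have gram: "gram n G = real n *\<^sub>R H" using n by (simp add: H_def)
  have gram_inv: "matrix_inv (gram n G) = (1 / real n) *\<^sub>R matrix_inv H"
    unfolding gram using inv n by (simp add: matrix_inv_scaleR)
  have cross_u: "cross_moment n G u = ?s *\<^sub>R z" using s by (simp add: z_def)
  define y where "y = matrix_inv H *v z"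
  have Hy: "H *v y = z" using inv(1) by (simp add: y_def matrix_vector_mul_assoc matrix_inv_invertible)
  have "cross_moment n G Y = cross_moment n G (\<lambda>i. G i \<bullet> \<theta> + u i)"
    by (simp add: cross_moment_def Y)
  then have cross_Y: "cross_moment n G Y = real n *\<^sub>R (H *v \<theta>) + ?s *\<^sub>R z"
    by (simp add: cross_moment_add cross_moment_linear gram cross_u matrix_vector_mult_scaleR)
  have ols: "ols n G Y = \<theta> + (1 / ?s) *\<^sub>R y"
    unfolding ols_def gram_inv cross_Y using inv(1) n
    by (simp add: matrix_vector_right_distrib matrix_vector_mult_scaleR matrix_vector_mul_assoc
        matrix_inv_invertible matrix_mult_scaleR y_def[symmetric] sn)
  define w where "w = C *v y + \<Delta>"
  have d: "C *v ols n G Y - c\<^sub>0 = (1 / ?s) *\<^sub>R w"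
  proof -
    have "C *v ols n G Y - c\<^sub>0 = (C *v \<theta> - c\<^sub>0) + (1 / ?s) *\<^sub>R (C *v y)"
      by (simp add: ols matrix_vector_right_distrib matrix_vector_mult_scaleR)
    then show ?thesis by (simp add: \<Delta> w_def scaleR_add_right)
  qed
  \<comment> \<open>The residuals are \<open>u i\<close> minus the fitted part of the error. Since
    \<open>H *v y = z\<close>, the mixed term contributes \<open>- 2 * (z \<bullet> y)\<close> and
    the squared fit contributes \<open>z \<bullet> y\<close>.\<close>
  have "(\<Sum>i<n. (Y i - G i \<bullet> ols n G Y)\<^sup>2) = (\<Sum>i<n. (u i - (1 / ?s) * (G i \<bullet> y))\<^sup>2)"
    by (intro sum.cong refl) (simp add: Y ols inner_add_right)
  also have "\<dots> = (\<Sum>i<n. (u i)\<^sup>2) - 2 * (1 / ?s) * (\<Sum>i<n. u i * (G i \<bullet> y))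
      + (1 / ?s)\<^sup>2 * (\<Sum>i<n. (G i \<bullet> y) * (G i \<bullet> y))"
  proof -
    have "(a - c * b)\<^sup>2 = a\<^sup>2 - 2 * c * (a * b) + c\<^sup>2 * (b * b)" for a b c :: real
      by (simp add: power2_eq_square algebra_simps)
    then show ?thesis by (simp only: sum.distrib sum_subtractf sum_distrib_left)
  qed
  also have "(\<Sum>i<n. u i * (G i \<bullet> y)) = ?s * (z \<bullet> y)"
    by (simp add: cross_moment_inner[symmetric] cross_u)
  also have "(\<Sum>i<n. (G i \<bullet> y) * (G i \<bullet> y)) = real n * (z \<bullet> y)"
    by (simp add: cross_moment_inner[of n G "\<lambda>i. G i \<bullet> y" y, symmetric] cross_moment_linear gram
        matrix_vector_mult_scaleR Hy)
  also have "(\<Sum>i<n. (u i)\<^sup>2) - 2 * (1 / ?s) * (?s * (z \<bullet> y)) + (1 / ?s)\<^sup>2 * (real n * (z \<bullet> y)) =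
      (\<Sum>i<n. (u i)\<^sup>2) - z \<bullet> y"
    using n by (simp add: power_divide)
  finally have rss: "(\<Sum>i<n. (Y i - G i \<bullet> ols n G Y)\<^sup>2) = (\<Sum>i<n. (u i)\<^sup>2) - z \<bullet> y" .
  \<comment> \<open>Also true when \<open>n = CARD('p) + 2\<close>, where both sides are 0 by the
    convention for division.\<close>
  have sigma: "sigma_hat2 n G Y =
      ((\<Sum>i<n. (u i)\<^sup>2) / real n - (1 / real n) * (z \<bullet> y)) * (real n / (real n - real CARD('p) - 2))"
  proof -
    have "(\<Sum>i<n. (u i)\<^sup>2) / real n - (1 / real n) * (z \<bullet> y) = ((\<Sum>i<n. (u i)\<^sup>2) - z \<bullet> y) / real n"
      by (simp add: diff_divide_distrib)
    then show ?thesis using n by (simp add: sigma_hat2_def rss)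
  qed
  have "C ** matrix_inv (gram n G) ** transpose C = (1 / real n) *\<^sub>R (C ** matrix_inv H ** transpose C)"
    by (simp add: gram_inv matrix_mult_scaleR)
  then have mid: "matrix_inv (C ** matrix_inv (gram n G) ** transpose C) =
      real n *\<^sub>R matrix_inv (C ** matrix_inv H ** transpose C)"
    using inv(2) n by (simp add: matrix_inv_scaleR)
  have "((1 / ?s) *\<^sub>R w) \<bullet> ((real n *\<^sub>R matrix_inv (C ** matrix_inv H ** transpose C)) *v ((1 / ?s) *\<^sub>R w)) =
      w \<bullet> (matrix_inv (C ** matrix_inv H ** transpose C) *v w)"
    using n by (simp add: matrix_vector_mult_scaleR)
  then show ?thesis
    unfolding S_star_def Let_def d mid sigma wald_form_def by (simp add: w_def y_def)
qed

text \<open>At \<open>k = 0\<close> and \<open>r = 1\<close> the term subtracted from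
  \<open>s\<close> disappears and the denominator is \<open>real CARD('m) * s\<close>, which is
  nonzero whatever \<open>z\<close> is.\<close>

lemma isCont_wald_form:
  fixes C :: "real^(bool + 'p::finite)^'m::finite"
  assumes H: "det H \<noteq> 0" and M: "det (C ** matrix_inv H ** transpose C) \<noteq> 0" and s: "s \<noteq> 0"
  shows "isCont (\<lambda>(a, z). wald_form C \<Delta> a z) ((H, s, 0, 1), z)"
proof -
  let ?F = "at ((H, s, 0::real, 1::real), z)"
  note t = tendsto_matrix_inv tendsto_matrix_mult tendsto_matrix_vector_mult tendsto_intros
  have *: "((\<lambda>x. fst (fst x)) \<longlongrightarrow> H) ?F" "((\<lambda>x. snd x) \<longlongrightarrow> z) ?F"
    "((\<lambda>x. fst (snd (fst x))) \<longlongrightarrow> s) ?F" "((\<lambda>x. fst (snd (snd (fst x)))) \<longlongrightarrow> 0) ?F"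
    "((\<lambda>x. snd (snd (snd (fst x)))) \<longlongrightarrow> 1) ?F"
    by (auto intro!: tendsto_eq_intros)
  show ?thesis
    unfolding isCont_def wald_form_def split_beta Let_def fst_conv snd_conv
    by (intro t * H M) (use s in simp)
qed

section \<open>The central limit theorem in terms of characters\<close>

text \<open>The standardised sum is divided by \<open>s * sqrt (real n)\<close>; evaluating its
  characteristic function at the point \<open>s\<close> undoes the scaling by the standard
  deviation.\<close>

lemma (in prob_space) clt_char:
  fixes r :: "nat \<Rightarrow> 'a \<Rightarrow> real"
  assumes indep: "indep_vars (\<lambda>_. borel) r UNIV"
    and distr: "\<And>i. distr M borel (r i) = distr M borel (r 0)"
    and mean: "\<And>i. expectation (r i) = 0"
    and sq: "\<And>i. integrable M (\<lambda>\<omega>. (r i \<omega>)\<^sup>2)"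
    and var: "\<And>i. expectation (\<lambda>\<omega>. (r i \<omega>)\<^sup>2) = s\<^sup>2" and s: "0 < s"
  shows "(\<lambda>n. \<integral>\<omega>. iexp ((1 / sqrt (real n)) * (\<Sum>i<n. r i \<omega>)) \<partial>M) \<longlonglongrightarrow> complex_of_real (exp (- s\<^sup>2 / 2))"
proof -
  have [measurable]: "random_variable borel (r i)" for i
    using indep by (simp add: indep_vars_def)
  let ?S = "\<lambda>n. distr M borel (\<lambda>\<omega>. (\<Sum>i<n. r i \<omega>) / sqrt (real n * s\<^sup>2))"
  have "weak_conv_m ?S std_normal_distribution"
    by (rule central_limit_theorem_zero_mean[OF indep mean s sq _ distr]) (simp add: mean var)
  then have "(\<lambda>n. char (?S n) s) \<longlonglongrightarrow> char std_normal_distribution s"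
    by (intro levy_continuity1 real_distribution_distr real_dist_normal_dist) auto
  moreover have "char (?S n) s = (\<integral>\<omega>. iexp ((1 / sqrt (real n)) * (\<Sum>i<n. r i \<omega>)) \<partial>M)" for n
  proof -
    have eq: "s * ((\<Sum>i<n. r i \<omega>) / sqrt (real n * s\<^sup>2)) = (1 / sqrt (real n)) * (\<Sum>i<n. r i \<omega>)" for \<omega>
      using s by (simp add: real_sqrt_mult)
    have "char (?S n) s = (\<integral>\<omega>. iexp (s * ((\<Sum>i<n. r i \<omega>) / sqrt (real n * s\<^sup>2))) \<partial>M)"
      unfolding char_def by (rule integral_distr) measurable
    then show ?thesis by (simp only: eq)
  qed
  ultimately show ?thesis by (simp add: char_std_normal_distribution)
qed

section \<open>Independence in the design\<close>

context covariate_adaptive_design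
begin

lemma x_measurable [measurable]: "random_variable borel (x i)"
  using x_indep by (simp add: indep_vars_def)

lemma eps_measurable [measurable]: "random_variable borel (\<epsilon> i)"
  using eps_indep by (simp add: indep_vars_def)

lemma X_measurable [measurable]: "random_variable borel (X j)"
  using X_indep by (simp add: indep_vars_def)

text \<open>Independence of two sigma-algebras passes to sub-sigma-algebras, and those generated by
  the images under \<open>f\<close> and \<open>g\<close> are such. Unlike the raw data, the two
  images have values in one type, as \<open>indep_var\<close> demands.\<close>

lemma design_indep_noise:
  assumes f: "f \<in> Pi\<^sub>M {..<n} (\<lambda>_. borel \<Otimes>\<^sub>M borel) \<rightarrow>\<^sub>M N1"
    and g: "g \<in> Pi\<^sub>M {..<n} (\<lambda>_. borel) \<rightarrow>\<^sub>M N2"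
  shows "indep_var N1 (\<lambda>\<omega>. f (\<lambda>i\<in>{..<n}. (T n i \<omega>, x i \<omega>))) N2 (\<lambda>\<omega>. g (\<lambda>i\<in>{..<n}. \<epsilon> i \<omega>))"
proof -
  let ?D = "\<lambda>\<omega>. \<lambda>i\<in>{..<n}. (T n i \<omega>, x i \<omega>)" and ?E = "\<lambda>\<omega>. \<lambda>i\<in>{..<n}. \<epsilon> i \<omega>"
  let ?VD = "vimage_algebra (space M) ?D (Pi\<^sub>M {..<n} (\<lambda>_. borel \<Otimes>\<^sub>M borel))"
  let ?VE = "vimage_algebra (space M) ?E (Pi\<^sub>M {..<n} (\<lambda>_. borel))"
  have D: "?D \<in> M \<rightarrow>\<^sub>M Pi\<^sub>M {..<n} (\<lambda>_. borel \<Otimes>\<^sub>M borel)"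
    using T_measurable by (intro measurable_restrict measurable_Pair) auto
  have E: "?E \<in> M \<rightarrow>\<^sub>M Pi\<^sub>M {..<n} (\<lambda>_. borel)"
    by (intro measurable_restrict) auto
  have sub: "sigma_sets (space M) {(\<lambda>\<omega>. h (F \<omega>)) -` A \<inter> space M |A. A \<in> sets N} \<subseteq>
      sets (vimage_algebra (space M) F L)"
    if "F \<in> M \<rightarrow>\<^sub>M L" "h \<in> L \<rightarrow>\<^sub>M N" for F h L N
  proof -
    have "F \<in> vimage_algebra (space M) F L \<rightarrow>\<^sub>M L"
      using measurable_space[OF that(1)] by (intro measurable_vimage_algebra1) auto
    then have "(\<lambda>\<omega>. h (F \<omega>)) \<in> vimage_algebra (space M) F L \<rightarrow>\<^sub>M N"
      using that(2) by (rule measurable_compose)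
    then have "{(\<lambda>\<omega>. h (F \<omega>)) -` A \<inter> space M |A. A \<in> sets N} \<subseteq> sets (vimage_algebra (space M) F L)"
      by (auto dest: measurable_sets)
    from sets.sigma_sets_subset[OF this] show ?thesis by simp
  qed
  have "indep_set
      (sigma_sets (space M) {(\<lambda>\<omega>. f (?D \<omega>)) -` A \<inter> space M |A. A \<in> sets N1})
      (sigma_sets (space M) {(\<lambda>\<omega>. g (?E \<omega>)) -` A \<inter> space M |A. A \<in> sets N2})"
    unfolding indep_set_def
    by (rule indep_sets_mono_sets[OF design_indep_eps[of n, unfolded indep_set_def]])
      (use sub[OF D f] sub[OF E g] in \<open>auto split: bool.split\<close>)
  then show ?thesis
    unfolding indep_var_eq using measurable_compose[OF D f] measurable_compose[OF E g] by blast
qed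

text \<open>Independence of design and noise is given for each number of units; \<open>Suc i\<close>
  units are the fewest that contain unit \<open>i\<close>.\<close>

lemma x_indep_eps:
  assumes f [measurable]: "f \<in> borel \<rightarrow>\<^sub>M N1" and g [measurable]: "g \<in> borel \<rightarrow>\<^sub>M N2"
  shows "indep_var N1 (\<lambda>\<omega>. f (x i \<omega>)) N2 (\<lambda>\<omega>. g (\<epsilon> i \<omega>))"
  using design_indep_noise[of "\<lambda>d. f (snd (d i))" "Suc i" N1 "\<lambda>d. g (d i)" N2] by simp

lemma
  fixes f :: "real^'k \<Rightarrow> real" and g :: "real \<Rightarrow> real"
  assumes [measurable]: "f \<in> borel_measurable borel" "g \<in> borel_measurable borel"
    and int: "integrable M (\<lambda>\<omega>. f (x i \<omega>))" "integrable M (\<lambda>\<omega>. g (\<epsilon> i \<omega>))"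
  shows integrable_x_eps: "integrable M (\<lambda>\<omega>. f (x i \<omega>) * g (\<epsilon> i \<omega>))"
    and expectation_x_eps: "expectation (\<lambda>\<omega>. f (x i \<omega>) * g (\<epsilon> i \<omega>)) =
      expectation (\<lambda>\<omega>. f (x i \<omega>)) * expectation (\<lambda>\<omega>. g (\<epsilon> i \<omega>))"
  using indep_var_integrable[OF x_indep_eps int] indep_var_lebesgue_integral[OF x_indep_eps int] by auto

text \<open>The covariates and the noise are each independent across units, and the two families are
  independent within each finite experiment. For rectangles the expectation of the product of
  indicators can therefore be split by family, then by unit, and regrouped; rectangles are stable
  under intersection and generate the product sigma-algebra.\<close>

lemma unit_indep: "indep_vars (\<lambda>_. borel \<Otimes>\<^sub>M borel) (\<lambda>i \<omega>. (x i \<omega>, \<epsilon> i \<omega>)) UNIV"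
proof -
  define R where "R i = {(x i -` A \<inter> \<epsilon> i -` B) \<inter> space M | A B. A \<in> sets borel \<and> B \<in> sets borel}" for i
  have R_events: "R i \<subseteq> events" for i
  proof -
    have "(x i -` A \<inter> \<epsilon> i -` B) \<inter> space M \<in> events" if "A \<in> sets borel" "B \<in> sets borel" for A B
    proof -
      have "(x i -` A \<inter> space M) \<inter> (\<epsilon> i -` B \<inter> space M) \<in> events"
        using that by (intro sets.Int measurable_sets[OF x_measurable] measurable_sets[OF eps_measurable])
      moreover have "(x i -` A \<inter> \<epsilon> i -` B) \<inter> space M = (x i -` A \<inter> space M) \<inter> (\<epsilon> i -` B \<inter> space M)" by auto
      ultimately show ?thesis by simp
    qed
    then show ?thesis unfolding R_def by blast
  qed
  have "indep_sets R UNIV"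
  proof (rule indep_setsI)
    show "R i \<subseteq> events" for i by (rule R_events)
  next
    fix A and J :: "nat set"
    assume J: "J \<noteq> {}" "finite J" and AR: "\<forall>j\<in>J. A j \<in> R j"
    have A_events: "A j \<in> events" if "j \<in> J" for j using AR R_events that by blast
    have "\<forall>j\<in>J. \<exists>a b. a \<in> sets borel \<and> b \<in> sets borel \<and> A j = (x j -` a \<inter> \<epsilon> j -` b) \<inter> space M"
    proof
      fix j assume "j \<in> J"
      with AR have "A j \<in> R j" ..
      then show "\<exists>a b. a \<in> sets borel \<and> b \<in> sets borel \<and> A j = (x j -` a \<inter> \<epsilon> j -` b) \<inter> space M"
        unfolding R_def mem_Collect_eq by (elim exE conjE) (intro exI conjI)
    qed
    from bchoice[OF this] obtain a where
      "\<forall>j\<in>J. \<exists>b. a j \<in> sets borel \<and> b \<in> sets borel \<and> A j = (x j -` a j \<inter> \<epsilon> j -` b) \<inter> space M" ..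
    from bchoice[OF this] obtain b where b:
      "\<forall>j\<in>J. a j \<in> sets borel \<and> b j \<in> sets borel \<and> A j = (x j -` a j \<inter> \<epsilon> j -` b j) \<inter> space M" ..
    note ab = b[THEN bspec, THEN conjunct1] b[THEN bspec, THEN conjunct2, THEN conjunct1]
      b[THEN bspec, THEN conjunct2, THEN conjunct2]
    \<comment> \<open>Indices outside \<open>J\<close> get the constant 1, so that measurability and
      integrability hold for every index.\<close>
    define f where "f j = (if j \<in> J then indicat_real (a j) else (\<lambda>_. 1))" for j
    define g where "g j = (if j \<in> J then indicat_real (b j) else (\<lambda>_. 1))" for j
    have [measurable]: "f j \<in> borel_measurable borel" "g j \<in> borel_measurable borel" for j
      using ab by (auto simp: f_def g_def)
    have f01: "0 \<le> f j z" "f j z \<le> 1" and g01: "0 \<le> g j y" "g j y \<le> 1" for j z y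
      by (auto simp: f_def g_def)
    have intf: "integrable M (\<lambda>\<omega>. f j (x j \<omega>))" and intg: "integrable M (\<lambda>\<omega>. g j (\<epsilon> j \<omega>))" for j
      by (auto intro!: integrable_const_bound[of _ 1] simp: f01 g01)
    have prob_A: "prob (A j) = expectation (\<lambda>\<omega>. f j (x j \<omega>)) * expectation (\<lambda>\<omega>. g j (\<epsilon> j \<omega>))" if "j \<in> J" for j
    proof -
      have "prob (A j) = expectation (indicator (A j))"
        using A_events[OF that] by simp
      also have "\<dots> = expectation (\<lambda>\<omega>. f j (x j \<omega>) * g j (\<epsilon> j \<omega>))"
        by (intro Bochner_Integration.integral_cong) (auto simp: ab(3)[OF that] f_def g_def that indicator_def)
      also have "\<dots> = expectation (\<lambda>\<omega>. f j (x j \<omega>)) * expectation (\<lambda>\<omega>. g j (\<epsilon> j \<omega>))"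
        by (rule expectation_x_eps) (auto simp: intf intg)
      finally show ?thesis .
    qed
    \<comment> \<open>A finite set of units fits into one experiment, whose independence of design
      and noise separates the two products.\<close>
    obtain n where n: "J \<subseteq> {..<n}" using J(2) finite_nat_iff_bounded by blast
    let ?F = "\<lambda>\<omega>. \<Prod>j\<in>J. f j (x j \<omega>)" and ?G = "\<lambda>\<omega>. \<Prod>j\<in>J. g j (\<epsilon> j \<omega>)"
    have indF: "indep_vars (\<lambda>_. borel) (\<lambda>j \<omega>. f j (x j \<omega>)) J"
      by (rule indep_vars_subset[OF indep_vars_compose2[OF x_indep]]) auto
    have indG: "indep_vars (\<lambda>_. borel) (\<lambda>j \<omega>. g j (\<epsilon> j \<omega>)) J"
      by (rule indep_vars_subset[OF indep_vars_compose2[OF eps_indep]]) auto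
    have ind: "indep_var borel ?F borel ?G"
    proof -
      have eq: "(\<Prod>j\<in>J. f j (snd ((\<lambda>i\<in>{..<n}. (T n i \<omega>, x i \<omega>)) j))) = ?F \<omega>"
        "(\<Prod>j\<in>J. g j ((\<lambda>i\<in>{..<n}. \<epsilon> i \<omega>) j)) = ?G \<omega>" for \<omega>
        using n by (auto intro!: prod.cong)
      have "(\<lambda>d. \<Prod>j\<in>J. f j (snd (d j))) \<in> borel_measurable (Pi\<^sub>M {..<n} (\<lambda>_. borel \<Otimes>\<^sub>M borel))"
        using n by (intro borel_measurable_prod) (measurable, auto)
      moreover have "(\<lambda>d. \<Prod>j\<in>J. g j (d j)) \<in> borel_measurable (Pi\<^sub>M {..<n} (\<lambda>_. borel))"
        using n by (intro borel_measurable_prod) (measurable, auto)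
      ultimately show ?thesis by (rule design_indep_noise[of "\<lambda>d. \<Prod>j\<in>J. f j (snd (d j))" n borel
            "\<lambda>d. \<Prod>j\<in>J. g j (d j)" borel, unfolded eq])
    qed
    have "prob (\<Inter>j\<in>J. A j) = expectation (indicator (\<Inter>j\<in>J. A j))"
      using J A_events by (simp add: sets.finite_INT)
    also have "\<dots> = expectation (\<lambda>\<omega>. ?F \<omega> * ?G \<omega>)"
    proof (intro Bochner_Integration.integral_cong refl)
      fix \<omega> assume \<omega>: "\<omega> \<in> space M"
      have "indicat_real (\<Inter>j\<in>J. A j) \<omega> = (\<Prod>j\<in>J. indicat_real (A j) \<omega>)"
        using J(2) by (auto simp: indicator_def)
      also have "\<dots> = (\<Prod>j\<in>J. f j (x j \<omega>) * g j (\<epsilon> j \<omega>))"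
        using \<omega> by (intro prod.cong refl) (auto simp: ab(3) f_def g_def indicator_def)
      finally show "indicat_real (\<Inter>j\<in>J. A j) \<omega> = ?F \<omega> * ?G \<omega>" by (simp add: prod.distrib)
    qed
    also have "\<dots> = expectation ?F * expectation ?G"
      using J(2) by (intro indep_var_lebesgue_integral ind indep_vars_integrable indF indG intf intg)
    also have "\<dots> = (\<Prod>j\<in>J. prob (A j))"
      using J(2) by (simp add: indep_vars_lebesgue_integral indF indG intf intg prob_A prod.distrib)
    finally show "prob (\<Inter>j\<in>J. A j) = (\<Prod>j\<in>J. prob (A j))" .
  qed
  then have "indep_sets (\<lambda>i. sigma_sets (space M) (R i)) UNIV"
  proof (rule indep_sets_sigma)
    fix i
    show "Int_stable (R i)"
    proof (rule Int_stableI)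
      fix a b assume "a \<in> R i" "b \<in> R i"
      then obtain A B A' B' where "a = (x i -` A \<inter> \<epsilon> i -` B) \<inter> space M" "b = (x i -` A' \<inter> \<epsilon> i -` B') \<inter> space M"
        "A \<in> sets borel" "B \<in> sets borel" "A' \<in> sets borel" "B' \<in> sets borel"
        by (auto simp: R_def)
      then have "a \<inter> b = (x i -` (A \<inter> A') \<inter> \<epsilon> i -` (B \<inter> B')) \<inter> space M" "A \<inter> A' \<in> sets borel" "B \<inter> B' \<in> sets borel"
        by auto
      then show "a \<inter> b \<in> R i" unfolding R_def by blast
    qed
  qed
  moreover have "{(\<lambda>\<omega>. (x i \<omega>, \<epsilon> i \<omega>)) -` S \<inter> space M |S. S \<in> sets (borel \<Otimes>\<^sub>M borel)} \<subseteq>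
      sigma_sets (space M) (R i)" for i
  proof -
    have "{(\<lambda>\<omega>. (x i \<omega>, \<epsilon> i \<omega>)) -` S \<inter> space M |S. S \<in> sets (borel \<Otimes>\<^sub>M borel)} =
        sigma_sets (space M) {(\<lambda>\<omega>. (x i \<omega>, \<epsilon> i \<omega>)) -` S \<inter> space M |S.
          S \<in> {a \<times> b |a b. a \<in> sets borel \<and> b \<in> sets borel}}"
      unfolding sets_pair_measure by (subst sigma_sets_vimage_commute) auto
    also have "{(\<lambda>\<omega>. (x i \<omega>, \<epsilon> i \<omega>)) -` S \<inter> space M |S. S \<in> {a \<times> b |a b. a \<in> sets borel \<and> b \<in> sets borel}} \<subseteq> R i"
      unfolding R_def by auto
    then have "sigma_sets (space M) {(\<lambda>\<omega>. (x i \<omega>, \<epsilon> i \<omega>)) -` S \<inter> space M |S.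
          S \<in> {a \<times> b |a b. a \<in> sets borel \<and> b \<in> sets borel}} \<subseteq> sigma_sets (space M) (R i)"
      by (rule sigma_sets_mono')
    finally show ?thesis .
  qed
  ultimately have "indep_sets (\<lambda>i. {(\<lambda>\<omega>. (x i \<omega>, \<epsilon> i \<omega>)) -` S \<inter> space M |S. S \<in> sets (borel \<Otimes>\<^sub>M borel)}) UNIV"
    by (rule indep_sets_mono_sets)
  then show ?thesis unfolding indep_vars_def2 by simp
qed

text \<open>The law of the pair is the product of its marginals, and neither marginal depends on the
  unit.\<close>

lemma unit_distr:
  assumes [measurable]: "h \<in> borel_measurable (borel \<Otimes>\<^sub>M borel)"
  shows "distr M borel (\<lambda>\<omega>. h (x i \<omega>, \<epsilon> i \<omega>)) = distr M borel (\<lambda>\<omega>. h (x 0 \<omega>, \<epsilon> 0 \<omega>) :: real)"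
proof -
  \<comment> \<open>\<open>indep_var\<close> needs values of one type, hence the embedding \<open>v\<close> of the noise\<close>
  define v :: "real \<Rightarrow> real^'k" where "v e = (\<chi> _. e)" for e
  define k :: 'k where "k = undefined"
  have [measurable]: "v \<in> borel_measurable borel" unfolding v_def by measurable
  have v: "v e $ k = e" for e by (simp add: v_def)
  have "distr M (borel \<Otimes>\<^sub>M borel) (\<lambda>\<omega>. (x i \<omega>, v (\<epsilon> i \<omega>))) = distr M borel (x 0) \<Otimes>\<^sub>M distr (distr M borel (\<epsilon> 0)) borel v" for i
  proof -
    have "distr M borel (x i) \<Otimes>\<^sub>M distr M borel (\<lambda>\<omega>. v (\<epsilon> i \<omega>)) =
        distr M (borel \<Otimes>\<^sub>M borel) (\<lambda>\<omega>. (x i \<omega>, v (\<epsilon> i \<omega>)))"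
      using x_indep_eps[of "\<lambda>z. z" borel v borel i] by (simp add: indep_var_distribution_eq)
    moreover have "distr M borel (\<lambda>\<omega>. v (\<epsilon> i \<omega>)) = distr (distr M borel (\<epsilon> i)) borel v"
      by (subst distr_distr) (simp_all add: comp_def)
    ultimately show ?thesis using x_distr[of i] x_distr[of 0] eps_distr[of i] by simp
  qed
  note eq = this[of i, folded this[of 0]]
  have "distr M borel (\<lambda>\<omega>. h (x i \<omega>, \<epsilon> i \<omega>)) =
      distr (distr M (borel \<Otimes>\<^sub>M borel) (\<lambda>\<omega>. (x i \<omega>, v (\<epsilon> i \<omega>)))) borel (\<lambda>p. h (fst p, snd p $ k))" for i
    by (subst distr_distr) (simp_all add: comp_def v)
  then show ?thesis using eq by simp
qed

section \<open>Moments of the covariates and of the score terms\<close>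

abbreviation second_moment :: "'k \<Rightarrow> real" where
  "second_moment j \<equiv> expectation (\<lambda>\<omega>. (X j \<omega>)\<^sup>2)"

lemma second_moment_pos: "0 < second_moment j"
  using X_variance[of j] by (simp add: X_mean)

lemma
  fixes g :: "real^'k \<Rightarrow> real"
  assumes g [measurable]: "g \<in> borel_measurable borel"
  shows expectation_x: "expectation (\<lambda>\<omega>. g (x i \<omega>)) = expectation (\<lambda>\<omega>. g (\<chi> j. X j \<omega>))"
    and integrable_x: "integrable M (\<lambda>\<omega>. g (x i \<omega>)) \<longleftrightarrow> integrable M (\<lambda>\<omega>. g (\<chi> j. X j \<omega>))"
  by (rule distr_eq_integral_cong[OF _ _ g x_distr]; measurable)+

lemma integrable_X_mult: "integrable M (\<lambda>\<omega>. X j \<omega> * X l \<omega>)"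
  using indep_vars_integrable_mult[OF X_indep _ _ _ X_integrable X_integrable, of j l] X_square_integrable[of j]
  by (cases "j = l") (auto simp: power2_eq_square)

lemma expectation_X_mult: "expectation (\<lambda>\<omega>. X j \<omega> * X l \<omega>) = (if j = l then second_moment j else 0)"
  using indep_vars_expectation_mult[OF X_indep _ _ _ X_integrable X_integrable, of j l]
  by (auto simp: power2_eq_square X_mean)

lemma integrable_x_inner: "integrable M (\<lambda>\<omega>. c \<bullet> x i \<omega>)"
  by (subst integrable_x) (auto simp: inner_vec_def X_integrable)

lemma expectation_x_inner: "expectation (\<lambda>\<omega>. c \<bullet> x i \<omega>) = 0"
  by (subst expectation_x) (auto simp: inner_vec_def X_integrable X_mean)

lemma x_inner_mult_eq:
  "(c \<bullet> (\<chi> j. X j \<omega>)) * (d \<bullet> (\<chi> j. X j \<omega>)) = (\<Sum>j\<in>UNIV. \<Sum>l\<in>UNIV. (c $ j * d $ l) * (X j \<omega> * X l \<omega>))"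
  by (simp add: inner_vec_def sum_product mult_ac)

lemma integrable_x_inner_mult: "integrable M (\<lambda>\<omega>. (c \<bullet> x i \<omega>) * (d \<bullet> x i \<omega>))"
  by (subst integrable_x[of "\<lambda>z. (c \<bullet> z) * (d \<bullet> z)"])
    (auto simp: x_inner_mult_eq intro!: Bochner_Integration.integrable_sum integrable_mult_right integrable_X_mult)

lemma expectation_x_inner_mult:
  "expectation (\<lambda>\<omega>. (c \<bullet> x i \<omega>) * (d \<bullet> x i \<omega>)) = (\<Sum>j\<in>UNIV. c $ j * d $ j * second_moment j)"
proof -
  have "expectation (\<lambda>\<omega>. (c \<bullet> x i \<omega>) * (d \<bullet> x i \<omega>)) =
      (\<Sum>j\<in>UNIV. \<Sum>l\<in>UNIV. (c $ j * d $ l) * expectation (\<lambda>\<omega>. X j \<omega> * X l \<omega>))"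
    by (subst expectation_x[of "\<lambda>z. (c \<bullet> z) * (d \<bullet> z)"]) (auto simp: x_inner_mult_eq integrable_X_mult)
  also have "\<dots> = (\<Sum>j\<in>UNIV. \<Sum>l\<in>UNIV. if l = j then c $ j * d $ j * second_moment j else 0)"
    by (intro sum.cong refl) (auto simp: expectation_X_mult)
  finally show ?thesis by simp
qed

text \<open>Splitting the independent covariates by whether \<open>d\<close> vanishes puts the
  support of \<open>c\<close> in one group and that of \<open>d\<close> in the other. In the
  application one form involves included covariates and the other omitted ones.\<close>

lemma x_inner_indep:
  assumes disj: "\<And>j. c $ j = 0 \<or> d $ j = 0"
  shows "indep_var borel (\<lambda>\<omega>. c \<bullet> (\<chi> j. X j \<omega>)) borel (\<lambda>\<omega>. d \<bullet> (\<chi> j. X j \<omega>))"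
proof -
  define K where "K b = (if b then {j. d $ j = 0} else {j. d $ j \<noteq> 0})" for b
  define e where "e b = (if b then c else d)" for b
  have "indep_vars (\<lambda>b. Pi\<^sub>M (K b) (\<lambda>_. borel)) (\<lambda>b \<omega>. restrict (\<lambda>j. X j \<omega>) (K b)) (UNIV :: bool set)"
    by (rule indep_vars_restrict[OF X_indep]) (auto simp: disjoint_family_on_def K_def)
  then have "indep_vars (\<lambda>_. borel) (\<lambda>b \<omega>. \<Sum>j\<in>K b. e b $ j * (restrict (\<lambda>j. X j \<omega>) (K b)) j) (UNIV :: bool set)"
    by (rule indep_vars_compose2[where Y="\<lambda>b f. \<Sum>j\<in>K b. e b $ j * f j"]) measurable
  moreover have "(\<Sum>j\<in>K b. e b $ j * (restrict (\<lambda>j. X j \<omega>) (K b)) j) = (\<Sum>j\<in>UNIV. e b $ j * X j \<omega>)" for b \<omega>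
    by (rule sum.mono_neutral_cong_left) (use disj in \<open>auto simp: K_def e_def split: if_splits\<close>)
  ultimately have "indep_vars (\<lambda>_. borel) (\<lambda>b \<omega>. \<Sum>j\<in>UNIV. e b $ j * X j \<omega>) (UNIV :: bool set)"
    by simp
  moreover have "(\<lambda>b \<omega>. \<Sum>j\<in>UNIV. e b $ j * X j \<omega>) = case_bool (\<lambda>\<omega>. c \<bullet> (\<chi> j. X j \<omega>)) (\<lambda>\<omega>. d \<bullet> (\<chi> j. X j \<omega>))"
    by (auto simp: fun_eq_iff e_def inner_vec_def split: bool.split)
  moreover have "(\<lambda>_. borel) = case_bool borel (borel :: real measure)"
    by (auto simp: fun_eq_iff split: bool.split)
  ultimately show ?thesis by (simp add: indep_var_def)
qed

text \<open>Products of squares of the two forms are covered although the covariates have only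
  second moments, because independence lets the expectation factor.\<close>

lemma
  assumes disj: "\<And>j. c $ j = 0 \<or> d $ j = 0"
    and f [measurable]: "f \<in> borel_measurable borel" and g [measurable]: "g \<in> borel_measurable borel"
    and int: "integrable M (\<lambda>\<omega>. f (c \<bullet> x i \<omega>))" "integrable M (\<lambda>\<omega>. g (d \<bullet> x i \<omega>))"
  shows integrable_x_inner_indep: "integrable M (\<lambda>\<omega>. f (c \<bullet> x i \<omega>) * g (d \<bullet> x i \<omega>) :: real)"
    and expectation_x_inner_indep: "expectation (\<lambda>\<omega>. f (c \<bullet> x i \<omega>) * g (d \<bullet> x i \<omega>)) =
      expectation (\<lambda>\<omega>. f (c \<bullet> x i \<omega>)) * expectation (\<lambda>\<omega>. g (d \<bullet> x i \<omega>))"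
proof -
  have ind: "indep_var borel (\<lambda>\<omega>. f (c \<bullet> (\<chi> j. X j \<omega>))) borel (\<lambda>\<omega>. g (d \<bullet> (\<chi> j. X j \<omega>)))"
    using indep_var_compose[OF x_inner_indep[OF disj] f g] by (simp add: comp_def)
  have 1: "integrable M (\<lambda>\<omega>. f (c \<bullet> (\<chi> j. X j \<omega>)))" "integrable M (\<lambda>\<omega>. g (d \<bullet> (\<chi> j. X j \<omega>)))"
    using int integrable_x[of "\<lambda>z. f (c \<bullet> z)" i] integrable_x[of "\<lambda>z. g (d \<bullet> z)" i] by simp_all
  show "integrable M (\<lambda>\<omega>. f (c \<bullet> x i \<omega>) * g (d \<bullet> x i \<omega>))"
    using integrable_x[of "\<lambda>z. f (c \<bullet> z) * g (d \<bullet> z)" i] indep_var_integrable[OF ind 1] by simp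
  show "expectation (\<lambda>\<omega>. f (c \<bullet> x i \<omega>) * g (d \<bullet> x i \<omega>)) =
      expectation (\<lambda>\<omega>. f (c \<bullet> x i \<omega>)) * expectation (\<lambda>\<omega>. g (d \<bullet> x i \<omega>))"
    using expectation_x[of "\<lambda>z. f (c \<bullet> z) * g (d \<bullet> z)" i] indep_var_lebesgue_integral[OF ind 1]
      expectation_x[of "\<lambda>z. f (c \<bullet> z)" i] expectation_x[of "\<lambda>z. g (d \<bullet> z)" i] by simp
qed

lemma expectation_eps_square: "expectation (\<lambda>\<omega>. (\<epsilon> i \<omega>)\<^sup>2) = \<sigma>\<^sub>\<epsilon>2"
  using eps_variance[of i] by (simp add: eps_mean)

text \<open>The general term of the score: \<open>d\<close> holds the omitted coefficients,
  \<open>a = 0\<close> with a unit vector \<open>c\<close> selects a covariate column, and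
  \<open>a = 1\<close> with \<open>c = 0\<close> leaves the error alone. The noise is centred and
  independent of the covariates, so the mixed terms vanish and the second moment is a
  product.\<close>

lemma
  fixes a :: real and c d :: "real^'k"
  assumes disj: "\<And>j. c $ j = 0 \<or> d $ j = 0"
  defines "r \<equiv> \<lambda>i \<omega>. (a + c \<bullet> x i \<omega>) * (\<epsilon> i \<omega> + d \<bullet> x i \<omega>)"
  shows score_square_integrable: "integrable M (\<lambda>\<omega>. (r i \<omega>)\<^sup>2)"
    and score_mean: "expectation (r i) = 0"
    and score_second_moment: "expectation (\<lambda>\<omega>. (r i \<omega>)\<^sup>2) =
      (a\<^sup>2 + (\<Sum>j\<in>UNIV. (c $ j)\<^sup>2 * second_moment j)) * (\<sigma>\<^sub>\<epsilon>2 + (\<Sum>j\<in>UNIV. (d $ j)\<^sup>2 * second_moment j))"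
proof -
  have sq: "integrable M (\<lambda>\<omega>. (c \<bullet> x i \<omega>)\<^sup>2)" "expectation (\<lambda>\<omega>. (c \<bullet> x i \<omega>)\<^sup>2) = (\<Sum>j\<in>UNIV. (c $ j)\<^sup>2 * second_moment j)" for c
    using integrable_x_inner_mult[of c i c] expectation_x_inner_mult[of c i c] by (simp_all add: power2_eq_square)
  have A1: "integrable M (\<lambda>\<omega>. a + c \<bullet> x i \<omega>)" "expectation (\<lambda>\<omega>. a + c \<bullet> x i \<omega>) = a"
    by (simp_all add: integrable_x_inner expectation_x_inner prob_space)
  have A2e: "(a + c \<bullet> x i \<omega>)\<^sup>2 = a\<^sup>2 + 2 * a * (c \<bullet> x i \<omega>) + (c \<bullet> x i \<omega>)\<^sup>2" for \<omega>
    by (simp add: power2_sum)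
  have A2: "integrable M (\<lambda>\<omega>. (a + c \<bullet> x i \<omega>)\<^sup>2)"
    "expectation (\<lambda>\<omega>. (a + c \<bullet> x i \<omega>)\<^sup>2) = a\<^sup>2 + (\<Sum>j\<in>UNIV. (c $ j)\<^sup>2 * second_moment j)"
    unfolding A2e by (simp_all add: integrable_x_inner expectation_x_inner sq prob_space)
  have AB: "integrable M (\<lambda>\<omega>. (a + c \<bullet> x i \<omega>) * (d \<bullet> x i \<omega>))"
    by (rule integrable_x_inner_indep[OF disj, where f="\<lambda>y. a + y" and g="\<lambda>y. y"])
      (simp_all add: A1 integrable_x_inner)
  have "expectation (\<lambda>\<omega>. (a + c \<bullet> x i \<omega>) * (d \<bullet> x i \<omega>)) =
      expectation (\<lambda>\<omega>. a + c \<bullet> x i \<omega>) * expectation (\<lambda>\<omega>. d \<bullet> x i \<omega>)"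
    by (rule expectation_x_inner_indep[OF disj, where f="\<lambda>y. a + y" and g="\<lambda>y. y"])
      (simp_all add: A1 integrable_x_inner)
  then have ABe: "expectation (\<lambda>\<omega>. (a + c \<bullet> x i \<omega>) * (d \<bullet> x i \<omega>)) = 0"
    by (simp add: expectation_x_inner)
  have A2B: "integrable M (\<lambda>\<omega>. (a + c \<bullet> x i \<omega>)\<^sup>2 * (d \<bullet> x i \<omega>))"
    by (rule integrable_x_inner_indep[OF disj, where f="\<lambda>y. (a + y)\<^sup>2" and g="\<lambda>y. y"])
      (simp_all add: A2(1) integrable_x_inner)
  have A2B2: "integrable M (\<lambda>\<omega>. (a + c \<bullet> x i \<omega>)\<^sup>2 * (d \<bullet> x i \<omega>)\<^sup>2)"
    by (rule integrable_x_inner_indep[OF disj, where f="\<lambda>y. (a + y)\<^sup>2" and g="\<lambda>y. y\<^sup>2"])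
      (simp_all add: A2(1) sq(1))
  have "expectation (\<lambda>\<omega>. (a + c \<bullet> x i \<omega>)\<^sup>2 * (d \<bullet> x i \<omega>)\<^sup>2) =
      expectation (\<lambda>\<omega>. (a + c \<bullet> x i \<omega>)\<^sup>2) * expectation (\<lambda>\<omega>. (d \<bullet> x i \<omega>)\<^sup>2)"
    by (rule expectation_x_inner_indep[OF disj, where f="\<lambda>y. (a + y)\<^sup>2" and g="\<lambda>y. y\<^sup>2"])
      (simp_all add: A2(1) sq(1))
  then have A2B2e: "expectation (\<lambda>\<omega>. (a + c \<bullet> x i \<omega>)\<^sup>2 * (d \<bullet> x i \<omega>)\<^sup>2) =
      (a\<^sup>2 + (\<Sum>j\<in>UNIV. (c $ j)\<^sup>2 * second_moment j)) * (\<Sum>j\<in>UNIV. (d $ j)\<^sup>2 * second_moment j)"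
    by (simp only: A2(2) sq(2))
  have Ae: "integrable M (\<lambda>\<omega>. (a + c \<bullet> x i \<omega>) * \<epsilon> i \<omega>)"
    by (rule integrable_x_eps[where f="\<lambda>z. a + c \<bullet> z" and g="\<lambda>y. y"]) (simp_all add: A1 eps_integrable)
  have "expectation (\<lambda>\<omega>. (a + c \<bullet> x i \<omega>) * \<epsilon> i \<omega>) = expectation (\<lambda>\<omega>. a + c \<bullet> x i \<omega>) * expectation (\<epsilon> i)"
    by (rule expectation_x_eps[where f="\<lambda>z. a + c \<bullet> z" and g="\<lambda>y. y"]) (simp_all add: A1 eps_integrable)
  then have Aee: "expectation (\<lambda>\<omega>. (a + c \<bullet> x i \<omega>) * \<epsilon> i \<omega>) = 0"
    by (simp only: eps_mean mult_zero_right)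
  have A2Be: "integrable M (\<lambda>\<omega>. ((a + c \<bullet> x i \<omega>)\<^sup>2 * (d \<bullet> x i \<omega>)) * \<epsilon> i \<omega>)"
    by (rule integrable_x_eps[where f="\<lambda>z. (a + c \<bullet> z)\<^sup>2 * (d \<bullet> z)" and g="\<lambda>y. y"])
      (simp_all add: A2B eps_integrable)
  have "expectation (\<lambda>\<omega>. ((a + c \<bullet> x i \<omega>)\<^sup>2 * (d \<bullet> x i \<omega>)) * \<epsilon> i \<omega>) =
      expectation (\<lambda>\<omega>. (a + c \<bullet> x i \<omega>)\<^sup>2 * (d \<bullet> x i \<omega>)) * expectation (\<epsilon> i)"
    by (rule expectation_x_eps[where f="\<lambda>z. (a + c \<bullet> z)\<^sup>2 * (d \<bullet> z)" and g="\<lambda>y. y"])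
      (simp_all add: A2B eps_integrable)
  then have A2Bee: "expectation (\<lambda>\<omega>. ((a + c \<bullet> x i \<omega>)\<^sup>2 * (d \<bullet> x i \<omega>)) * \<epsilon> i \<omega>) = 0"
    by (simp only: eps_mean mult_zero_right)
  have A2e2: "integrable M (\<lambda>\<omega>. (a + c \<bullet> x i \<omega>)\<^sup>2 * (\<epsilon> i \<omega>)\<^sup>2)"
    by (rule integrable_x_eps[where f="\<lambda>z. (a + c \<bullet> z)\<^sup>2" and g="\<lambda>y. y\<^sup>2"])
      (simp_all add: A2(1) eps_square_integrable)
  have "expectation (\<lambda>\<omega>. (a + c \<bullet> x i \<omega>)\<^sup>2 * (\<epsilon> i \<omega>)\<^sup>2) =
      expectation (\<lambda>\<omega>. (a + c \<bullet> x i \<omega>)\<^sup>2) * expectation (\<lambda>\<omega>. (\<epsilon> i \<omega>)\<^sup>2)"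
    by (rule expectation_x_eps[where f="\<lambda>z. (a + c \<bullet> z)\<^sup>2" and g="\<lambda>y. y\<^sup>2"])
      (simp_all add: A2(1) eps_square_integrable)
  then have A2e2e: "expectation (\<lambda>\<omega>. (a + c \<bullet> x i \<omega>)\<^sup>2 * (\<epsilon> i \<omega>)\<^sup>2) =
      (a\<^sup>2 + (\<Sum>j\<in>UNIV. (c $ j)\<^sup>2 * second_moment j)) * \<sigma>\<^sub>\<epsilon>2"
    by (simp only: A2(2) expectation_eps_square)
  have r: "r i \<omega> = (a + c \<bullet> x i \<omega>) * \<epsilon> i \<omega> + (a + c \<bullet> x i \<omega>) * (d \<bullet> x i \<omega>)" for \<omega>
    by (simp add: r_def algebra_simps)
  \<comment> \<open>Grouped so that a power of the noise factors out of the first two summands and a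
    square of the omitted form out of the third; the middle one has expectation 0 because the noise
    is centred.\<close>
  have r2: "(r i \<omega>)\<^sup>2 = (a + c \<bullet> x i \<omega>)\<^sup>2 * (\<epsilon> i \<omega>)\<^sup>2 + 2 * (((a + c \<bullet> x i \<omega>)\<^sup>2 * (d \<bullet> x i \<omega>)) * \<epsilon> i \<omega>)
      + (a + c \<bullet> x i \<omega>)\<^sup>2 * (d \<bullet> x i \<omega>)\<^sup>2" for \<omega>
    unfolding r_def power_mult_distrib power2_sum[of "\<epsilon> i \<omega>"] by (simp only: algebra_simps)
  show "integrable M (\<lambda>\<omega>. (r i \<omega>)\<^sup>2)"
    unfolding r2 by (intro Bochner_Integration.integrable_add integrable_mult_right A2e2 A2Be A2B2)
  show "expectation (r i) = 0"
    using Ae AB Aee ABe by (simp add: r[abs_def])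
  show "expectation (\<lambda>\<omega>. (r i \<omega>)\<^sup>2) =
      (a\<^sup>2 + (\<Sum>j\<in>UNIV. (c $ j)\<^sup>2 * second_moment j)) * (\<sigma>\<^sub>\<epsilon>2 + (\<Sum>j\<in>UNIV. (d $ j)\<^sup>2 * second_moment j))"
    unfolding r2 using A2e2 A2Be A2B2 A2e2e A2Bee A2B2e by (simp add: distrib_left)
qed

lemma score_indep:
  "indep_vars (\<lambda>_. borel) (\<lambda>i \<omega>. (a + c \<bullet> x i \<omega>) * (\<epsilon> i \<omega> + d \<bullet> x i \<omega>)) UNIV"
  using indep_vars_compose2[OF unit_indep, of "\<lambda>_ p. (a + c \<bullet> fst p) * (snd p + d \<bullet> fst p)" "\<lambda>_. borel"]
  by simp

lemma score_distr:
  "distr M borel (\<lambda>\<omega>. (a + c \<bullet> x i \<omega>) * (\<epsilon> i \<omega> + d \<bullet> x i \<omega>)) =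
   distr M borel (\<lambda>\<omega>. (a + c \<bullet> x 0 \<omega>) * (\<epsilon> 0 \<omega> + d \<bullet> x 0 \<omega>))"
  using unit_distr[of "\<lambda>p. (a + c \<bullet> fst p) * (snd p + d \<bullet> fst p)" i] by simp

text \<open>The design is independent of the noise, so the mixed moments factor and vanish off the
  diagonal whatever the dependence among the assignments; values in {0, 1} bound the diagonal ones
  by \<open>\<sigma>\<^sub>\<epsilon>2\<close>.\<close>

lemma treated_noise_bounded:
  "bounded_in_prob M (\<lambda>n \<omega>. (1 / sqrt (real n)) * (\<Sum>i<n. T n i \<omega> * \<epsilon> i \<omega>))"
proof (rule bounded_in_prob_second_moment)
  fix n
  have Tm [measurable]: "i < n \<Longrightarrow> random_variable borel (T n i)" for i by (rule T_measurable)
  have T01: "i < n \<Longrightarrow> \<omega> \<in> space M \<Longrightarrow> 0 \<le> T n i \<omega> \<and> T n i \<omega> \<le> 1" for i \<omega>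
    using T_values[of i n \<omega>] by auto
  show "random_variable borel (\<lambda>\<omega>. (1 / sqrt (real n)) * (\<Sum>i<n. T n i \<omega> * \<epsilon> i \<omega>))"
    by (intro borel_measurable_times borel_measurable_sum) auto
  have intT: "integrable M (\<lambda>\<omega>. T n i \<omega> * T n j \<omega>)" if "i < n" "j < n" for i j
  proof (rule integrable_const_bound[of _ 1])
    show "AE \<omega> in M. norm (T n i \<omega> * T n j \<omega>) \<le> 1"
      using T01 that by (intro AE_I2) (auto simp: abs_mult intro!: mult_le_one)
  qed (use that in measurable)
  have inte: "integrable M (\<lambda>\<omega>. \<epsilon> i \<omega> * \<epsilon> j \<omega>)" for i j
    using indep_vars_integrable_mult[OF eps_indep _ _ _ eps_integrable eps_integrable, of i j] eps_square_integrable[of i]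
    by (cases "i = j") (auto simp: power2_eq_square)
  have ind: "indep_var borel (\<lambda>\<omega>. T n i \<omega> * T n j \<omega>) borel (\<lambda>\<omega>. \<epsilon> i \<omega> * \<epsilon> j \<omega>)" if "i < n" "j < n" for i j
  proof -
    have c: "l < n \<Longrightarrow> (\<lambda>d. d l) \<in> Pi\<^sub>M {..<n} (\<lambda>_. borel \<Otimes>\<^sub>M borel) \<rightarrow>\<^sub>M (borel :: real measure) \<Otimes>\<^sub>M (borel :: (real^'k) measure)" for l
      by (rule measurable_component_singleton) simp
    have 1: "(\<lambda>d. fst (d i) * fst (d j)) \<in> borel_measurable (Pi\<^sub>M {..<n} (\<lambda>_. (borel :: real measure) \<Otimes>\<^sub>M (borel :: (real^'k) measure)))"
      by (intro borel_measurable_times measurable_compose[OF c measurable_fst] that)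
    have 2: "(\<lambda>d. d i * d j) \<in> borel_measurable (Pi\<^sub>M {..<n} (\<lambda>_. borel :: real measure))"
      using that by (intro borel_measurable_times measurable_component_singleton) auto
    show ?thesis using design_indep_noise[OF 1 2] that by simp
  qed
  have mult: "T n i \<omega> * \<epsilon> i \<omega> * (T n j \<omega> * \<epsilon> j \<omega>) = (T n i \<omega> * T n j \<omega>) * (\<epsilon> i \<omega> * \<epsilon> j \<omega>)" for i j \<omega>
    by (simp add: mult_ac)
  have int: "integrable M (\<lambda>\<omega>. T n i \<omega> * \<epsilon> i \<omega> * (T n j \<omega> * \<epsilon> j \<omega>))" if "i < n" "j < n" for i j
    unfolding mult by (rule indep_var_integrable[OF ind[OF that] intT[OF that] inte])
  have orth: "expectation (\<lambda>\<omega>. T n i \<omega> * \<epsilon> i \<omega> * (T n j \<omega> * \<epsilon> j \<omega>)) = 0" if "i < n" "j < n" "i \<noteq> j" for i j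
    unfolding mult using indep_var_lebesgue_integral[OF ind[OF that(1,2)] intT[OF that(1,2)] inte]
      indep_vars_expectation_mult[OF eps_indep _ _ that(3) eps_integrable eps_integrable] by (simp add: eps_mean)
  show "integrable M (\<lambda>\<omega>. ((1 / sqrt (real n)) * (\<Sum>i<n. T n i \<omega> * \<epsilon> i \<omega>))\<^sup>2)"
    unfolding power_mult_distrib by (intro integrable_mult_right integrable_sum_power2 int orth) auto
  have "expectation (\<lambda>\<omega>. ((1 / sqrt (real n)) * (\<Sum>i<n. T n i \<omega> * \<epsilon> i \<omega>))\<^sup>2) =
      (1 / sqrt (real n))\<^sup>2 * expectation (\<lambda>\<omega>. (\<Sum>i<n. T n i \<omega> * \<epsilon> i \<omega>)\<^sup>2)"
    unfolding power_mult_distrib[of "1 / sqrt (real n)"] by (rule integral_mult_right_zero)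
  also have "\<dots> = (1 / real n) * (\<Sum>i<n. expectation (\<lambda>\<omega>. (T n i \<omega> * \<epsilon> i \<omega>)\<^sup>2))"
    by (subst expectation_sum_power2) (auto simp: int orth power_divide)
  also have "\<dots> \<le> (1 / real n) * (\<Sum>i<n. \<sigma>\<^sub>\<epsilon>2)"
  proof (intro mult_left_mono sum_mono)
    fix i assume i: "i \<in> {..<n}"
    have "expectation (\<lambda>\<omega>. (T n i \<omega> * \<epsilon> i \<omega>)\<^sup>2) \<le> expectation (\<lambda>\<omega>. (\<epsilon> i \<omega>)\<^sup>2)"
    proof (rule integral_mono)
      show "integrable M (\<lambda>\<omega>. (T n i \<omega> * \<epsilon> i \<omega>)\<^sup>2)" using int[of i i] i by (simp add: power2_eq_square)
      show "(T n i \<omega> * \<epsilon> i \<omega>)\<^sup>2 \<le> (\<epsilon> i \<omega>)\<^sup>2" if "\<omega> \<in> space M" for \<omega>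
        using T_values[of i n \<omega>] i that by auto
    qed (rule eps_square_integrable)
    then show "expectation (\<lambda>\<omega>. (T n i \<omega> * \<epsilon> i \<omega>)\<^sup>2) \<le> \<sigma>\<^sub>\<epsilon>2" by (simp add: expectation_eps_square)
  qed simp
  also have "\<dots> \<le> \<sigma>\<^sub>\<epsilon>2" using eps_variance_pos by simp
  finally show "expectation (\<lambda>\<omega>. ((1 / sqrt (real n)) * (\<Sum>i<n. T n i \<omega> * \<epsilon> i \<omega>))\<^sup>2) \<le> \<sigma>\<^sub>\<epsilon>2" .
qed

section \<open>Limits of the averages\<close>

definition design :: "nat \<Rightarrow> 'a \<Rightarrow> nat \<Rightarrow> real^(bool + 'p)" where
  "design n \<omega> i = design_row inc (T n i \<omega>) (x i \<omega>)"

text \<open>Padding with zeros on the included covariates avoids a separate index type and makes the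
  supports visibly disjoint, as \<open>score_bounded\<close> demands.\<close>

definition omitted :: "real^'k \<Rightarrow> real^'k" where
  "omitted \<beta> = (\<chi> j. if j \<in> range inc then 0 else \<beta> $ j)"

definition limit_diag :: "bool + 'p \<Rightarrow> real" where
  "limit_diag a = (case a of Inl _ \<Rightarrow> 1 / 2 | Inr j \<Rightarrow> second_moment (inc j))"

lemma limit_diag_pos: "0 < limit_diag a"
  by (simp add: limit_diag_def second_moment_pos split: sum.split)

lemma V_matrix_eq: "V_matrix M inc X = diag_mat limit_diag"
  unfolding V_matrix_def diag_mat_def limit_diag_def
  by (simp add: vec_eq_iff X_mean split: sum.split)

lemma sigma_w2_eq: "sigma_w2 M inc X \<beta> \<sigma>\<^sub>\<epsilon>2 = \<sigma>\<^sub>\<epsilon>2 + (\<Sum>j\<in>UNIV. (omitted \<beta> $ j)\<^sup>2 * second_moment j)"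
proof -
  have "(\<Sum>j\<in>UNIV. (omitted \<beta> $ j)\<^sup>2 * second_moment j) = (\<Sum>j\<in>- range inc. (\<beta> $ j)\<^sup>2 * second_moment j)"
    by (rule sum.mono_neutral_cong_right) (auto simp: omitted_def)
  then show ?thesis by (simp add: sigma_w2_def X_mean)
qed

lemma sigma_w2_pos: "0 < sigma_w2 M inc X \<beta> \<sigma>\<^sub>\<epsilon>2"
  unfolding sigma_w2_eq using second_moment_pos eps_variance_pos
  by (intro add_pos_nonneg sum_nonneg mult_nonneg_nonneg) (auto intro: less_imp_le)

lemma design_nth:
  "design n \<omega> i $ Inl b = (if b then T n i \<omega> else 1 - T n i \<omega>)"
  "design n \<omega> i $ Inr j = x i \<omega> $ inc j"
  by (simp_all add: design_def design_row_def)

text \<open>\<open>T n i\<close> is known to be measurable only for \<open>i < n\<close>, so the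
  range of summation has to enter the argument.\<close>

lemma T_sum_measurable:
  assumes [measurable]: "\<And>i. random_variable borel (f i)"
  shows "random_variable borel (\<lambda>\<omega>. \<Sum>i<n. (T n i \<omega> :: real) * f i \<omega>)"
  by (intro borel_measurable_sum borel_measurable_times T_measurable) auto

lemma design_measurable: "i < n \<Longrightarrow> random_variable borel (\<lambda>\<omega>. design n \<omega> i)"
  unfolding borel_measurable_vec_iff
proof
  fix a assume i: "i < n"
  note [measurable] = T_measurable[OF i]
  show "random_variable borel (\<lambda>\<omega>. design n \<omega> i $ a)"
    by (cases a) (auto simp: design_nth)
qed

lemma x_average_limit:
  assumes [measurable]: "g \<in> borel_measurable borel" and int: "integrable M (\<lambda>\<omega>. g (x 0 \<omega>))"
  shows "tendsto_in_prob M (\<lambda>n \<omega>. (\<Sum>i<n. g (x i \<omega>)) / real n) (expectation (\<lambda>\<omega>. g (x 0 \<omega>)))"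
proof (rule weak_law_of_large_numbers)
  show "indep_vars (\<lambda>_. borel) (\<lambda>i \<omega>. g (x i \<omega>)) UNIV"
    by (rule indep_vars_compose2[OF x_indep]) measurable
  show "distr M borel (\<lambda>\<omega>. g (x i \<omega>)) = distr M borel (\<lambda>\<omega>. g (x 0 \<omega>))" for i
    using distr_distr[of g borel borel "x i" M] distr_distr[of g borel borel "x 0" M] x_distr[of i] x_distr[of 0]
    by (simp add: comp_def)
qed (rule int)

lemma noise_square_average_limit:
  "tendsto_in_prob M (\<lambda>n \<omega>. (\<Sum>i<n. (\<epsilon> i \<omega> + omitted \<beta> \<bullet> x i \<omega>)\<^sup>2) / real n) (sigma_w2 M inc X \<beta> \<sigma>\<^sub>\<epsilon>2)"
proof -
  let ?u = "\<lambda>i \<omega>. \<epsilon> i \<omega> + omitted \<beta> \<bullet> x i \<omega>"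
  have "tendsto_in_prob M (\<lambda>n \<omega>. (\<Sum>i<n. (?u i \<omega>)\<^sup>2) / real n) (expectation (\<lambda>\<omega>. (?u 0 \<omega>)\<^sup>2))"
  proof (rule weak_law_of_large_numbers)
    show "indep_vars (\<lambda>_. borel) (\<lambda>i \<omega>. (?u i \<omega>)\<^sup>2) UNIV"
      using indep_vars_compose2[OF unit_indep, of "\<lambda>_ p. (snd p + omitted \<beta> \<bullet> fst p)\<^sup>2" "\<lambda>_. borel"] by simp
    show "distr M borel (\<lambda>\<omega>. (?u i \<omega>)\<^sup>2) = distr M borel (\<lambda>\<omega>. (?u 0 \<omega>)\<^sup>2)" for i
      using unit_distr[of "\<lambda>p. (snd p + omitted \<beta> \<bullet> fst p)\<^sup>2" i] by simp
    show "integrable M (\<lambda>\<omega>. (?u 0 \<omega>)\<^sup>2)"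
      \<comment> \<open>The instance \<open>c = 0\<close>, \<open>a = 1\<close> of the score term is
        the error itself.\<close>
      using score_square_integrable[of 0 "omitted \<beta>" 1 0] by simp
  qed
  moreover have "expectation (\<lambda>\<omega>. (?u 0 \<omega>)\<^sup>2) = sigma_w2 M inc X \<beta> \<sigma>\<^sub>\<epsilon>2"
    using score_second_moment[of 0 "omitted \<beta>" 1 0] by (simp add: sigma_w2_eq)
  ultimately show ?thesis by simp
qed

lemma score_bounded:
  fixes a :: real and c d :: "real^'k"
  assumes "\<And>j. c $ j = 0 \<or> d $ j = 0"
  shows "bounded_in_prob M (\<lambda>n \<omega>. (1 / sqrt (real n)) * (\<Sum>i<n. (a + c \<bullet> x i \<omega>) * (\<epsilon> i \<omega> + d \<bullet> x i \<omega>)))"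
  by (rule normalized_sum_bounded_in_prob[OF score_indep])
    (use score_square_integrable[OF assms] score_mean[OF assms] score_second_moment[OF assms] in auto)

text \<open>The vector whose convergence in distribution is the covariate balance condition.\<close>

definition imbalance :: "nat \<Rightarrow> 'a \<Rightarrow> real^'k" where
  "imbalance n \<omega> = (1 / sqrt (real n)) *\<^sub>R (\<Sum>i<n. (2 * T n i \<omega> - 1) *\<^sub>R x i \<omega>)"

lemma imbalance_measurable [measurable]: "random_variable borel (imbalance n)"
  unfolding imbalance_def
  by (intro borel_measurable_scaleR borel_measurable_sum borel_measurable_diff borel_measurable_times T_measurable) auto

lemma imbalance_inner:
  "c \<bullet> imbalance n \<omega> = (1 / sqrt (real n)) * (\<Sum>i<n. (2 * T n i \<omega> - 1) * (c \<bullet> x i \<omega>))"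
  by (simp add: imbalance_def inner_sum_right)

lemma gram_entry_measurable [measurable]:
  "random_variable borel (\<lambda>\<omega>. gram n (design n \<omega>) $ a $ b)"
  unfolding gram_def using design_measurable
  by (auto intro!: borel_measurable_sum borel_measurable_times borel_measurable_vec_nth)

text \<open>Depends on \<open>\<beta>\<close> only through \<open>omitted \<beta>\<close>, so it is
  unaffected by changes of the included coefficients with \<open>n\<close>.\<close>

definition score :: "real^'k \<Rightarrow> nat \<Rightarrow> 'a \<Rightarrow> real^(bool + 'p)" where
  "score \<beta> n \<omega> = (1 / sqrt (real n)) *\<^sub>R cross_moment n (design n \<omega>) (\<lambda>i. \<epsilon> i \<omega> + omitted \<beta> \<bullet> x i \<omega>)"

lemma score_measurable [measurable]: "random_variable borel (score \<beta> n)"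
  unfolding score_def cross_moment_def borel_measurable_vec_iff
  using design_measurable
  by (auto intro!: borel_measurable_sum borel_measurable_times borel_measurable_vec_nth borel_measurable_divide)

section \<open>Consequences of the balance conditions\<close>

context
  fixes N :: "'b measure" and \<xi> :: "'b \<Rightarrow> real^'k"
  assumes A1: "tendsto_in_prob M (\<lambda>n \<omega>. (\<Sum>i<n. (2 * T n i \<omega> - 1)) / real n) 0"
    and N: "prob_space N" and \<xi>: "\<xi> \<in> borel_measurable N"
    and A2: "tendsto_in_distr M
      (\<lambda>n \<omega>. (1 / sqrt (real n)) *\<^sub>R (\<Sum>i<n. (2 * T n i \<omega> - 1) *\<^sub>R x i \<omega>)) N \<xi>"
begin

lemma imbalance_bounded: "bounded_in_prob M imbalance"
  by (rule tendsto_in_distr_bounded_in_prob[OF imbalance_measurable N \<xi>])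
    (use A2 in \<open>simp add: imbalance_def[abs_def]\<close>)

lemma imbalance_inner_bounded: "bounded_in_prob M (\<lambda>n \<omega>. c \<bullet> imbalance n \<omega>)"
proof (rule bounded_in_prob_mono)
  show "bounded_in_prob M (\<lambda>n \<omega>. norm c * norm (imbalance n \<omega>))"
    by (rule bounded_in_prob_cmult) (simp_all add: bounded_in_prob_norm imbalance_bounded)
  show "norm (c \<bullet> imbalance n \<omega>) \<le> norm (norm c * norm (imbalance n \<omega>))" for n \<omega>
    by (simp add: Cauchy_Schwarz_ineq2)
qed measurable

lemma treated_fraction: "tendsto_in_prob M (\<lambda>n \<omega>. (\<Sum>i<n. T n i \<omega>) / real n) (1 / 2)"
proof (rule tendsto_in_prob_mono)
  have m: "random_variable borel (\<lambda>\<omega>. (\<Sum>i<n. (2 * T n i \<omega> - 1)) / real n)" for n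
    by (intro borel_measurable_divide borel_measurable_sum borel_measurable_diff borel_measurable_times T_measurable) auto
  then show "random_variable borel (\<lambda>\<omega>. (1 / 2) * ((\<Sum>i<n. (2 * T n i \<omega> - 1)) / real n))" for n
    by (intro borel_measurable_times) auto
  show "tendsto_in_prob M (\<lambda>n \<omega>. (1 / 2) * ((\<Sum>i<n. (2 * T n i \<omega> - 1)) / real n)) 0"
    using tendsto_in_prob_cmult[OF A1, of "1 / 2"] by simp
  show "\<bar>(\<Sum>i<n. T n i \<omega>) / real n - 1 / 2\<bar> \<le> \<bar>(1 / 2) * ((\<Sum>i<n. (2 * T n i \<omega> - 1)) / real n) - 0\<bar>"
    if "0 < n" for n \<omega>
    using that by (simp add: sum_subtractf sum_distrib_left[symmetric] diff_divide_distrib)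
qed

text \<open>Writing \<open>T = ((2 * T - 1) + 1) / 2\<close> splits the average into the imbalance,
  which is tight and is divided by \<open>sqrt (real n)\<close> once more, and the plain average of
  centred covariates.\<close>

lemma treated_covariate_average:
  "tendsto_in_prob M (\<lambda>n \<omega>. (\<Sum>i<n. T n i \<omega> * (c \<bullet> x i \<omega>)) / real n) 0"
proof (rule tendsto_in_prob_mono)
  have 1: "tendsto_in_prob M (\<lambda>n \<omega>. (1 / sqrt (real n)) * (c \<bullet> imbalance n \<omega>)) 0"
    by (intro bounded_in_prob_vanish imbalance_inner_bounded sqrt_n_vanish) measurable
  have 2: "tendsto_in_prob M (\<lambda>n \<omega>. (\<Sum>i<n. c \<bullet> x i \<omega>) / real n) 0"
    using x_average_limit[of "\<lambda>z. c \<bullet> z"] by (simp add: integrable_x_inner expectation_x_inner)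
  have "tendsto_in_prob M (\<lambda>n \<omega>. (1 / sqrt (real n)) * (c \<bullet> imbalance n \<omega>) + (\<Sum>i<n. c \<bullet> x i \<omega>) / real n) (0 + 0)"
    by (rule tendsto_in_prob_add[OF _ _ 1 2]) measurable
  from tendsto_in_prob_cmult[OF this, of "1 / 2"]
  show "tendsto_in_prob M (\<lambda>n \<omega>. (1 / 2) * ((1 / sqrt (real n)) * (c \<bullet> imbalance n \<omega>) + (\<Sum>i<n. c \<bullet> x i \<omega>) / real n)) 0"
    by simp
  show "\<bar>(\<Sum>i<n. T n i \<omega> * (c \<bullet> x i \<omega>)) / real n - 0\<bar> \<le>
      \<bar>(1 / 2) * ((1 / sqrt (real n)) * (c \<bullet> imbalance n \<omega>) + (\<Sum>i<n. c \<bullet> x i \<omega>) / real n) - 0\<bar>" for n \<omega>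
  proof -
    have "(\<Sum>i<n. (2 * T n i \<omega> - 1) * (c \<bullet> x i \<omega>)) = 2 * (\<Sum>i<n. T n i \<omega> * (c \<bullet> x i \<omega>)) - (\<Sum>i<n. c \<bullet> x i \<omega>)"
      by (simp add: left_diff_distrib sum_subtractf sum_distrib_left mult.assoc)
    then have "(1 / sqrt (real n)) * (c \<bullet> imbalance n \<omega>) =
        (2 * (\<Sum>i<n. T n i \<omega> * (c \<bullet> x i \<omega>)) - (\<Sum>i<n. c \<bullet> x i \<omega>)) / real n"
      by (simp add: imbalance_inner)
    then show ?thesis by (simp add: diff_divide_distrib)
  qed
qed measurable

text \<open>As assignments are 0 or 1, entries between treatment columns reduce to the treated
  fraction or vanish. Mixed entries tend to 0 by covariate balance, and the covariate block follows
  from the law of large numbers, with off-diagonal limits 0 by independence of the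
  covariates.\<close>

lemma gram_entry_limit:
  "tendsto_in_prob M (\<lambda>n \<omega>. (\<Sum>i<n. design n \<omega> i $ a * design n \<omega> i $ b) / real n) (diag_mat limit_diag $ a $ b)"
proof -
  let ?P = "\<lambda>a b. tendsto_in_prob M (\<lambda>n \<omega>. (\<Sum>i<n. design n \<omega> i $ a * design n \<omega> i $ b) / real n) (diag_mat limit_diag $ a $ b)"
  have sym: "?P a b \<Longrightarrow> ?P b a" for a b
  proof -
    have "(\<Sum>i<n. design n \<omega> i $ a * design n \<omega> i $ b) = (\<Sum>i<n. design n \<omega> i $ b * design n \<omega> i $ a)" for n \<omega>
      by (rule sum.cong) (simp_all add: mult.commute)
    moreover have "diag_mat limit_diag $ a $ b = diag_mat limit_diag $ b $ a"
      by (auto simp: diag_mat_def)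
    moreover assume "?P a b"
    ultimately show "?P b a" by (simp only:)
  qed
  have sq: "T n i \<omega> * T n i \<omega> = T n i \<omega>" "T n i \<omega> * (1 - T n i \<omega>) = 0"
      "(1 - T n i \<omega>) * (1 - T n i \<omega>) = 1 - T n i \<omega>"
    if "\<omega> \<in> space M" "i < n" for n i \<omega>
    using T_values[OF that(2,1)] by auto
  have mT: "random_variable borel (\<lambda>\<omega>. (\<Sum>i<n. T n i \<omega>) / real n)" for n
    using T_measurable by (intro borel_measurable_divide borel_measurable_sum) auto
  have mTx: "random_variable borel (\<lambda>\<omega>. (\<Sum>i<n. T n i \<omega> * (c \<bullet> x i \<omega>)) / real n)" for n c
    by (intro borel_measurable_divide T_sum_measurable) auto
  have x_axis: "x i \<omega> $ j = axis j 1 \<bullet> x i \<omega>" for i \<omega> j by (simp add: inner_axis')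
  have TT: "?P (Inl True) (Inl True)"
  proof (rule tendsto_in_prob_mono[OF mT _ treated_fraction])
    show "\<bar>(\<Sum>i<n. design n \<omega> i $ Inl True * design n \<omega> i $ Inl True) / real n - diag_mat limit_diag $ Inl True $ Inl True\<bar>
      \<le> \<bar>(\<Sum>i<n. T n i \<omega>) / real n - 1 / 2\<bar>" if "\<omega> \<in> space M" for n \<omega>
      using that by (simp add: design_nth sq diag_mat_def limit_diag_def)
  qed
  have FF: "?P (Inl False) (Inl False)"
  proof (rule tendsto_in_prob_mono[OF mT _ treated_fraction])
    show "\<bar>(\<Sum>i<n. design n \<omega> i $ Inl False * design n \<omega> i $ Inl False) / real n - diag_mat limit_diag $ Inl False $ Inl False\<bar>
      \<le> \<bar>(\<Sum>i<n. T n i \<omega>) / real n - 1 / 2\<bar>" if "0 < n" "\<omega> \<in> space M" for n \<omega>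
      using that by (simp add: design_nth sq diag_mat_def limit_diag_def sum_subtractf diff_divide_distrib)
  qed
  have TF: "?P (Inl True) (Inl False)"
  proof (rule tendsto_in_prob_mono[OF _ _ tendsto_in_prob_const[OF tendsto_const]])
    show "\<bar>(\<Sum>i<n. design n \<omega> i $ Inl True * design n \<omega> i $ Inl False) / real n - diag_mat limit_diag $ Inl True $ Inl False\<bar>
      \<le> \<bar>0 - 0\<bar>" if "\<omega> \<in> space M" for n \<omega>
      using that by (simp add: design_nth sq diag_mat_def)
  qed simp
  have TX: "?P (Inl True) (Inr j)" for j
  proof (rule tendsto_in_prob_mono[OF mTx _ treated_covariate_average[of "axis (inc j) 1"]])
    show "\<bar>(\<Sum>i<n. design n \<omega> i $ Inl True * design n \<omega> i $ Inr j) / real n - diag_mat limit_diag $ Inl True $ Inr j\<bar>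
      \<le> \<bar>(\<Sum>i<n. T n i \<omega> * (axis (inc j) 1 \<bullet> x i \<omega>)) / real n - 0\<bar>" for n \<omega>
      by (simp add: design_nth x_axis diag_mat_def)
  qed
  have FX: "?P (Inl False) (Inr j)" for j
  proof -
    let ?c = "axis (inc j) 1 :: real^'k"
    have 2: "tendsto_in_prob M (\<lambda>n \<omega>. (\<Sum>i<n. ?c \<bullet> x i \<omega>) / real n) 0"
      using x_average_limit[of "\<lambda>z. ?c \<bullet> z"] by (simp add: integrable_x_inner expectation_x_inner)
    have m: "random_variable borel (\<lambda>\<omega>. - 1 * ((\<Sum>i<n. T n i \<omega> * (?c \<bullet> x i \<omega>)) / real n))" for n
      by (intro borel_measurable_times borel_measurable_const mTx)
    have "tendsto_in_prob M (\<lambda>n \<omega>. (\<Sum>i<n. ?c \<bullet> x i \<omega>) / real n +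
        - 1 * ((\<Sum>i<n. T n i \<omega> * (?c \<bullet> x i \<omega>)) / real n)) (0 + - 1 * 0)"
      by (rule tendsto_in_prob_add[OF _ m 2 tendsto_in_prob_cmult[OF treated_covariate_average]]) measurable
    then show ?thesis
      by (simp add: design_nth x_axis diag_mat_def left_diff_distrib sum_subtractf diff_divide_distrib)
  qed
  have XX: "?P (Inr j) (Inr l)" for j l
  proof -
    have e: "expectation (\<lambda>\<omega>. (axis (inc j) 1 \<bullet> x 0 \<omega>) * (axis (inc l) 1 \<bullet> x 0 \<omega>)) = diag_mat limit_diag $ Inr j $ Inr l"
    proof -
      have "(\<Sum>i\<in>UNIV. axis (inc j) 1 $ i * axis (inc l) 1 $ i * second_moment i) =
          (\<Sum>i\<in>UNIV. if i = inc j then (if j = l then second_moment (inc j) else 0) else 0)"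
        by (rule sum.cong) (auto simp: axis_def inj_eq[OF inj_inc])
      then show ?thesis
        by (simp add: expectation_x_inner_mult diag_mat_def limit_diag_def)
    qed
    show ?thesis
      using x_average_limit[of "\<lambda>z. (axis (inc j) 1 \<bullet> z) * (axis (inc l) 1 \<bullet> z)"] integrable_x_inner_mult
      by (simp add: e design_nth x_axis)
  qed
  have "?P a b" for a b
  proof (cases a)
    case (Inl s)
    then show ?thesis
    proof (cases b)
      case (Inl t)
      with \<open>a = Inl s\<close> show ?thesis using TT FF TF sym[OF TF] by (cases s; cases t) auto
    next
      case (Inr l)
      with \<open>a = Inl s\<close> show ?thesis using TX FX by (cases s) auto
    qed
  next
    case (Inr j)
    then show ?thesis
    proof (cases b)
      case (Inl t)
      with \<open>a = Inr j\<close> show ?thesis using sym[OF TX[of j]] sym[OF FX[of j]] by (cases t) auto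
    next
      case (Inr l)
      with \<open>a = Inr j\<close> show ?thesis using XX by auto
    qed
  qed
  then show ?thesis .
qed

lemma gram_limit:
  "tendsto_in_prob M (\<lambda>n \<omega>. norm ((1 / real n) *\<^sub>R gram n (design n \<omega>) - diag_mat limit_diag)) 0"
proof (intro tendsto_in_prob_norm_vec)
  fix a b
  show "tendsto_in_prob M (\<lambda>n \<omega>. norm (((1 / real n) *\<^sub>R gram n (design n \<omega>)) $ a $ b - diag_mat limit_diag $ a $ b)) 0"
    unfolding tendsto_in_prob_norm_real using gram_entry_limit[of a b] by (simp add: gram_def)
next
  fix a n
  have "(\<lambda>\<omega>. ((1 / real n) *\<^sub>R gram n (design n \<omega>)) $ a) \<in> borel_measurable M"
    unfolding borel_measurable_vec_iff by simp
  then show "random_variable borel (\<lambda>\<omega>. norm (((1 / real n) *\<^sub>R gram n (design n \<omega>)) $ a - diag_mat limit_diag $ a))"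
    by measurable
qed simp

text \<open>In the treatment entries the noise part is controlled by independence of the design, but
  the omitted covariates in the error may influence the assignments. Their part is tight because the
  balance condition extends to the omitted coordinates.\<close>

lemma score_vec_bounded: "bounded_in_prob M (score \<beta>)"
proof (rule bounded_in_prob_vec)
  let ?d = "omitted \<beta>"
  let ?u = "\<lambda>i \<omega>. \<epsilon> i \<omega> + ?d \<bullet> x i \<omega>"
  have nth: "score \<beta> n \<omega> $ a = (1 / sqrt (real n)) * (\<Sum>i<n. design n \<omega> i $ a * ?u i \<omega>)" for n \<omega> a
    by (simp add: score_def cross_moment_def)
  have U: "bounded_in_prob M (\<lambda>n \<omega>. (1 / sqrt (real n)) * (\<Sum>i<n. ?u i \<omega>))"
    using score_bounded[of 0 ?d 1] by simp
  have dx: "bounded_in_prob M (\<lambda>n \<omega>. (1 / sqrt (real n)) * (\<Sum>i<n. ?d \<bullet> x i \<omega>))"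
  proof (rule normalized_sum_bounded_in_prob)
    show "indep_vars (\<lambda>_. borel) (\<lambda>i \<omega>. ?d \<bullet> x i \<omega>) UNIV"
      by (rule indep_vars_compose2[OF x_indep]) measurable
    show "integrable M (\<lambda>\<omega>. (?d \<bullet> x i \<omega>)\<^sup>2)" for i
      using integrable_x_inner_mult[of ?d i ?d] by (simp add: power2_eq_square)
    show "expectation (\<lambda>\<omega>. (?d \<bullet> x i \<omega>)\<^sup>2) \<le> (\<Sum>j\<in>UNIV. ?d $ j * ?d $ j * second_moment j)" for i
      using expectation_x_inner_mult[of ?d i ?d] by (simp add: power2_eq_square)
  qed (rule expectation_x_inner)
  have TU: "bounded_in_prob M (\<lambda>n \<omega>. (1 / sqrt (real n)) * (\<Sum>i<n. T n i \<omega> * ?u i \<omega>))"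
  proof -
    \<comment> \<open>Only the omitted-covariate part is expressed through the imbalance, by
      \<open>T = ((2 * T - 1) + 1) / 2\<close>.\<close>
    have eq: "(1 / sqrt (real n)) * (\<Sum>i<n. T n i \<omega> * ?u i \<omega>) =
        (1 / sqrt (real n)) * (\<Sum>i<n. T n i \<omega> * \<epsilon> i \<omega>) +
        (1 / 2) * (?d \<bullet> imbalance n \<omega> + (1 / sqrt (real n)) * (\<Sum>i<n. ?d \<bullet> x i \<omega>))" for n \<omega>
    proof -
      have "(\<Sum>i<n. (2 * T n i \<omega> - 1) * (?d \<bullet> x i \<omega>)) = 2 * (\<Sum>i<n. T n i \<omega> * (?d \<bullet> x i \<omega>)) - (\<Sum>i<n. ?d \<bullet> x i \<omega>)"
        by (simp add: left_diff_distrib sum_subtractf sum_distrib_left mult.assoc)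
      then have *: "(\<Sum>i<n. T n i \<omega> * (?d \<bullet> x i \<omega>)) =
          (1 / 2) * ((\<Sum>i<n. (2 * T n i \<omega> - 1) * (?d \<bullet> x i \<omega>)) + (\<Sum>i<n. ?d \<bullet> x i \<omega>))"
        by simp
      show ?thesis
        unfolding imbalance_inner distrib_left[of "T n _ \<omega>"] sum.distrib * by (simp add: algebra_simps)
    qed
    have m: "random_variable borel (\<lambda>\<omega>. (1 / sqrt (real n)) * (\<Sum>i<n. T n i \<omega> * \<epsilon> i \<omega>))" for n
      by (intro borel_measurable_times borel_measurable_const T_sum_measurable) measurable
    show ?thesis
      unfolding eq
      by (intro bounded_in_prob_add m treated_noise_bounded bounded_in_prob_cmult imbalance_inner_bounded dx) measurable
  qed
  have mTU: "random_variable borel (\<lambda>\<omega>. (1 / sqrt (real n)) * (\<Sum>i<n. T n i \<omega> * ?u i \<omega>))" for n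
    by (intro borel_measurable_times borel_measurable_const T_sum_measurable) measurable
  fix a
  show "bounded_in_prob M (\<lambda>n \<omega>. score \<beta> n \<omega> $ a)"
  proof (cases a)
    case (Inr j)
    have "bounded_in_prob M (\<lambda>n \<omega>. (1 / sqrt (real n)) * (\<Sum>i<n. (0 + axis (inc j) 1 \<bullet> x i \<omega>) * ?u i \<omega>))"
      by (rule score_bounded) (auto simp: omitted_def axis_def)
    then show ?thesis by (simp add: Inr nth design_nth inner_axis')
  next
    case (Inl t)
    \<comment> \<open>The control entry is the full sum of errors minus the treated entry.\<close>
    have "bounded_in_prob M (\<lambda>n \<omega>. (1 / sqrt (real n)) * (\<Sum>i<n. ?u i \<omega>) +
        - 1 * ((1 / sqrt (real n)) * (\<Sum>i<n. T n i \<omega> * ?u i \<omega>)))"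
      by (intro bounded_in_prob_add U bounded_in_prob_cmult TU mTU borel_measurable_times borel_measurable_const) measurable
    then have F: "bounded_in_prob M (\<lambda>n \<omega>. (1 / sqrt (real n)) * (\<Sum>i<n. (1 - T n i \<omega>) * ?u i \<omega>))"
      by (simp add: left_diff_distrib sum_subtractf right_diff_distrib diff_divide_distrib)
    show ?thesis using F TU by (cases t) (simp_all add: Inl nth design_nth)
  qed
qed measurable

end

end

section \<open>Limit law of the test statistic\<close>

lemma real_distribution_transform:
  assumes "real_distribution m" and [measurable]: "g \<in> borel_measurable borel"
  shows "real_distribution (distr m borel g)"
proof -
  interpret real_distribution m by fact
  show ?thesis by (rule real_distribution_distr) measurable
qed

lemma weak_conv_m_continuous_mapping:
  fixes \<mu> :: "nat \<Rightarrow> real measure" and g :: "real \<Rightarrow> real"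
  assumes \<mu>: "\<And>n. real_distribution (\<mu> n)" and \<nu>: "real_distribution \<nu>"
    and conv: "weak_conv_m \<mu> \<nu>" and g: "\<And>x. isCont g x"
  shows "weak_conv_m (\<lambda>n. distr (\<mu> n) borel g) (distr \<nu> borel g)"
proof (rule integral_bdd_continuous_conv_imp_weak_conv)
  have [measurable]: "g \<in> borel_measurable borel"
    using g by (intro borel_measurable_continuous_onI) (simp add: continuous_on_eq_continuous_at)
  have meas: "g \<in> borel_measurable m" if "real_distribution m" for m
  proof -
    interpret real_distribution m by (rule that)
    show ?thesis by measurable
  qed
  show "real_distribution (distr (\<mu> n) borel g)" for n
    by (rule real_distribution_transform[OF \<mu>]) measurable
  show "real_distribution (distr \<nu> borel g)"
    by (rule real_distribution_transform[OF \<nu>]) measurable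
  fix f :: "real \<Rightarrow> real" assume f: "\<And>x. isCont f x" "\<And>x. \<bar>f x\<bar> \<le> 1"
  have [measurable]: "f \<in> borel_measurable borel"
    using f(1) by (intro borel_measurable_continuous_onI) (simp add: continuous_on_eq_continuous_at)
  have "(\<lambda>n. \<integral>x. f (g x) \<partial>\<mu> n) \<longlonglongrightarrow> (\<integral>x. f (g x) \<partial>\<nu>)"
    by (rule weak_conv_imp_integral_bdd_continuous_conv[OF \<mu> \<nu> conv, of _ 1])
      (use f g in \<open>auto intro: isCont_o2\<close>)
  then show "(\<lambda>n. integral\<^sup>L (distr (\<mu> n) borel g) f) \<longlonglongrightarrow> integral\<^sup>L (distr \<nu> borel g) f"
    using meas[OF \<mu>] meas[OF \<nu>] by (simp add: integral_distr)
qed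

text \<open>Inversion is Borel on all matrices, singular ones included, so the statistic is
  measurable for every \<open>n\<close>, even where it is degenerate.\<close>

lemma borel_measurable_S_star:
  assumes G: "\<And>i. i < n \<Longrightarrow> (\<lambda>\<omega>. G \<omega> i) \<in> borel_measurable M"
    and Y: "\<And>i. i < n \<Longrightarrow> (\<lambda>\<omega>. Y \<omega> i) \<in> borel_measurable M"
  shows "(\<lambda>\<omega>. S_star C c\<^sub>0 n (G \<omega>) (Y \<omega>)) \<in> borel_measurable M"
proof -
  have [measurable]: "(\<lambda>\<omega>. gram n (G \<omega>)) \<in> borel_measurable M"
    unfolding gram_def using G
    by (auto intro!: borel_measurable_vec_lambda borel_measurable_sum borel_measurable_times borel_measurable_vec_nth)
  have [measurable]: "(\<lambda>\<omega>. cross_moment n (G \<omega>) (Y \<omega>)) \<in> borel_measurable M"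
    unfolding cross_moment_def using G Y
    by (auto intro!: borel_measurable_vec_lambda borel_measurable_sum borel_measurable_times borel_measurable_vec_nth)
  have ols [measurable]: "(\<lambda>\<omega>. ols n (G \<omega>) (Y \<omega>)) \<in> borel_measurable M"
    unfolding ols_def by measurable
  have [measurable]: "(\<lambda>\<omega>. sigma_hat2 n (G \<omega>) (Y \<omega>)) \<in> borel_measurable M"
    unfolding sigma_hat2_def using G Y ols
    by (auto intro!: borel_measurable_divide borel_measurable_sum borel_measurable_power borel_measurable_diff borel_measurable_inner)
  show ?thesis unfolding S_star_def Let_def by measurable
qed

context covariate_adaptive_design
begin

lemma S_star_n_measurable: "random_variable borel (S_star_n inc T x \<epsilon> C c\<^sub>0 \<mu>\<^sub>1 \<mu>\<^sub>2 \<beta> n)"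
  unfolding S_star_n_def
proof (rule borel_measurable_S_star)
  fix i assume i: "i < n"
  show "random_variable borel (\<lambda>\<omega>. design_row inc (T n i \<omega>) (x i \<omega>))"
    using design_measurable[OF i] by (simp add: design_def)
  note [measurable] = T_measurable[OF i]
  show "random_variable borel (\<lambda>\<omega>. outcome \<mu>\<^sub>1 \<mu>\<^sub>2 \<beta> (T n i \<omega>) (x i \<omega>) (\<epsilon> i \<omega>))"
    unfolding outcome_def by measurable
qed

lemma outcome_eq_design:
  "outcome \<mu>\<^sub>1 \<mu>\<^sub>2 \<beta> (T n i \<omega>) (x i \<omega>) (\<epsilon> i \<omega>) =
    design n \<omega> i \<bullet> theta inc \<mu>\<^sub>1 \<mu>\<^sub>2 \<beta> + (\<epsilon> i \<omega> + omitted \<beta> \<bullet> x i \<omega>)"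
proof -
  have plus: "(UNIV :: (bool + 'p) set) = Inl ` UNIV \<union> Inr ` UNIV" by (auto simp: UNIV_sum)
  have "(\<Sum>j\<in>UNIV. \<beta> $ j * x i \<omega> $ j) =
      (\<Sum>j\<in>range inc. \<beta> $ j * x i \<omega> $ j) + (\<Sum>j\<in>- range inc. \<beta> $ j * x i \<omega> $ j)"
    by (subst sum.union_disjoint[symmetric]) auto
  also have "(\<Sum>j\<in>range inc. \<beta> $ j * x i \<omega> $ j) = (\<Sum>j\<in>UNIV. \<beta> $ inc j * x i \<omega> $ inc j)"
    by (simp add: sum.reindex[OF inj_inc])
  also have "(\<Sum>j\<in>- range inc. \<beta> $ j * x i \<omega> $ j) = omitted \<beta> \<bullet> x i \<omega>"
    unfolding inner_vec_def by (rule sum.mono_neutral_cong_left) (auto simp: omitted_def)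
  finally have "(\<Sum>j\<in>UNIV. \<beta> $ j * x i \<omega> $ j) =
      (\<Sum>j\<in>UNIV. \<beta> $ inc j * x i \<omega> $ inc j) + omitted \<beta> \<bullet> x i \<omega>" .
  moreover have "design n \<omega> i \<bullet> theta inc \<mu>\<^sub>1 \<mu>\<^sub>2 \<beta> =
      T n i \<omega> * \<mu>\<^sub>1 + (1 - T n i \<omega>) * \<mu>\<^sub>2 + (\<Sum>j\<in>UNIV. x i \<omega> $ inc j * \<beta> $ inc j)"
    unfolding inner_vec_def plus
    by (subst sum.union_disjoint)
      (auto simp: sum.reindex design_nth theta_def UNIV_bool)
  ultimately show ?thesis by (simp add: outcome_def mult.commute)
qed

text \<open>A combination without treatment entries is a normalised sum of i.i.d. terms that do not
  involve \<open>T\<close>. Its variance factors into that of the error and the quadratic form of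
  the limiting Gram matrix.\<close>

lemma score_char_limit:
  fixes q :: "real^(bool + 'p)"
  assumes q: "\<And>b. q $ Inl b = 0"
  shows "(\<lambda>n. \<integral>\<omega>. iexp (q \<bullet> score \<beta> n \<omega>) \<partial>M) \<longlonglongrightarrow>
    exp (- (sigma_w2 M inc X \<beta> \<sigma>\<^sub>\<epsilon>2 * (q \<bullet> (diag_mat limit_diag *v q))) / 2)"
\<comment> \<open>The zero vector is treated apart because \<open>clt_char\<close> asks for a
  positive variance.\<close>
proof (cases "q = 0")
  case True
  then show ?thesis by (simp add: prob_space)
next
  case False
  \<comment> \<open>The covariate part of \<open>q\<close> transported to the index type of all
    covariates, so that \<open>c \<bullet> x i \<omega> = design n \<omega> i \<bullet> q\<close>.
    It vanishes outside the range of \<open>inc\<close>, hence is disjoint from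
    \<open>omitted \<beta>\<close>.\<close>
  define c where "c = (\<Sum>j\<in>UNIV. q $ Inr j *\<^sub>R axis (inc j) (1::real))"
  have plus: "(UNIV :: (bool + 'p) set) = Inl ` UNIV \<union> Inr ` UNIV" by (auto simp: UNIV_sum)
  have sum_plus: "(\<Sum>a\<in>UNIV. f a) = (\<Sum>b\<in>UNIV. f (Inl b)) + (\<Sum>j\<in>UNIV. f (Inr j))" for f :: "bool + 'p \<Rightarrow> real"
    unfolding plus by (subst sum.union_disjoint) (auto simp: sum.reindex)
  have c_nth: "c $ inc j = q $ Inr j" for j
  proof -
    have "c $ inc j = (\<Sum>i\<in>UNIV. if i = j then q $ Inr j else 0)"
      unfolding c_def sum_component by (rule sum.cong) (auto simp: axis_def inj_eq[OF inj_inc])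
    then show ?thesis by simp
  qed
  have c_out: "c $ k = 0" if "k \<notin> range inc" for k
    unfolding c_def sum_component by (rule sum.neutral) (use that in \<open>auto simp: axis_def\<close>)
  let ?r = "\<lambda>i \<omega>. (0 + c \<bullet> x i \<omega>) * (\<epsilon> i \<omega> + omitted \<beta> \<bullet> x i \<omega>)"
  have disj: "c $ j = 0 \<or> omitted \<beta> $ j = 0" for j
    using c_out[of j] by (auto simp: omitted_def)
  let ?D = "q \<bullet> (diag_mat limit_diag *v q)"
  have D_sum: "?D = (\<Sum>j\<in>UNIV. (q $ Inr j)\<^sup>2 * second_moment (inc j))"
    unfolding inner_vec_def sum_plus by (simp add: q diag_mat_vector limit_diag_def power2_eq_square mult_ac)
  have "(\<Sum>k\<in>UNIV. (c $ k)\<^sup>2 * second_moment k) = (\<Sum>k\<in>range inc. (c $ k)\<^sup>2 * second_moment k)"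
    by (rule sum.mono_neutral_right) (auto simp: c_out)
  also have "\<dots> = ?D" by (simp add: sum.reindex[OF inj_inc] c_nth D_sum)
  finally have cD: "(\<Sum>k\<in>UNIV. (c $ k)\<^sup>2 * second_moment k) = ?D" .
  have D_pos: "0 < ?D"
  proof -
    from False obtain a where "q $ a \<noteq> 0" by (auto simp: vec_eq_iff)
    then obtain j where "q $ Inr j \<noteq> 0" using q by (cases a) auto
    then show ?thesis
      unfolding D_sum using second_moment_pos
      by (intro sum_pos2[of _ j]) (auto intro: less_imp_le)
  qed
  define s where "s = sqrt (sigma_w2 M inc X \<beta> \<sigma>\<^sub>\<epsilon>2 * ?D)"
  have s: "0 < s" "s\<^sup>2 = sigma_w2 M inc X \<beta> \<sigma>\<^sub>\<epsilon>2 * ?D"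
    using D_pos sigma_w2_pos[of \<beta>] by (simp_all add: s_def)
  have "expectation (\<lambda>\<omega>. (?r i \<omega>)\<^sup>2) = s\<^sup>2" for i
    using score_second_moment[OF disj, of 0 i] by (simp add: s(2) cD sigma_w2_eq mult.commute)
  then have "(\<lambda>n. \<integral>\<omega>. iexp ((1 / sqrt (real n)) * (\<Sum>i<n. ?r i \<omega>)) \<partial>M) \<longlonglongrightarrow> complex_of_real (exp (- s\<^sup>2 / 2))"
    by (intro clt_char score_indep score_distr score_mean[OF disj] score_square_integrable[OF disj] s(1))
  moreover have "(1 / sqrt (real n)) * (\<Sum>i<n. ?r i \<omega>) = q \<bullet> score \<beta> n \<omega>" for n \<omega>
  proof -
    have cx: "c \<bullet> x i \<omega> = design n \<omega> i \<bullet> q" for i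
    proof -
      have "c \<bullet> x i \<omega> = (\<Sum>j\<in>UNIV. q $ Inr j * x i \<omega> $ inc j)"
        by (simp add: c_def inner_sum_left inner_axis')
      also have "\<dots> = design n \<omega> i \<bullet> q"
        unfolding inner_vec_def sum_plus by (simp add: q design_nth mult.commute)
      finally show ?thesis .
    qed
    have "q \<bullet> score \<beta> n \<omega> = (1 / sqrt (real n)) * (cross_moment n (design n \<omega>) (\<lambda>i. \<epsilon> i \<omega> + omitted \<beta> \<bullet> x i \<omega>) \<bullet> q)"
      by (simp add: score_def inner_commute)
    also have "\<dots> = (1 / sqrt (real n)) * (\<Sum>i<n. ?r i \<omega>)"
      unfolding cross_moment_inner by (simp add: cx mult.commute)
    finally show ?thesis by simp
  qed
  ultimately show ?thesis by (simp only: s(2))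
qed

context
  fixes N :: "'b measure" and \<xi> :: "'b \<Rightarrow> real^'k"
  assumes A1: "tendsto_in_prob M (\<lambda>n \<omega>. (\<Sum>i<n. (2 * T n i \<omega> - 1)) / real n) 0"
    and N: "prob_space N" and \<xi>: "\<xi> \<in> borel_measurable N"
    and A2: "tendsto_in_distr M
      (\<lambda>n \<omega>. (1 / sqrt (real n)) *\<^sub>R (\<Sum>i<n. (2 * T n i \<omega> - 1) *\<^sub>R x i \<omega>)) N \<xi>"
begin

text \<open>The parameters may vary with \<open>n\<close>, except for the omitted coefficients,
  which fix the error and its variance. Constant parameters with \<open>\<Delta> = 0\<close> give
  the null hypothesis.\<close>

theorem S_star_weak_limit:
  fixes C :: "real^(bool + 'p)^'m::finite" and \<Delta> c\<^sub>0 :: "real^'m"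
    and m\<^sub>1 m\<^sub>2 :: "nat \<Rightarrow> real" and b :: "nat \<Rightarrow> real^'k"
  assumes rank: "rank C = CARD('m)" and zero: "\<And>r b. C $ r $ Inl b = 0"
    and b: "\<And>n j. j \<notin> range inc \<Longrightarrow> b n $ j = \<beta> $ j"
    and \<Delta>: "\<And>n. 0 < n \<Longrightarrow> C *v theta inc (m\<^sub>1 n) (m\<^sub>2 n) (b n) - c\<^sub>0 = (1 / sqrt (real n)) *\<^sub>R \<Delta>"
  shows "weak_conv_m (\<lambda>n. distr M borel (S_star_n inc T x \<epsilon> C c\<^sub>0 (m\<^sub>1 n) (m\<^sub>2 n) (b n) n))
    (distr (noncentral_chi_squared TYPE('m)
        (\<Delta> \<bullet> (matrix_inv (C ** matrix_inv (V_matrix M inc X) ** transpose C) *v \<Delta>)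
           / sigma_w2 M inc X \<beta> \<sigma>\<^sub>\<epsilon>2))
      borel (\<lambda>s. s / real CARD('m)))"
proof -
  define V where "V = diag_mat limit_diag"
  define W where "W = diag_mat (\<lambda>a. 1 / limit_diag a)"
  define s2 where "s2 = sigma_w2 M inc X \<beta> \<sigma>\<^sub>\<epsilon>2"
  have s2: "0 < s2" by (simp add: s2_def sigma_w2_pos)
  have ld: "limit_diag a \<noteq> 0" for a using limit_diag_pos[of a] by simp
  have V_inv: "matrix_inv V = W" unfolding V_def W_def by (rule matrix_inv_diag_mat[OF ld])
  have V_det: "det V \<noteq> 0" unfolding V_def by (rule det_diag_mat[OF ld])
  have pos: "0 < 1 / limit_diag a" for a using limit_diag_pos[of a] by simp
  obtain P :: "real^'m^'m" where "P ** (C ** diag_mat (\<lambda>a. 1 / limit_diag a) ** transpose C) ** transpose P = mat 1"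
    by (rule whitening_exists[OF rank, where d="\<lambda>a. 1 / limit_diag a", OF pos])
  note P = this[folded W_def]
  have A_det: "det (C ** matrix_inv V ** transpose C) \<noteq> 0"
    unfolding V_inv invertible_det_nz[symmetric] by (rule whitening_inverse(2)[OF P])
  note quad = whitening_quadratic_form[OF P]

  \<comment> \<open>The mean of the whitened Gaussian limit; by \<open>quad\<close> its squared norm
    is the non-centrality parameter.\<close>
  define v where "v = (1 / sqrt s2) *\<^sub>R (P *v \<Delta>)"
  \<comment> \<open>Chosen so that \<open>wald_form\<close> at the limiting averages is the squared
    norm of \<open>R z\<close> divided by \<open>real CARD('m)\<close>.\<close>
  define R where "R z = (1 / sqrt s2) *\<^sub>R (P *v (C *v (W *v z))) + v" for z
  have [measurable]: "R \<in> borel_measurable borel" unfolding R_def by measurable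
  have R_char: "(\<lambda>n. \<integral>\<omega>. iexp (t \<bullet> R (score \<beta> n \<omega>)) \<partial>M) \<longlonglongrightarrow> (\<integral>z. iexp (t \<bullet> z) \<partial>normal_vec v)" for t
  proof -
    \<comment> \<open>The adjoint of the linear part of \<open>R\<close> applied to
      \<open>t\<close>. Its treatment entries vanish because those columns of \<open>C\<close> do
      and \<open>W\<close> is diagonal.\<close>
    define q where "q = (1 / sqrt s2) *\<^sub>R (W *v (transpose (P ** C) *v t))"
    have PC: "(P ** C) $ r $ Inl b = 0" for r b
      by (simp add: matrix_matrix_mult_def zero)
    have "(transpose (P ** C) *v t) $ Inl b = 0" for b
      by (simp add: matrix_vector_mult_def transpose_def PC)
    then have qz: "q $ Inl b = 0" for b
      by (simp add: q_def W_def diag_mat_vector)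
    have W_sym: "(W *v y) \<bullet> z = y \<bullet> (W *v z)" for y z
      by (simp add: W_def diag_mat_vector inner_vec_def mult_ac)
    have tr: "t \<bullet> ((P ** C) *v y) = (transpose (P ** C) *v t) \<bullet> y" for y
      by (simp add: dot_lmul_matrix[symmetric])
    have tR: "t \<bullet> R z = q \<bullet> z + t \<bullet> v" for z
    proof -
      have "t \<bullet> (P *v (C *v (W *v z))) = (W *v (transpose (P ** C) *v t)) \<bullet> z"
        by (simp only: matrix_vector_mul_assoc[of P] tr W_sym)
      then show ?thesis by (simp add: R_def q_def inner_add_right)
    qed
    \<comment> \<open>The whitening identity cancels the error variance and the limiting Gram
      matrix, leaving the identity covariance.\<close>
    have "s2 * (q \<bullet> (V *v q)) = (norm t)\<^sup>2"
    proof -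
      have VW: "V *v (W *v y) = y" for y
        using V_inv V_det by (metis invertible_det_nz matrix_inv_invertible(2) matrix_vector_mul_assoc matrix_vector_mul_lid)
      let ?y = "transpose (P ** C) *v t"
      have "s2 * (q \<bullet> (V *v q)) = (W *v ?y) \<bullet> ?y"
        using s2 by (simp add: q_def matrix_vector_mult_scaleR VW)
      also have "\<dots> = t \<bullet> ((P ** C) *v (W *v ?y))" by (simp only: tr inner_commute)
      also have "(P ** C) *v (W *v ?y) = (P ** (C ** W ** transpose C) ** transpose P) *v t"
        by (simp add: matrix_vector_mul_assoc matrix_transpose_mul matrix_mul_assoc)
      finally show ?thesis by (simp add: P power2_norm_eq_inner)
    qed
    then have "(\<lambda>n. \<integral>\<omega>. iexp (q \<bullet> score \<beta> n \<omega>) \<partial>M) \<longlonglongrightarrow> exp (- (norm t)\<^sup>2 / 2)"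
      using score_char_limit[of q \<beta>, OF qz] by (simp add: s2_def V_def)
    then have "(\<lambda>n. iexp (t \<bullet> v) * (\<integral>\<omega>. iexp (q \<bullet> score \<beta> n \<omega>) \<partial>M)) \<longlonglongrightarrow> iexp (t \<bullet> v) * exp (- (norm t)\<^sup>2 / 2)"
      by (rule tendsto_mult_left)
    moreover have "iexp (t \<bullet> v) * (\<integral>\<omega>. iexp (q \<bullet> score \<beta> n \<omega>) \<partial>M) = (\<integral>\<omega>. iexp (t \<bullet> R (score \<beta> n \<omega>)) \<partial>M)" for n
      by (simp add: tR distrib_left exp_add mult.commute flip: integral_mult_right_zero)
    ultimately show ?thesis by (simp add: normal_vec_char)
  qed
  let ?Q = "\<lambda>n \<omega>. (norm (R (score \<beta> n \<omega>)))\<^sup>2"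
  let ?m = "real CARD('m)"
  let ?\<nu> = "distr (normal_vec v) borel (\<lambda>z. (norm z)\<^sup>2)"
  interpret G: prob_space "normal_vec v" by (rule prob_space_normal_vec)
  have rd: "real_distribution (distr M borel (?Q n))" "real_distribution ?\<nu>" for n
    by (intro real_distribution_distr G.real_distribution_distr; measurable)+
  have "weak_conv_m (\<lambda>n. distr M borel (?Q n)) ?\<nu>"
    by (rule char_conv_imp_norm_weak_conv[OF _ prob_space_normal_vec _ R_char]) auto
  from weak_conv_m_continuous_mapping[OF rd this, of "\<lambda>s. s / ?m"]
  have "weak_conv_m (\<lambda>n. distr (distr M borel (?Q n)) borel (\<lambda>s. s / ?m)) (distr ?\<nu> borel (\<lambda>s. s / ?m))"
    by simp
  then have Q_conv: "weak_conv_m (\<lambda>n. distr M borel (\<lambda>\<omega>. ?Q n \<omega> / ?m)) (distr ?\<nu> borel (\<lambda>s. s / ?m))"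
    by (subst (asm) distr_distr) (auto simp: comp_def)

  define H where "H n \<omega> = (1 / real n) *\<^sub>R gram n (design n \<omega>)" for n \<omega>
  define U where "U n \<omega> = (\<Sum>i<n. (\<epsilon> i \<omega> + omitted \<beta> \<bullet> x i \<omega>)\<^sup>2) / real n" for n \<omega>
  define \<kappa> where "\<kappa> n = 1 / real n" for n
  define \<rho> where "\<rho> n = real n / (real n - real CARD('p) - 2)" for n
  let ?A = "\<lambda>n \<omega>. (H n \<omega>, U n \<omega>, \<kappa> n, \<rho> n)" and ?c = "(V, s2, 0::real, 1::real)"
  have H_meas: "random_variable borel (H n)" for n
    unfolding H_def borel_measurable_vec_iff by simp
  have [measurable]: "random_variable borel (\<lambda>\<omega>. norm (H n \<omega> - V))" for n
    using H_meas[of n] by measurable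
  have [measurable]: "random_variable borel (U n)" for n
    unfolding U_def by measurable
  have \<kappa>: "\<kappa> \<longlonglongrightarrow> 0" unfolding \<kappa>_def by (rule lim_1_over_n)
  have \<rho>: "\<rho> \<longlonglongrightarrow> 1" unfolding \<rho>_def
  proof (rule Lim_transform_eventually)
    have "(\<lambda>n. inverse (1 - (real CARD('p) + 2) * (1 / real n))) \<longlonglongrightarrow> inverse (1 - (real CARD('p) + 2) * 0)"
      by (intro tendsto_intros lim_1_over_n) simp
    then show "(\<lambda>n. inverse (1 - (real CARD('p) + 2) * (1 / real n))) \<longlonglongrightarrow> 1" by simp
    show "\<forall>\<^sub>F n in sequentially. inverse (1 - (real CARD('p) + 2) * (1 / real n)) =
        real n / (real n - real CARD('p) - 2)"
      using eventually_gt_at_top[of 0]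
    proof eventually_elim
      case (elim n)
      then have "1 - (real CARD('p) + 2) * (1 / real n) = (real n - real CARD('p) - 2) / real n"
        by (simp add: diff_divide_distrib add_divide_distrib)
      then show ?case by simp
    qed
  qed
  have 1: "tendsto_in_prob M (\<lambda>n \<omega>. norm ((\<kappa> n, \<rho> n) - (0, 1))) 0"
    by (rule tendsto_in_prob_norm_Pair)
      (simp_all only: tendsto_in_prob_norm_real tendsto_in_prob_const \<kappa> \<rho>, auto)
  have "tendsto_in_prob M (\<lambda>n \<omega>. norm (U n \<omega> - s2)) 0"
    unfolding tendsto_in_prob_norm_real U_def s2_def by (rule noise_square_average_limit)
  then have 2: "tendsto_in_prob M (\<lambda>n \<omega>. norm ((U n \<omega>, \<kappa> n, \<rho> n) - (s2, 0, 1))) 0"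
    by (intro tendsto_in_prob_norm_Pair 1) measurable
  have "tendsto_in_prob M (\<lambda>n \<omega>. norm (H n \<omega> - V)) 0"
    unfolding H_def V_def by (rule gram_limit[OF A1 N \<xi> A2])
  then have A_lim: "tendsto_in_prob M (\<lambda>n \<omega>. norm (?A n \<omega> - ?c)) 0"
    by (intro tendsto_in_prob_norm_Pair 2) measurable
  have A_meas: "random_variable borel (\<lambda>\<omega>. norm (?A n \<omega> - ?c))" for n
    using H_meas[of n] by simp

  \<comment> \<open>Both determinants are nonzero at \<open>V\<close> and continuous there, which
    provides the ball on which the algebraic identity for the statistic holds.\<close>
  have "\<exists>r>0. \<forall>K. norm (K - V) < r \<longrightarrow> det K \<noteq> 0 \<and> det (C ** matrix_inv K ** transpose C) \<noteq> 0"
  proof -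
    have id: "((\<lambda>K. K) \<longlongrightarrow> V) (nhds V)" by (simp add: filterlim_def)
    have "\<forall>\<^sub>F K in nhds V. det K \<noteq> 0 \<and> det (C ** matrix_inv K ** transpose C) \<noteq> 0"
      by (intro eventually_conj tendsto_imp_eventually_ne[OF tendsto_det V_det] id
          tendsto_imp_eventually_ne[OF tendsto_det A_det] tendsto_matrix_mult tendsto_matrix_inv V_det tendsto_const)
    then show ?thesis by (auto simp: eventually_nhds_metric dist_norm)
  qed
  then obtain r where r: "0 < r" "\<And>K. norm (K - V) < r \<Longrightarrow> det K \<noteq> 0"
      "\<And>K. norm (K - V) < r \<Longrightarrow> det (C ** matrix_inv K ** transpose C) \<noteq> 0"
    by blast
  \<comment> \<open>Here the local alternatives leave the omitted coefficients fixed, so that the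
    score is built from \<open>\<beta>\<close> for every \<open>n\<close>.\<close>
  have om: "omitted (b n) = omitted \<beta>" for n
    using b by (simp add: omitted_def vec_eq_iff)
  have "tendsto_in_prob M (\<lambda>n \<omega>. S_star_n inc T x \<epsilon> C c\<^sub>0 (m\<^sub>1 n) (m\<^sub>2 n) (b n) n \<omega> - wald_form C \<Delta> ?c (score \<beta> n \<omega>)) 0"
  proof (rule slutsky_substitute[OF A_meas _ _ r(1) _ A_lim score_vec_bounded[OF A1 N \<xi> A2]])
    show "isCont (\<lambda>(a, z). wald_form C \<Delta> a z) (?c, z)" for z
      by (rule isCont_wald_form[OF V_det A_det]) (use s2 in simp)
    fix n \<omega> assume n: "0 < n" and "norm (?A n \<omega> - ?c) < r"
    moreover have "norm (H n \<omega> - V) \<le> norm (?A n \<omega> - ?c)"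
      using norm_fst_le[of "H n \<omega> - V" "(U n \<omega> - s2, \<kappa> n, \<rho> n - 1)"] by simp
    ultimately have near: "norm (H n \<omega> - V) < r" by simp
    show "S_star_n inc T x \<epsilon> C c\<^sub>0 (m\<^sub>1 n) (m\<^sub>2 n) (b n) n \<omega> = wald_form C \<Delta> (?A n \<omega>) (score \<beta> n \<omega>)"
      unfolding S_star_n_def U_def \<kappa>_def \<rho>_def design_def[symmetric]
      by (rule S_star_eq_wald_form[OF n _ \<Delta>[OF n] _ _ r(2)[OF near] r(3)[OF near]])
        (simp_all add: outcome_eq_design om H_def score_def)
  qed measurable
  moreover have "wald_form C \<Delta> ?c z = (norm (R z))\<^sup>2 / ?m" for z
  proof -
    have "R z = (1 / sqrt s2) *\<^sub>R (P *v (C *v (W *v z) + \<Delta>))"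
      by (simp add: R_def v_def matrix_vector_right_distrib scaleR_add_right)
    then have "(norm (R z))\<^sup>2 = (norm (P *v (C *v (W *v z) + \<Delta>)))\<^sup>2 / s2"
      using s2 by (simp add: power_divide)
    then show ?thesis by (simp add: wald_form_def V_inv quad)
  qed
  ultimately have diff: "tendsto_in_prob M (\<lambda>n \<omega>. S_star_n inc T x \<epsilon> C c\<^sub>0 (m\<^sub>1 n) (m\<^sub>2 n) (b n) n \<omega> - ?Q n \<omega> / ?m) 0"
    by simp
  have "real_distribution (distr ?\<nu> borel (\<lambda>s. s / ?m))"
    by (rule real_distribution_transform[OF rd(2)]) measurable
  then have "weak_conv_m (\<lambda>n. distr M borel (S_star_n inc T x \<epsilon> C c\<^sub>0 (m\<^sub>1 n) (m\<^sub>2 n) (b n) n))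
      (distr ?\<nu> borel (\<lambda>s. s / ?m))"
    by (intro weak_conv_slutsky[OF _ S_star_n_measurable _ Q_conv diff]) measurable
  moreover have "noncentral_chi_squared TYPE('m)
        (\<Delta> \<bullet> (matrix_inv (C ** matrix_inv (V_matrix M inc X) ** transpose C) *v \<Delta>) / sigma_w2 M inc X \<beta> \<sigma>\<^sub>\<epsilon>2) = ?\<nu>"
  proof (rule noncentral_chi_squared_eq)
    show "(norm v)\<^sup>2 = \<Delta> \<bullet> (matrix_inv (C ** matrix_inv (V_matrix M inc X) ** transpose C) *v \<Delta>) / sigma_w2 M inc X \<beta> \<sigma>\<^sub>\<epsilon>2"
      using s2 by (simp add: V_matrix_eq V_def[symmetric] V_inv quad v_def power_divide s2_def[symmetric])
  qed
  ultimately show ?thesis by simp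
qed

end

end

theorem theorem3p5:
  fixes M :: "'a measure" and N :: "'b measure"
    and inc :: "'p::finite \<Rightarrow> 'k::finite"
    and T :: "nat \<Rightarrow> nat \<Rightarrow> 'a \<Rightarrow> real"
    and x :: "nat \<Rightarrow> 'a \<Rightarrow> real^'k"
    and X :: "'k \<Rightarrow> 'a \<Rightarrow> real"
    and \<epsilon> :: "nat \<Rightarrow> 'a \<Rightarrow> real"
    and \<sigma>\<^sub>\<epsilon>2 \<mu>\<^sub>1 \<mu>\<^sub>2 :: real
    and \<beta> :: "real^'k"
    and \<xi> :: "'b \<Rightarrow> real^'k"
    and C :: "real^(bool + 'p)^'m::finite"
    and c\<^sub>0 :: "real^'m"
  assumes design: "covariate_adaptive_design M inc T x X \<epsilon> \<sigma>\<^sub>\<epsilon>2"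
    and A1: "tendsto_in_prob M (\<lambda>n \<omega>. (\<Sum>i<n. (2 * T n i \<omega> - 1)) / real n) 0"
    and xi: "prob_space N" "integrable N \<xi>" "(\<integral>\<omega>. \<xi> \<omega> \<partial>N) = 0"
    and A2: "tendsto_in_distr M
               (\<lambda>n \<omega>. (1 / sqrt (real n)) *\<^sub>R (\<Sum>i<n. (2 * T n i \<omega> - 1) *\<^sub>R x i \<omega>)) N \<xi>"
    and C_rank: "rank C = CARD('m)" "CARD('m) \<le> CARD('p)"
    and C_zero: "\<And>r b. C $ r $ Inl b = 0"
  shows "(C *v theta inc \<mu>\<^sub>1 \<mu>\<^sub>2 \<beta> = c\<^sub>0 \<longrightarrow>
            weak_conv_m (\<lambda>n. distr M borel (S_star_n inc T x \<epsilon> C c\<^sub>0 \<mu>\<^sub>1 \<mu>\<^sub>2 \<beta> n))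
              (distr (chi_squared TYPE('m)) borel (\<lambda>s. s / real CARD('m))))
       \<and> (\<forall>(\<Delta> :: real^'m) (c\<^sub>1 :: nat \<Rightarrow> real^'m) (m\<^sub>1 :: nat \<Rightarrow> real) (m\<^sub>2 :: nat \<Rightarrow> real)
             (b :: nat \<Rightarrow> real^'k).
            \<Delta> \<noteq> 0 \<and>
            (\<forall>n. \<forall>j\<in>- range inc. b n $ j = \<beta> $ j) \<and>
            (\<forall>n>0. C *v theta inc (m\<^sub>1 n) (m\<^sub>2 n) (b n) = c\<^sub>1 n) \<and>
            (\<forall>n>0. c\<^sub>1 n - c\<^sub>0 = (1 / sqrt (real n)) *\<^sub>R \<Delta>) \<longrightarrow>
            weak_conv_m (\<lambda>n. distr M borel (S_star_n inc T x \<epsilon> C c\<^sub>0 (m\<^sub>1 n) (m\<^sub>2 n) (b n) n))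
              (distr (noncentral_chi_squared TYPE('m)
                  (\<Delta> \<bullet> (matrix_inv (C ** matrix_inv (V_matrix M inc X) ** transpose C) *v \<Delta>)
                     / sigma_w2 M inc X \<beta> \<sigma>\<^sub>\<epsilon>2))
                borel (\<lambda>s. s / real CARD('m))))"
proof -
  interpret covariate_adaptive_design M inc T x X \<epsilon> \<sigma>\<^sub>\<epsilon>2 by (rule design)
  note limit = S_star_weak_limit[OF A1 xi(1) borel_measurable_integrable[OF xi(2)] A2 C_rank(1) C_zero]
  \<comment> \<open>The zero vector realises the non-centrality parameter 0.\<close>
  have central: "noncentral_chi_squared TYPE('m) 0 = chi_squared TYPE('m)"
    unfolding chi_squared_def by (rule noncentral_chi_squared_eq) simp
  show ?thesis
  proof (intro conjI impI allI)
    assume "C *v theta inc \<mu>\<^sub>1 \<mu>\<^sub>2 \<beta> = c\<^sub>0"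
    then show "weak_conv_m (\<lambda>n. distr M borel (S_star_n inc T x \<epsilon> C c\<^sub>0 \<mu>\<^sub>1 \<mu>\<^sub>2 \<beta> n))
        (distr (chi_squared TYPE('m)) borel (\<lambda>s. s / real CARD('m)))"
      \<comment> \<open>Under the null hypothesis the shift is \<open>\<Delta> = 0\<close> with
        constant parameters, so the quadratic form defining the non-centrality is 0.\<close>
      using limit[of "\<lambda>_. \<beta>" \<beta> "\<lambda>_. \<mu>\<^sub>1" "\<lambda>_. \<mu>\<^sub>2" c\<^sub>0 0] by (simp add: central)
  next
    fix \<Delta> c\<^sub>1 m\<^sub>1 m\<^sub>2 b
    assume *: "\<Delta> \<noteq> 0 \<and> (\<forall>n. \<forall>j\<in>- range inc. b n $ j = \<beta> $ j) \<and>
      (\<forall>n>0. C *v theta inc (m\<^sub>1 n) (m\<^sub>2 n) (b n) = c\<^sub>1 n) \<and>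
      (\<forall>n>0. c\<^sub>1 n - c\<^sub>0 = (1 / sqrt (real n)) *\<^sub>R \<Delta>)"
    show "weak_conv_m (\<lambda>n. distr M borel (S_star_n inc T x \<epsilon> C c\<^sub>0 (m\<^sub>1 n) (m\<^sub>2 n) (b n) n))
        (distr (noncentral_chi_squared TYPE('m)
            (\<Delta> \<bullet> (matrix_inv (C ** matrix_inv (V_matrix M inc X) ** transpose C) *v \<Delta>)
               / sigma_w2 M inc X \<beta> \<sigma>\<^sub>\<epsilon>2))
          borel (\<lambda>s. s / real CARD('m)))"
      by (rule limit) (use * in auto)
  qed
qed

end
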